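(* Let $n\ge 2$ and let $I$ be a nonempty subset of $\rho_{\mathbf{SPS}}$ composed of non-trivial pairs, all with 2-content $D_n$. Then $I$ is equivalent either to a single pair from $$I_n=\{(\alpha_{n,k,i},\beta_{n,k,i}),\ (\alpha^*_{n,k,j},\beta^*_{n,k,j})\mid k\geq 1,\ 1\leq i,j\leq 2n,\ j\text{ odd}\},$$ or to a subset $\{(\alpha_{n,k,i},\beta_{n,k,i}),(\alpha^*_{n,k,i},\beta^*_{n,k,i})\}$ of $I_n$ for some $k\ge1$ and some odd $i$ with $1\le i\le 2n$.
   Context: $X$ is a countably infinite set of letters containing distinct letters $x_1,x_2,\dots$. Bi-rooted trees. $\mathfrak B'(X)$ is the set of finite trees (up to isomorphism) with at least two vertices, all vertices labelled by letters of $X$, with an ordered pair of adjacent distinguished vertices (left root, right root). Vertices at even distance from the left root are left vertices, the others right vertices; each edge is written $(a,b)$ with $a$ left and $b$ right. For $\alpha,\beta\in\mathfrak B'(X)$, $\alpha\sqcap\beta$ is the disjoint union of $\alpha$ and $\beta$ with an added edge joining the left root of $\alpha$ to the right root of $\beta$; these two vertices are the left and the right root of $\alpha\sqcap\beta$. A thorn is a degree-one vertex $a$ together with its edge $e$, such that both endpoints of $e$ have the same label; it is essential if $a$ is a root, non-essential otherwise. Reductions: (i) delete a non-essential thorn; (ii) edge-folding: if two distinct vertices with the same label have a common neighbour, merge them (and the two edges to the common neighbour), keeping the label, the merged vertex being a root if one of the merged vertices was. A tree is reduced if no reduction applies; each $\gamma\in\mathfrak B'(X)$ has a unique reduced form $\overline\gamma$.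 $\mathfrak A(X)$ is the set of reduced trees in $\mathfrak B'(X)$, with operation $\alpha\wedge\beta=\overline{\alpha\sqcap\beta}$; it is the free pseudosemilattice on $X$, with $x\in X$ identified with the single edge both of whose endpoints are labelled $x$. (A pseudosemilattice is a binary algebra satisfying $x\wedge x\approx x$; $(x\wedge y)\wedge(x\wedge z)\approx(x\wedge y)\wedge z$; $((x\wedge y)\wedge(x\wedge z))\wedge(x\wedge w)\approx(x\wedge y)\wedge((x\wedge z)\wedge(x\wedge w))$; and the left-right duals of the last two.) For $\gamma\in\mathfrak A(X)$: $l(\gamma),r(\gamma)$ are the labels of the left and right root; the 2-content $c_2(\gamma)$ is the set of pairs (label of $a$, label of $b$) over edges $(a,b)$, together with the pairs $(x,x)$ for every label $x$ occurring in $\gamma$. $\rho_{\mathbf{SPS}}$ is the set of pairs $(\alpha,\beta)\in\mathfrak A(X)\times\mathfrak A(X)$ with $(l(\alpha),c_2(\alpha),r(\alpha))=(l(\beta),c_2(\beta),r(\beta))$; a pair is non-trivial if $\alpha\ne\beta$; it has 2-content $D_n$ if $c_2(\alpha)=D_n$, where $D_n=\{(x_{2t-1},x_{2t}),(x_{2t+1},x_{2t})\mid 1\le t<n\}\cup\{(x_1,x_{2n}),(x_{2n-1},x_{2n})\}\cup\{(x_t,x_t)\mid 1\le t\le 2n\}$. Two sets of pairs in $\mathfrak A(X)\times\mathfrak A(X)$ (or single pairs, viewed as singletons) are equivalent if they generate the same fully invariant congruence on $\mathfrak A(X)$. The trees. For $n\ge2$, $k\ge1$, $1\le i\le 2n$: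 $\alpha_{n,k,i}$ is the path $a_1,a_2,\dots,a_{2nk+i}$ (consecutive vertices adjacent), $a_p$ labelled $x_q$ with $1\le q\le 2n$ and $q\equiv p\pmod{2n}$, with left root $a_1$ and right root $a_2$. $\beta_{n,k,i}$ is obtained from $\alpha_{n,k,i}$ by adding one new vertex labelled $x_{2n}$, adjacent only to $a_1$. $\alpha^*_{n,k,i}$ and $\beta^*_{n,k,i}$ are the same labelled trees as $\alpha_{n,k,i}$ and $\beta_{n,k,i}$ respectively, but with left root $a_2$ and right root $a_1$. All these trees are in $\mathfrak A(X)$. *)

theory Defs
  imports Main "HOL-Library.Countable" "HOL-Library.Infinite_Typeclass"
begin

section \<open>Concrete bi-rooted labelled trees\<close>

text \<open>
  The vertices of a concrete tree are natural numbers. The undirected edges are given by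
  a symmetric adjacency relation, and the labelling is only relevant on the vertices.
\<close>

record 'x rgraph =
  verts :: "nat set"
  adj :: "(nat \<times> nat) set"
  lab :: "nat \<Rightarrow> 'x"
  lroot :: nat
  rroot :: nat

definition is_cycle :: "(nat \<times> nat) set \<Rightarrow> nat list \<Rightarrow> bool" where
  "is_cycle E c \<longleftrightarrow> length c \<ge> 3 \<and> distinct c \<and>
     (\<forall>i. Suc i < length c \<longrightarrow> (c ! i, c ! Suc i) \<in> E) \<and> (last c, hd c) \<in> E"

text \<open>There are at least two vertices, since the two roots are adjacent and hence distinct.\<close>

definition is_tree :: "'x rgraph \<Rightarrow> bool" where
  "is_tree T \<longleftrightarrow> finite (verts T) \<and> adj T \<subseteq> verts T \<times> verts T \<and> sym (adj T) \<and> irrefl (adj T) \<and>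
     (\<forall>u\<in>verts T. \<forall>v\<in>verts T. (u, v) \<in> (adj T)\<^sup>*) \<and> (\<nexists>c. is_cycle (adj T) c) \<and>
     (lroot T, rroot T) \<in> adj T"

definition iso_map :: "(nat \<Rightarrow> nat) \<Rightarrow> 'x rgraph \<Rightarrow> 'x rgraph \<Rightarrow> bool" where
  "iso_map f S T \<longleftrightarrow> bij_betw f (verts S) (verts T) \<and>
     (\<forall>u\<in>verts S. \<forall>v\<in>verts S. (u, v) \<in> adj S \<longleftrightarrow> (f u, f v) \<in> adj T) \<and>
     (\<forall>v\<in>verts S. lab T (f v) = lab S v) \<and>
     f (lroot S) = lroot T \<and> f (rroot S) = rroot T"

definition tree_iso :: "'x rgraph \<Rightarrow> 'x rgraph \<Rightarrow> bool" where
  "tree_iso S T \<longleftrightarrow> is_tree S \<and> is_tree T \<and> (\<exists>f. iso_map f S T)"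

definition graph_dist :: "(nat \<times> nat) set \<Rightarrow> nat \<Rightarrow> nat \<Rightarrow> nat" where
  "graph_dist E u v = (LEAST m. (u, v) \<in> E ^^ m)"

definition left_vertex :: "'x rgraph \<Rightarrow> nat \<Rightarrow> bool" where
  "left_vertex T v \<longleftrightarrow> v \<in> verts T \<and> even (graph_dist (adj T) (lroot T) v)"

definition right_vertex :: "'x rgraph \<Rightarrow> nat \<Rightarrow> bool" where
  "right_vertex T v \<longleftrightarrow> v \<in> verts T \<and> odd (graph_dist (adj T) (lroot T) v)"

definition pre_c2 :: "'x rgraph \<Rightarrow> ('x \<times> 'x) set" where
  "pre_c2 T = {(lab T a, lab T b) | a b. (a, b) \<in> adj T \<and> left_vertex T a \<and> right_vertex T b}
     \<union> {(lab T v, lab T v) | v. v \<in> verts T}"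

text \<open>
  The disjoint union is realised on the even numbers (first tree) and the odd numbers
  (second tree).
\<close>

definition pre_join :: "'x rgraph \<Rightarrow> 'x rgraph \<Rightarrow> 'x rgraph" where
  "pre_join S T = \<lparr>
     verts = (\<lambda>v. 2 * v) ` verts S \<union> (\<lambda>v. 2 * v + 1) ` verts T,
     adj = {(2 * u, 2 * v) | u v. (u, v) \<in> adj S} \<union> {(2 * u + 1, 2 * v + 1) | u v. (u, v) \<in> adj T}
       \<union> {(2 * lroot S, 2 * rroot T + 1), (2 * rroot T + 1, 2 * lroot S)},
     lab = (\<lambda>v. if even v then lab S (v div 2) else lab T (v div 2)),
     lroot = 2 * lroot S,
     rroot = 2 * rroot T + 1 \<rparr>"

definition pre_swap :: "'x rgraph \<Rightarrow> 'x rgraph" where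
  "pre_swap T = T\<lparr>lroot := rroot T, rroot := lroot T\<rparr>"

definition nonessential_thorn :: "'x rgraph \<Rightarrow> nat \<Rightarrow> bool" where
  "nonessential_thorn T a \<longleftrightarrow> a \<in> verts T \<and> a \<noteq> lroot T \<and> a \<noteq> rroot T \<and>
     (\<exists>b. {v. (a, v) \<in> adj T} = {b} \<and> lab T a = lab T b)"

definition delete_vertex :: "'x rgraph \<Rightarrow> nat \<Rightarrow> 'x rgraph" where
  "delete_vertex T a = T\<lparr>verts := verts T - {a}, adj := adj T \<inter> (- {a}) \<times> (- {a})\<rparr>"

definition foldable :: "'x rgraph \<Rightarrow> nat \<Rightarrow> nat \<Rightarrow> bool" where
  "foldable T u v \<longleftrightarrow> u \<noteq> v \<and> lab T u = lab T v \<and> (\<exists>w. (u, w) \<in> adj T \<and> (v, w) \<in> adj T)"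

text \<open>The vertex \<open>v\<close> is merged into \<open>u\<close>.\<close>

definition merge_vertices :: "'x rgraph \<Rightarrow> nat \<Rightarrow> nat \<Rightarrow> 'x rgraph" where
  "merge_vertices T u v = (let f = (\<lambda>z. if z = v then u else z) in
     T\<lparr>verts := f ` verts T, adj := map_prod f f ` adj T,
       lroot := f (lroot T), rroot := f (rroot T)\<rparr>)"

inductive pre_step :: "'x rgraph \<Rightarrow> 'x rgraph \<Rightarrow> bool" where
  thorn: "nonessential_thorn T a \<Longrightarrow> pre_step T (delete_vertex T a)"
| edge_fold: "foldable T u v \<Longrightarrow> pre_step T (merge_vertices T u v)"


subsection \<open>Isomorphism invariance\<close>

lemma iso_map_id: "iso_map id T T"
  by (auto simp: iso_map_def)

lemma is_treeD:
  assumes "is_tree T"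
  shows "finite (verts T)" "adj T \<subseteq> verts T \<times> verts T" "sym (adj T)" "irrefl (adj T)"
    "\<And>u v. u \<in> verts T \<Longrightarrow> v \<in> verts T \<Longrightarrow> (u, v) \<in> (adj T)\<^sup>*"
    "\<And>c. \<not> is_cycle (adj T) c" "(lroot T, rroot T) \<in> adj T"
    "lroot T \<in> verts T" "rroot T \<in> verts T"
  using assms unfolding is_tree_def by blast+

lemma iso_map_inv:
  assumes "is_tree S" "is_tree T" "iso_map f S T"
  shows "iso_map (inv_into (verts S) f) T S"
proof -
  let ?g = "inv_into (verts S) f"
  have b: "bij_betw f (verts S) (verts T)" using assms(3) by (simp add: iso_map_def)
  have fg: "f (?g v) = v" if "v \<in> verts T" for v
    using b that by (simp add: bij_betw_inv_into_right)
  have gf: "?g (f v) = v" if "v \<in> verts S" for v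
    using b that by (simp add: bij_betw_inv_into_left)
  have gS: "?g v \<in> verts S" if "v \<in> verts T" for v
    using b that by (metis bij_betw_imp_surj_on inv_into_into)
  have roots: "lroot S \<in> verts S" "rroot S \<in> verts S" using is_treeD[OF assms(1)] by auto
  show ?thesis
    unfolding iso_map_def
    using assms(3) fg gf gS roots bij_betw_inv_into[OF b] unfolding iso_map_def by metis
qed

lemma iso_map_comp:
  assumes "iso_map f S T" "iso_map g T U" "is_tree S"
  shows "iso_map (g \<circ> f) S U"
proof -
  have "f v \<in> verts T" if "v \<in> verts S" for v
    using assms(1) that by (auto simp: iso_map_def bij_betw_def)
  then show ?thesis using assms unfolding iso_map_def
    by (auto intro: bij_betw_trans)
qed

lemma tree_iso_sym: "tree_iso S T \<Longrightarrow> tree_iso T S"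
  unfolding tree_iso_def using iso_map_inv by blast

lemma tree_iso_trans: "tree_iso S T \<Longrightarrow> tree_iso T U \<Longrightarrow> tree_iso S U"
  unfolding tree_iso_def using iso_map_comp by blast

lemma iso_map_relpow:
  assumes "is_tree S" "iso_map f S T" "(u, v) \<in> adj S ^^ m"
  shows "(f u, f v) \<in> adj T ^^ m"
  using assms(3)
proof (induction m arbitrary: v)
  case (Suc m)
  then obtain w where w: "(u, w) \<in> adj S ^^ m" "(w, v) \<in> adj S" by auto
  moreover have "(f w, f v) \<in> adj T"
    using assms(2) w(2) is_treeD(2)[OF assms(1)] unfolding iso_map_def by blast
  ultimately show ?case using Suc.IH by auto
qed simp

lemma iso_map_relpow_iff:
  assumes "is_tree S" "is_tree T" "iso_map f S T" "u \<in> verts S" "v \<in> verts S"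
  shows "(f u, f v) \<in> adj T ^^ m \<longleftrightarrow> (u, v) \<in> adj S ^^ m"
proof
  assume "(f u, f v) \<in> adj T ^^ m"
  from iso_map_relpow[OF assms(2) iso_map_inv[OF assms(1-3)] this]
  show "(u, v) \<in> adj S ^^ m"
    using assms(3-5) bij_betw_inv_into_left[of f "verts S" "verts T"]
    unfolding iso_map_def by metis
qed (rule iso_map_relpow[OF assms(1,3)])

lemma iso_map_left_right:
  assumes "is_tree S" "is_tree T" "iso_map f S T" "v \<in> verts S"
  shows "left_vertex T (f v) \<longleftrightarrow> left_vertex S v" "right_vertex T (f v) \<longleftrightarrow> right_vertex S v"
proof -
  have "graph_dist (adj T) (lroot T) (f v) = graph_dist (adj S) (lroot S) v"
    using iso_map_relpow_iff[OF assms(1-3) is_treeD(8)[OF assms(1)] assms(4)] assms(3)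
    by (simp add: graph_dist_def iso_map_def)
  moreover have "f v \<in> verts T" using assms(3,4) by (auto simp: iso_map_def bij_betw_def)
  ultimately show "left_vertex T (f v) \<longleftrightarrow> left_vertex S v" "right_vertex T (f v) \<longleftrightarrow> right_vertex S v"
    using assms(4) by (simp_all add: left_vertex_def right_vertex_def)
qed

lemma pre_c2_mono:
  assumes "is_tree S" "is_tree T" "iso_map f S T"
  shows "pre_c2 S \<subseteq> pre_c2 T"
proof
  fix p assume "p \<in> pre_c2 S"
  then consider (1) a b where "p = (lab S a, lab S b)" "(a, b) \<in> adj S" "left_vertex S a" "right_vertex S b"
    | (2) v where "p = (lab S v, lab S v)" "v \<in> verts S"
    by (auto simp: pre_c2_def)
  then show "p \<in> pre_c2 T"
  proof cases
    case 1
    then have "a \<in> verts S" "b \<in> verts S" using is_treeD(2)[OF assms(1)] by auto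
    then have "p = (lab T (f a), lab T (f b))" "(f a, f b) \<in> adj T" "left_vertex T (f a)" "right_vertex T (f b)"
      using 1 assms(3) iso_map_left_right[OF assms] by (auto simp: iso_map_def)
    then show ?thesis unfolding pre_c2_def by blast
  next
    case 2
    then have "p = (lab T (f v), lab T (f v))" "f v \<in> verts T"
      using assms(3) by (auto simp: iso_map_def bij_betw_def)
    then show ?thesis unfolding pre_c2_def by blast
  qed
qed

lemma pre_c2_cong: "tree_iso S T \<Longrightarrow> pre_c2 S = pre_c2 T"
  by (metis pre_c2_mono subset_antisym tree_iso_def tree_iso_sym)

lemma is_tree_swap: "is_tree T \<Longrightarrow> is_tree (pre_swap T)"
  by (auto simp: is_tree_def pre_swap_def sym_def)

lemma tree_iso_swap: "tree_iso S T \<Longrightarrow> tree_iso (pre_swap S) (pre_swap T)"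
  unfolding tree_iso_def by (auto simp: is_tree_swap) (auto simp: pre_swap_def iso_map_def)


subsection \<open>The join of two trees is a tree\<close>

text \<open>The vertices of a cycle, indexed cyclically.\<close>

lemma is_cycle_mod:
  assumes "is_cycle E c"
  shows "(c ! (i mod length c), c ! (Suc i mod length c)) \<in> E"
proof -
  have L: "length c \<ge> 3" using assms by (simp add: is_cycle_def)
  show ?thesis
  proof (cases "Suc (i mod length c) < length c")
    case True
    then show ?thesis using assms by (simp add: is_cycle_def mod_Suc)
  next
    case False
    then have "i mod length c = length c - 1" using L
      by (metis Suc_lessI diff_Suc_1 length_greater_0_conv list.size(3) mod_less_divisor not_numeral_le_zero)
    moreover have "c \<noteq> []" using L by auto
    ultimately show ?thesis using assms L
      by (simp add: is_cycle_def mod_Suc last_conv_nth hd_conv_nth)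
  qed
qed

lemma cycle_two_nbrs:
  assumes "is_cycle E c" "sym E" "v \<in> set c"
  obtains u w where "u \<in> set c" "w \<in> set c" "u \<noteq> w" "(v, u) \<in> E" "(v, w) \<in> E"
proof -
  let ?n = "length c"
  have L: "?n \<ge> 3" and d: "distinct c" using assms by (auto simp: is_cycle_def)
  obtain i where i: "i < ?n" "v = c ! i" using assms(3) by (auto simp: in_set_conv_nth)
  let ?j = "i + ?n - 1"
  have 1: "(c ! (?j mod ?n), v) \<in> E"
  proof -
    have "Suc ?j = i + ?n" using L by simp
    then show ?thesis using is_cycle_mod[OF assms(1), of ?j] i by simp
  qed
  have 2: "(v, c ! (Suc i mod ?n)) \<in> E"
    using is_cycle_mod[OF assms(1), of i] i by simp
  have "?j mod ?n \<noteq> Suc i mod ?n"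
  proof
    assume eq: "?j mod ?n = Suc i mod ?n"
    have "?j mod ?n = (if i = 0 then ?n - 1 else i - 1)"
      using i L by (cases i) auto
    moreover have "Suc i mod ?n = (if Suc i = ?n then 0 else Suc i)"
      using i L by auto
    ultimately show False using eq L i by (auto split: if_splits)
  qed
  moreover have "?j mod ?n < ?n" "Suc i mod ?n < ?n" using L by (auto intro: mod_less_divisor)
  ultimately have "c ! (?j mod ?n) \<noteq> c ! (Suc i mod ?n)" "c ! (?j mod ?n) \<in> set c"
    "c ! (Suc i mod ?n) \<in> set c" using d by (auto simp: nth_eq_iff_index_eq)
  then show ?thesis using that 1 2 assms(2) by (meson symD)
qed

lemma cyclic_switch:
  assumes "\<And>i. P (c ! (i mod length c)) \<Longrightarrow> P (c ! (Suc i mod length c))" "v \<in> set c" "P v" "u \<in> set c"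
  shows "P u"
proof -
  obtain i where i: "i < length c" "c ! i = v" using assms(2) by (auto simp: in_set_conv_nth)
  have step: "P (c ! ((i + k) mod length c))" for k
    by (induction k) (use i assms(1,3) in auto)
  obtain j where j: "j < length c" "c ! j = u" using assms(4) by (auto simp: in_set_conv_nth)
  have "(i + (length c - i + j)) mod length c = j" using i j by simp
  then show ?thesis using step[of "length c - i + j"] j by simp
qed

lemma is_cycle_map_div2:
  assumes "is_cycle E c" "inj_on (\<lambda>v. v div 2) (set c)"
    "\<And>u v. u \<in> set c \<Longrightarrow> v \<in> set c \<Longrightarrow> (u, v) \<in> E \<Longrightarrow> (u div 2, v div 2) \<in> F"
  shows "is_cycle F (map (\<lambda>v. v div 2) c)"
proof -
  have ne: "c \<noteq> []" using assms(1) by (auto simp: is_cycle_def)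
  then show ?thesis
    using assms unfolding is_cycle_def by (auto simp: distinct_map last_map hd_map)
qed

lemma acyclic_join:
  assumes S: "is_tree S" and T: "is_tree T"
  shows "\<not> is_cycle (adj (pre_join S T)) c"
proof
  let ?E = "adj (pre_join S T)" and ?n = "length c"
  assume c: "is_cycle ?E c"
  have L: "?n \<ge> 3" and d: "distinct c" using c by (auto simp: is_cycle_def)
  have ee: "(u div 2, v div 2) \<in> adj S" if "(u, v) \<in> ?E" "even u" "even v" for u v
    using that by (auto simp: pre_join_def)
  have oo: "(u div 2, v div 2) \<in> adj T" if "(u, v) \<in> ?E" "odd u" "odd v" for u v
    using that by (auto simp: pre_join_def)
  have eo: "u = 2 * lroot S \<and> v = 2 * rroot T + 1" if "(u, v) \<in> ?E" "even u" "odd v" for u v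
    using that by (auto simp: pre_join_def)
  have oe: "v = 2 * lroot S \<and> u = 2 * rroot T + 1" if "(u, v) \<in> ?E" "odd u" "even v" for u v
    using that by (auto simp: pre_join_def)
  have bit_eq: "u div 2 = v div 2 \<Longrightarrow> even u = even v \<Longrightarrow> u = v" for u v :: nat
    by presburger
  have not_all_even: "\<not> (\<forall>v\<in>set c. even v)"
  proof
    assume a: "\<forall>v\<in>set c. even v"
    have "is_cycle (adj S) (map (\<lambda>v. v div 2) c)"
      by (rule is_cycle_map_div2[OF c]) (use a ee in \<open>auto intro!: inj_onI dest: bit_eq\<close>)
    then show False using is_treeD(6)[OF S] by blast
  qed
  have not_all_odd: "\<not> (\<forall>v\<in>set c. odd v)"
  proof
    assume a: "\<forall>v\<in>set c. odd v"
    have "is_cycle (adj T) (map (\<lambda>v. v div 2) c)"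
      by (rule is_cycle_map_div2[OF c]) (use a oo in \<open>auto intro!: inj_onI dest: bit_eq\<close>)
    then show False using is_treeD(6)[OF T] by blast
  qed
  obtain i where i: "even (c ! (i mod ?n))" "odd (c ! (Suc i mod ?n))"
    using cyclic_switch[of even c] not_all_even not_all_odd by blast
  obtain j where j: "odd (c ! (j mod ?n))" "even (c ! (Suc j mod ?n))"
    using cyclic_switch[of odd c] not_all_even not_all_odd by blast
  have "c ! (i mod ?n) = c ! (Suc j mod ?n)" "c ! (Suc i mod ?n) = c ! (j mod ?n)"
    using eo[OF is_cycle_mod[OF c] i] oe[OF is_cycle_mod[OF c] j] by auto
  moreover have lt: "k mod ?n < ?n" for k using L by (auto intro: mod_less_divisor)
  ultimately have "i mod ?n = Suc j mod ?n" "Suc i mod ?n = j mod ?n"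
    using nth_eq_iff_index_eq[OF d] by blast+
  moreover note lt[of i] lt[of j]
  ultimately show False using L by (auto simp: mod_Suc split: if_splits)
qed

lemma rtrancl_image:
  assumes "(u, v) \<in> E\<^sup>*" "\<And>a b. (a, b) \<in> E \<Longrightarrow> (f a, f b) \<in> F"
  shows "(f u, f v) \<in> F\<^sup>*"
  using assms(1) by induction (auto intro: rtrancl_into_rtrancl assms(2))

lemma is_tree_join:
  assumes S: "is_tree S" and T: "is_tree T"
  shows "is_tree (pre_join S T)"
proof -
  let ?J = "pre_join S T"
  note S' = is_treeD[OF S] and T' = is_treeD[OF T]
  have sym: "sym (adj ?J)"
    using symD[OF S'(3)] symD[OF T'(3)] by (auto simp: pre_join_def intro!: symI)
  have eS: "(2 * u, 2 * v) \<in> (adj ?J)\<^sup>*" if "u \<in> verts S" "v \<in> verts S" for u v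
    by (rule rtrancl_image[OF S'(5)[OF that]]) (auto simp: pre_join_def)
  have eT: "(2 * u + 1, 2 * v + 1) \<in> (adj ?J)\<^sup>*" if "u \<in> verts T" "v \<in> verts T" for u v
    by (rule rtrancl_image[OF T'(5)[OF that]]) (auto simp: pre_join_def)
  have r: "(2 * lroot S, 2 * rroot T + 1) \<in> (adj ?J)\<^sup>*"
    by (auto simp: pre_join_def)
  have symr: "sym ((adj ?J)\<^sup>*)" by (rule sym_rtrancl[OF sym])
  have toroot: "(2 * lroot S, z) \<in> (adj ?J)\<^sup>*" if "z \<in> verts ?J" for z
    using that eS[OF S'(8)] rtrancl_trans[OF r eT[OF T'(9)]] by (auto simp: pre_join_def)
  have "(u, v) \<in> (adj ?J)\<^sup>*" if "u \<in> verts ?J" "v \<in> verts ?J" for u v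
    using rtrancl_trans[OF symD[OF symr toroot[OF that(1)]] toroot[OF that(2)]] .
  moreover have "irrefl (adj ?J)"
    using S'(4) T'(4) by (auto simp: irrefl_def pre_join_def) presburger+
  moreover have "finite (verts ?J)" "adj ?J \<subseteq> verts ?J \<times> verts ?J" "(lroot ?J, rroot ?J) \<in> adj ?J"
    using S'(1,2,8) T'(1,2,9) by (auto simp: pre_join_def)
  ultimately show ?thesis
    using sym acyclic_join[OF S T] unfolding is_tree_def by blast
qed

lemma tree_iso_join:
  assumes "tree_iso S S'" "tree_iso T T'"
  shows "tree_iso (pre_join S T) (pre_join S' T')"
proof -
  from assms obtain f g where f: "iso_map f S S'" and g: "iso_map g T T'"
    and t: "is_tree S" "is_tree S'" "is_tree T" "is_tree T'"
    by (auto simp: tree_iso_def)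
  let ?h = "\<lambda>z. if even z then 2 * f (z div 2) else 2 * g (z div 2) + 1"
  let ?J = "pre_join S T" and ?J' = "pre_join S' T'"
  have bf: "inj_on f (verts S)" "f ` verts S = verts S'" and bg: "inj_on g (verts T)" "g ` verts T = verts T'"
    using f g by (auto simp: iso_map_def bij_betw_def)
  have "?h ` verts ?J = verts ?J'"
    unfolding pre_join_def
    by (simp only: rgraph.simps image_Un image_image bf(2)[symmetric] bg(2)[symmetric]) simp
  moreover have "inj_on ?h (verts ?J)"
  proof (rule inj_onI)
    fix u v assume uv: "u \<in> verts ?J" "v \<in> verts ?J" and eq: "?h u = ?h v"
    have "even (?h u) = even u" "even (?h v) = even v" by auto
    then have par: "even u = even v" using eq by simp
    have "u div 2 = v div 2"
    proof (cases "even u")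
      case True
      then have "u div 2 \<in> verts S" "v div 2 \<in> verts S" using uv par by (auto simp: pre_join_def)
      then show ?thesis using True par eq bf(1) by (auto dest: inj_onD)
    next
      case False
      then have "u div 2 \<in> verts T" "v div 2 \<in> verts T" using uv par by (auto simp: pre_join_def)
      then show ?thesis using False par eq bg(1) by (auto dest: inj_onD)
    qed
    then show "u = v" using par by presburger
  qed
  moreover have "(u, v) \<in> adj ?J \<longleftrightarrow> (?h u, ?h v) \<in> adj ?J'" if uv: "u \<in> verts ?J" "v \<in> verts ?J" for u v
  proof -
    have par: "2 * a \<noteq> Suc (2 * b)" "Suc (2 * b) \<noteq> 2 * a" for a b :: nat by presburger+
    have fi: "f a = f b \<longleftrightarrow> a = b" if "a \<in> verts S" "b \<in> verts S" for a b
      using bf(1) that by (auto simp: inj_on_def)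
    have gi: "g a = g b \<longleftrightarrow> a = b" if "a \<in> verts T" "b \<in> verts T" for a b
      using bg(1) that by (auto simp: inj_on_def)
    have rt: "lroot S \<in> verts S" "rroot T \<in> verts T" "lroot S' = f (lroot S)" "rroot T' = g (rroot T)"
      using is_treeD(8)[OF t(1)] is_treeD(9)[OF t(3)] f g by (auto simp: iso_map_def)
    have fa: "(f a, f b) \<in> adj S' \<longleftrightarrow> (a, b) \<in> adj S" if "a \<in> verts S" "b \<in> verts S" for a b
      using f that by (simp add: iso_map_def)
    have ga: "(g a, g b) \<in> adj T' \<longleftrightarrow> (a, b) \<in> adj T" if "a \<in> verts T" "b \<in> verts T" for a b
      using g that by (simp add: iso_map_def)
    consider (ee) a b where "u = 2 * a" "v = 2 * b" "a \<in> verts S" "b \<in> verts S"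
      | (eo) a b where "u = 2 * a" "v = 2 * b + 1" "a \<in> verts S" "b \<in> verts T"
      | (oe) a b where "u = 2 * a + 1" "v = 2 * b" "a \<in> verts T" "b \<in> verts S"
      | (oo) a b where "u = 2 * a + 1" "v = 2 * b + 1" "a \<in> verts T" "b \<in> verts T"
      using uv by (auto simp: pre_join_def)
    then show ?thesis
      by cases (simp_all add: pre_join_def par fi gi fa ga rt)
  qed
  moreover have "\<forall>v\<in>verts ?J. lab ?J' (?h v) = lab ?J v"
    using f g by (auto simp: pre_join_def iso_map_def)
  moreover have "?h (lroot ?J) = lroot ?J'" "?h (rroot ?J) = rroot ?J'"
    using f g by (auto simp: pre_join_def iso_map_def)
  ultimately have "iso_map ?h ?J ?J'"
    unfolding iso_map_def bij_betw_def by blast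
  then show ?thesis using is_tree_join t unfolding tree_iso_def by blast
qed


section \<open>Bi-rooted trees up to isomorphism\<close>

lemma is_tree_path:
  assumes "a \<le> l" "l < b"
  shows "is_tree \<lparr>verts = {a..b}, adj = {(p, q). p \<in> {a..b} \<and> q \<in> {a..b} \<and> (q = p + 1 \<or> p = q + 1)},
    lab = f, lroot = l, rroot = l + 1\<rparr>"
proof -
  let ?E = "{(p, q). p \<in> {a..b} \<and> q \<in> {a..b} \<and> (q = p + 1 \<or> p = q + 1)}"
  have s: "sym ?E" by (auto simp: sym_def)
  have conn0: "(a, a + m) \<in> ?E\<^sup>*" if "a + m \<le> b" for m
    using that by (induction m) (auto intro: rtrancl_into_rtrancl)
  have conn1: "(a, v) \<in> ?E\<^sup>*" if "v \<in> {a..b}" for v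
    using conn0[of "v - a"] that by simp
  have "(u, v) \<in> ?E\<^sup>*" if "u \<in> {a..b}" "v \<in> {a..b}" for u v
    using rtrancl_trans[OF symD[OF sym_rtrancl[OF s] conn1[OF that(1)]] conn1[OF that(2)]] .
  moreover have "\<not> is_cycle ?E c" for c
  proof
    assume c: "is_cycle ?E c"
    then have ne: "set c \<noteq> {}" by (auto simp: is_cycle_def)
    then have "Max (set c) \<in> set c" by simp
    from cycle_two_nbrs[OF c s this] obtain u w where
      uw: "u \<in> set c" "w \<in> set c" "u \<noteq> w" "(Max (set c), u) \<in> ?E" "(Max (set c), w) \<in> ?E" .
    moreover have "u \<le> Max (set c)" "w \<le> Max (set c)" using uw by auto
    ultimately show False by auto
  qed
  ultimately show ?thesis using s assms by (auto simp: is_tree_def irrefl_def)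
qed

quotient_type 'x birooted = "'x rgraph" / partial: tree_iso
  morphisms rep_birooted abs_birooted
proof (rule part_equivpI)
  show "\<exists>T::'x rgraph. tree_iso T T"
    using is_tree_path[of 0 0 1] iso_map_id unfolding tree_iso_def
    by (meson le_refl zero_less_one)
  show "symp (tree_iso :: 'x rgraph \<Rightarrow> _)" by (rule sympI) (rule tree_iso_sym)
  show "transp (tree_iso :: 'x rgraph \<Rightarrow> _)" by (rule transpI) (rule tree_iso_trans)
qed

lift_definition join :: "'x birooted \<Rightarrow> 'x birooted \<Rightarrow> 'x birooted" (infixl \<open>\<sqinter>\<^sub>t\<close> 70)
  is pre_join by (rule tree_iso_join)

lift_definition swap_roots :: "'x birooted \<Rightarrow> 'x birooted"
  is pre_swap by (rule tree_iso_swap)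

lift_definition left_label :: "'x birooted \<Rightarrow> 'x"
  is "\<lambda>T. lab T (lroot T)"
  unfolding tree_iso_def iso_map_def using is_treeD(8) by metis

lift_definition right_label :: "'x birooted \<Rightarrow> 'x"
  is "\<lambda>T. lab T (rroot T)"
  unfolding tree_iso_def iso_map_def using is_treeD(9) by metis

lift_definition c2 :: "'x birooted \<Rightarrow> ('x \<times> 'x) set"
  is pre_c2 by (rule pre_c2_cong)

text \<open>Deleting a leaf and folding two edges both turn a concrete tree into a tree again.\<close>

definition reduces_to :: "'x birooted \<Rightarrow> 'x birooted \<Rightarrow> bool" where
  "reduces_to \<alpha> \<beta> \<longleftrightarrow>
     (\<exists>S T. is_tree S \<and> pre_step S T \<and> \<alpha> = abs_birooted S \<and> \<beta> = abs_birooted T)"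

definition reduced :: "'x birooted \<Rightarrow> bool" where
  "reduced \<alpha> \<longleftrightarrow> (\<nexists>\<beta>. reduces_to \<alpha> \<beta>)"

definition reduced_form :: "'x birooted \<Rightarrow> 'x birooted" where
  "reduced_form \<alpha> = (THE \<beta>. reduces_to\<^sup>*\<^sup>* \<alpha> \<beta> \<and> reduced \<beta>)"


section \<open>The free pseudosemilattice\<close>

definition A_X :: "'x birooted set" where
  "A_X = {\<alpha>. reduced \<alpha>}"

definition meet :: "'x birooted \<Rightarrow> 'x birooted \<Rightarrow> 'x birooted" (infixl \<open>\<and>\<^sub>t\<close> 70) where
  "\<alpha> \<and>\<^sub>t \<beta> = reduced_form (\<alpha> \<sqinter>\<^sub>t \<beta>)"

definition endomorphism :: "('x birooted \<Rightarrow> 'x birooted) \<Rightarrow> bool" where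
  "endomorphism \<phi> \<longleftrightarrow> (\<forall>\<alpha>\<in>A_X. \<phi> \<alpha> \<in> A_X) \<and>
     (\<forall>\<alpha>\<in>A_X. \<forall>\<beta>\<in>A_X. \<phi> (\<alpha> \<and>\<^sub>t \<beta>) = \<phi> \<alpha> \<and>\<^sub>t \<phi> \<beta>)"

definition congruence :: "('x birooted \<times> 'x birooted) set \<Rightarrow> bool" where
  "congruence \<theta> \<longleftrightarrow> equiv A_X \<theta> \<and>
     (\<forall>\<alpha> \<alpha>' \<beta> \<beta>'. (\<alpha>, \<alpha>') \<in> \<theta> \<longrightarrow> (\<beta>, \<beta>') \<in> \<theta> \<longrightarrow> (\<alpha> \<and>\<^sub>t \<beta>, \<alpha>' \<and>\<^sub>t \<beta>') \<in> \<theta>)"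

definition fully_invariant :: "('x birooted \<times> 'x birooted) set \<Rightarrow> bool" where
  "fully_invariant \<theta> \<longleftrightarrow>
     (\<forall>\<phi> \<alpha> \<beta>. endomorphism \<phi> \<longrightarrow> (\<alpha>, \<beta>) \<in> \<theta> \<longrightarrow> (\<phi> \<alpha>, \<phi> \<beta>) \<in> \<theta>)"

definition fic_generated :: "('x birooted \<times> 'x birooted) set \<Rightarrow> ('x birooted \<times> 'x birooted) set" where
  "fic_generated I = \<Inter> {\<theta>. congruence \<theta> \<and> fully_invariant \<theta> \<and> I \<subseteq> \<theta>}"

definition equivalent_pairs ::
    "('x birooted \<times> 'x birooted) set \<Rightarrow> ('x birooted \<times> 'x birooted) set \<Rightarrow> bool" where
  "equivalent_pairs I J \<longleftrightarrow> fic_generated I = fic_generated J"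

definition rho_SPS :: "('x birooted \<times> 'x birooted) set" where
  "rho_SPS = {(\<alpha>, \<beta>). \<alpha> \<in> A_X \<and> \<beta> \<in> A_X \<and>
     (left_label \<alpha>, c2 \<alpha>, right_label \<alpha>) = (left_label \<beta>, c2 \<beta>, right_label \<beta>)}"


section \<open>The special 2-content and the special trees\<close>

definition D_content :: "(nat \<Rightarrow> 'x) \<Rightarrow> nat \<Rightarrow> ('x \<times> 'x) set" where
  "D_content x n = (\<Union>t\<in>{1..<n}. {(x (2*t - 1), x (2*t)), (x (2*t + 1), x (2*t))})
     \<union> {(x 1, x (2*n)), (x (2*n - 1), x (2*n))}
     \<union> {(x t, x t) | t. 1 \<le> t \<and> t \<le> 2*n}"

text \<open>
  In \<open>pre_alpha\<close> the vertex \<open>p\<close> is the \<open>p\<close>-th vertex of the path. Its label is \<open>x\<close> at the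
  unique index between 1 and \<open>2 * n\<close> that is congruent to \<open>p\<close> modulo \<open>2 * n\<close>.
  In \<open>pre_beta\<close> the added vertex is \<open>0\<close>.
\<close>

definition pre_alpha :: "(nat \<Rightarrow> 'x) \<Rightarrow> nat \<Rightarrow> nat \<Rightarrow> nat \<Rightarrow> 'x rgraph" where
  "pre_alpha x n k i = \<lparr>
     verts = {1..2*n*k + i},
     adj = {(p, q). p \<in> {1..2*n*k + i} \<and> q \<in> {1..2*n*k + i} \<and> (q = p + 1 \<or> p = q + 1)},
     lab = (\<lambda>p. x ((p - 1) mod (2*n) + 1)),
     lroot = 1,
     rroot = 2 \<rparr>"

definition pre_beta :: "(nat \<Rightarrow> 'x) \<Rightarrow> nat \<Rightarrow> nat \<Rightarrow> nat \<Rightarrow> 'x rgraph" where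
  "pre_beta x n k i = (let T = pre_alpha x n k i in
     T\<lparr>verts := insert 0 (verts T), adj := adj T \<union> {(0, 1), (1, 0)}, lab := (lab T)(0 := x (2*n))\<rparr>)"

lemma is_tree_alpha:
  assumes "2*n*k + i \<ge> 2"
  shows "is_tree (pre_alpha x n k i)"
  using is_tree_path[of 1 1 "2*n*k + i"] assms by (simp add: pre_alpha_def numeral_2_eq_2)

lemma is_tree_beta:
  assumes "2*n*k + i \<ge> 2"
  shows "is_tree (pre_beta x n k i)"
proof -
  let ?m = "2*n*k + i"
  have v: "insert 0 {1..?m} = {0..?m}" by auto
  have e: "{(p, q). p \<in> {1..?m} \<and> q \<in> {1..?m} \<and> (q = p + 1 \<or> p = q + 1)} \<union> {(0, 1), (1, 0)}
    = {(p, q). p \<in> {0..?m} \<and> q \<in> {0..?m} \<and> (q = p + 1 \<or> p = q + 1)}"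
    using assms by auto
  have "pre_beta x n k i = \<lparr>verts = {0..?m},
    adj = {(p, q). p \<in> {0..?m} \<and> q \<in> {0..?m} \<and> (q = p + 1 \<or> p = q + 1)},
    lab = (\<lambda>p. x ((p - 1) mod (2*n) + 1))(0 := x (2*n)), lroot = 1, rroot = 1 + 1\<rparr>"
    unfolding pre_beta_def pre_alpha_def Let_def rgraph.simps rgraph.update_convs v e
    by simp
  then show ?thesis using is_tree_path[of 0 1 ?m] assms by simp
qed

definition alpha :: "(nat \<Rightarrow> 'x) \<Rightarrow> nat \<Rightarrow> nat \<Rightarrow> nat \<Rightarrow> 'x birooted" where
  "alpha x n k i = abs_birooted (pre_alpha x n k i)"

definition beta :: "(nat \<Rightarrow> 'x) \<Rightarrow> nat \<Rightarrow> nat \<Rightarrow> nat \<Rightarrow> 'x birooted" where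
  "beta x n k i = abs_birooted (pre_beta x n k i)"

definition alpha_star :: "(nat \<Rightarrow> 'x) \<Rightarrow> nat \<Rightarrow> nat \<Rightarrow> nat \<Rightarrow> 'x birooted" where
  "alpha_star x n k i = swap_roots (alpha x n k i)"

definition beta_star :: "(nat \<Rightarrow> 'x) \<Rightarrow> nat \<Rightarrow> nat \<Rightarrow> nat \<Rightarrow> 'x birooted" where
  "beta_star x n k i = swap_roots (beta x n k i)"

definition I_pairs :: "(nat \<Rightarrow> 'x) \<Rightarrow> nat \<Rightarrow> ('x birooted \<times> 'x birooted) set" where
  "I_pairs x n =
     {(alpha x n k i, beta x n k i) | k i. k \<ge> 1 \<and> 1 \<le> i \<and> i \<le> 2*n}
     \<union> {(alpha_star x n k j, beta_star x n k j) | k j. k \<ge> 1 \<and> 1 \<le> j \<and> j \<le> 2*n \<and> odd j}"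

end

theory Submission
  imports Defs
begin

text \<open>
  The free pseudosemilattice embeds into an algebra of finite labelled subsets of a free group
  in which the meet is a union of translates, and every assignment of its elements to the letters
  extends to an endomorphism. A tree with 2-content \<open>D_n\<close> is an interval of a bi-infinite path
  with labels of period \<open>2n\<close>, with at least \<open>2n + 1\<close> vertices. Multiplication by letters moves the
  roots along the path, so a pair of such trees says that two overlapping intervals may be exchanged,
  and this amounts to a few rules that extend an interval with \<open>m\<close> vertices by one vertex at an end
  point of given parity. Rotations and reflections of the path are substitutions, so such a rule
  depends only on \<open>m\<close> and the parity; it implies both rules for \<open>m + 1\<close>, and for even \<open>m\<close> the two
  rules are equivalent. Hence only the rules with the least \<open>m\<close> matter.
\<close>

section \<open>Free groups\<close>

text \<open>The obstacle is that a meet is a join followed by an unspecified sequence of reductions,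
  on trees known only up to isomorphism, while full invariance asks for trees to be substituted at
  every vertex. In the group model each vertex has a definite position: isomorphism becomes
  equality, reductions become invisible, and a substitution becomes a homomorphism of free groups
  followed by a union of translates. Uniqueness of reduced forms comes out as a by-product.

  The bound 2n + 1 arises because the tree must carry all 2n edges of a 2n-cycle; it is the source
  of the condition k \<ge> 1. For odd m both ends of an interval with m vertices have the same
  parity, so the argument that exchanges the two rules for even m says nothing. This is why single
  pairs of both kinds and a two-element set appear in the result.

  Equivalence is tested on one fully invariant congruence \<theta> at a time: membership of a pair
  in \<theta> is the validity in \<theta> of a set of rules that is read off from the pair
  alone.\<close>

definition inv_letter :: "'g \<times> bool \<Rightarrow> 'g \<times> bool" where
  "inv_letter a = (fst a, \<not> snd a)"

lemma inv_letter_simps [simp]: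
  "inv_letter (inv_letter a) = a" "inv_letter a \<noteq> a" "a \<noteq> inv_letter a"
  "inv_letter (g, s) = (g, \<not> s)"
  by (cases a; simp add: inv_letter_def)+

abbreviation red_word :: "('g \<times> bool) list \<Rightarrow> bool" where
  "red_word \<equiv> successively (\<lambda>a b. b \<noteq> inv_letter a)"

text \<open>Left multiplication of a reduced word by one letter. Letting letters act on reduced
  words (van der Waerden's method) avoids a confluence argument: associativity rests on
  \<open>cancel_cons_inv\<close>, by which a letter undoes its inverse.\<close>

definition cancel_cons :: "'g \<times> bool \<Rightarrow> ('g \<times> bool) list \<Rightarrow> ('g \<times> bool) list" where
  "cancel_cons a w = (if w \<noteq> [] \<and> hd w = inv_letter a then tl w else a # w)"

lemma red_cancel_cons: "red_word w \<Longrightarrow> red_word (cancel_cons a w)"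
  by (cases w) (auto simp: cancel_cons_def successively_Cons)

lemma cancel_cons_inv: "red_word w \<Longrightarrow> cancel_cons a (cancel_cons (inv_letter a) w) = w"
  by (cases w) (auto simp: cancel_cons_def successively_Cons)

lemma red_foldr: "red_word v \<Longrightarrow> red_word (foldr cancel_cons u v)"
  by (induction u) (auto intro: red_cancel_cons)

lemma foldr_cancel_cons:
  assumes "red_word w"
  shows "foldr cancel_cons (cancel_cons a u) w = cancel_cons a (foldr cancel_cons u w)"
proof (cases u)
  case (Cons b u')
  \<comment> \<open>Only a cancellation in \<open>cancel_cons a u\<close> needs an argument: then
    \<open>b\<close> is inverse to \<open>a\<close>, and \<open>cancel_cons_inv\<close> undoes its
    action.\<close>
  then show ?thesis
    using cancel_cons_inv[OF red_foldr[OF assms], of a u'] by (auto simp: cancel_cons_def[of a "_ # _"])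
qed (simp add: cancel_cons_def)

lemma foldr_cancel_assoc:
  "red_word w \<Longrightarrow> foldr cancel_cons (foldr cancel_cons u v) w = foldr cancel_cons u (foldr cancel_cons v w)"
  by (induction u) (auto simp: foldr_cancel_cons)

lemma foldr_cancel_Nil: "red_word u \<Longrightarrow> foldr cancel_cons u [] = u"
proof (induction u)
  case (Cons a u)
  then show ?case by (cases u) (auto simp: cancel_cons_def)
qed simp

definition inv_word :: "('g \<times> bool) list \<Rightarrow> ('g \<times> bool) list" where
  "inv_word w = rev (map inv_letter w)"

lemma red_inv_word: "red_word w \<Longrightarrow> red_word (inv_word w)"
  unfolding inv_word_def successively_rev successively_map
  by (erule successively_mono) (auto dest: arg_cong[of _ _ inv_letter])

lemma foldr_cancel_inv: "red_word w \<Longrightarrow> foldr cancel_cons (inv_word w) w = []"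
proof (induction w)
  case (Cons a w)
  then show ?case by (cases w) (auto simp: inv_word_def cancel_cons_def)
qed (simp add: inv_word_def)

typedef 'g free_group = "{w :: ('g \<times> bool) list. red_word w}"
  morphisms word_of Free_group
  by (rule exI[of _ "[]"]) simp

setup_lifting type_definition_free_group

instantiation free_group :: (type) group_add
begin

lift_definition zero_free_group :: "'a free_group" is "[]" by simp
lift_definition plus_free_group :: "'a free_group \<Rightarrow> 'a free_group \<Rightarrow> 'a free_group"
  is "foldr cancel_cons" by (rule red_foldr)
lift_definition uminus_free_group :: "'a free_group \<Rightarrow> 'a free_group" is inv_word
  by (rule red_inv_word)
definition minus_free_group :: "'a free_group \<Rightarrow> 'a free_group \<Rightarrow> 'a free_group" where
  "minus_free_group a b = a + - b"

instance
proof
  fix a b c :: "'a free_group"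
  show "a + b + c = a + (b + c)" by transfer (rule foldr_cancel_assoc)
  show "0 + a = a" by transfer simp
  show "a + 0 = a" by transfer (rule foldr_cancel_Nil)
  show "- a + a = 0" by transfer (rule foldr_cancel_inv)
  show "a + - b = a - b" by (simp add: minus_free_group_def)
qed

end

lift_definition gen :: "'g \<times> bool \<Rightarrow> 'g free_group" is "\<lambda>a. [a]" by simp

lemma gen_inv: "gen (inv_letter a) = - gen a"
  by transfer (simp add: inv_word_def)

lemma word_of_gen_add:
  "word_of (gen a + w) = cancel_cons a (word_of w)"
  by (simp add: plus_free_group.rep_eq gen.rep_eq)

lift_definition extend_hom :: "('g \<Rightarrow> 'b::group_add) \<Rightarrow> 'g free_group \<Rightarrow> 'b"
  is "\<lambda>f w. sum_list (map (\<lambda>(g, s). if s then f g else - f g) w)" .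

lemma extend_hom_gen: "extend_hom f (gen (g, True)) = f g"
  by transfer simp

lemma extend_hom_add:
  fixes f :: "'g \<Rightarrow> 'b::group_add"
  shows "extend_hom f (a + b) = extend_hom f a + extend_hom f b"
proof transfer
  fix f :: "'g \<Rightarrow> 'b" and u v :: "('g \<times> bool) list"
  let ?val = "\<lambda>(g, s). if s then f g else - f g"
  have inv: "?val (inv_letter a) = - ?val a" for a by (cases a) auto
  \<comment> \<open>Cancelling two inverse letters does not change the sum in the target
    group.\<close>
  have cc: "sum_list (map ?val (cancel_cons a w)) = ?val a + sum_list (map ?val w)" for a w
    by (cases w) (auto simp: cancel_cons_def inv add.assoc[symmetric])
  show "sum_list (map ?val (foldr cancel_cons u v)) = sum_list (map ?val u) + sum_list (map ?val v)"
    by (induction u) (auto simp: cc add.assoc)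
qed

lemma extend_hom_zero: "extend_hom f 0 = 0"
  by transfer simp

lemma extend_hom_uminus: "extend_hom f (- a) = - extend_hom f a"
  by (metis add.right_inverse extend_hom_add extend_hom_zero minus_unique)

definition edge_gen :: "'x \<Rightarrow> 'x \<Rightarrow> ('x \<times> 'x) free_group" where
  "edge_gen x y = (if x = y then 0 else gen ((x, y), True))"

lemma edge_gen_same [simp]: "edge_gen x x = 0"
  by (simp add: edge_gen_def)

section \<open>Finite trees\<close>

lemma rtrancl_map_or_eq:
  assumes "(u, v) \<in> E\<^sup>*" "\<And>a b. (a, b) \<in> E \<Longrightarrow> f a = f b \<or> (f a, f b) \<in> E'"
  shows "(f u, f v) \<in> E'\<^sup>*"
  using assms(1)
proof (induction rule: rtrancl_induct)
  case (step y z)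
  then show ?case using assms(2)[OF step(2)] by (auto intro: rtrancl_into_rtrancl)
qed simp

text \<open>Attaching leaves one at a time supplies an induction principle: bridges, potentials and
  membership in \<open>generated\<close> are all obtained leaf by leaf.\<close>

inductive grown_tree :: "nat set \<Rightarrow> (nat \<times> nat) set \<Rightarrow> bool" where
  single: "grown_tree {v} {}"
| add_leaf: "grown_tree V E \<Longrightarrow> b \<in> V \<Longrightarrow> a \<notin> V \<Longrightarrow>
    grown_tree (insert a V) (insert (a, b) (insert (b, a) E))"

lemma grown_tree_props:
  assumes "grown_tree V E"
  shows "finite V" "E \<subseteq> V \<times> V" "sym E" "irrefl E" "V \<noteq> {}"
  using assms by (induction) (auto simp: sym_def irrefl_def)

lemma grown_tree_connected:
  assumes "grown_tree V E" "u \<in> V" "v \<in> V"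
  shows "(u, v) \<in> E\<^sup>*"
proof -
  have "\<exists>c. \<forall>v\<in>V. (c, v) \<in> E\<^sup>*"
    using assms(1)
  proof induction
    case (add_leaf V E b a)
    then obtain c where c: "\<And>v. v \<in> V \<Longrightarrow> (c, v) \<in> E\<^sup>*" by blast
    let ?E = "insert (a, b) (insert (b, a) E)"
    have "(c, v) \<in> ?E\<^sup>*" if "v \<in> V" for v
      using c[OF that] rtrancl_mono[of E ?E] by blast
    moreover from this[OF add_leaf.hyps(2)] have "(c, a) \<in> ?E\<^sup>*"
      by (rule rtrancl_into_rtrancl) simp
    ultimately show ?case by blast
  qed simp
  then obtain c where c: "\<And>v. v \<in> V \<Longrightarrow> (c, v) \<in> E\<^sup>*" by blast
  then show ?thesis
    using assms(2,3) sym_rtrancl[OF grown_tree_props(3)[OF assms(1)]]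
    by (meson rtrancl_trans symD)
qed

text \<open>The first vertex of a longest simple path is a leaf: a neighbour off the path would
  lengthen it, and a neighbour on it beyond the second vertex would close a cycle.\<close>

lemma ex_leaf:
  assumes "finite V" "E \<subseteq> V \<times> V" "sym E" "irrefl E" "E \<noteq> {}" "\<And>c. \<not> is_cycle E c"
  obtains a b where "a \<noteq> b" "{v. (a, v) \<in> E} = {b}"
proof -
  let ?P = "\<lambda>c. length c \<ge> 2 \<and> distinct c \<and> (\<forall>i. Suc i < length c \<longrightarrow> (c ! i, c ! Suc i) \<in> E)"
  obtain a b where ab: "(a, b) \<in> E" using assms(5) by auto
  then have "?P [a, b]" using assms(4) by (auto simp: irrefl_def less_Suc_eq)
  moreover have sub: "set c \<subseteq> V" if P: "?P c" for c
  proof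
    fix v assume "v \<in> set c"
    then obtain i where i: "i < length c" "v = c ! i" by (auto simp: in_set_conv_nth)
    show "v \<in> V"
    proof (cases "Suc i < length c")
      case True then show ?thesis using P i assms(2) by blast
    next
      case False
      then obtain j where "i = Suc j" using i P by (cases i) auto
      then show ?thesis using P i assms(2) by blast
    qed
  qed
  then have "length c < Suc (card V)" if "?P c" for c
    using that sub[OF that] assms(1) by (metis card_mono distinct_card le_imp_less_Suc)
  ultimately obtain c where c: "?P c" and max: "\<And>d. ?P d \<Longrightarrow> length d \<le> length c"
    using ex_has_greatest_nat[of ?P "[a, b]" length "Suc (card V)"] by blast
  define h where "h = hd c"
  have "c \<noteq> []" using c by auto
  then have c0: "c \<noteq> []" "h = c ! 0" by (simp_all add: h_def hd_conv_nth)
  have nb: "v = c ! 1" if v: "(h, v) \<in> E" for v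
  proof (cases "v \<in> set c")
    case False
    have "?P (v # c)"
      using c False v c0 assms(3) by (auto simp: nth_Cons' sym_def gr0_conv_Suc)
    then show ?thesis using max by fastforce
  next
    case True
    then obtain j where j: "j < length c" "v = c ! j" by (auto simp: in_set_conv_nth)
    have "j \<noteq> 0" using v j c0 assms(4) by (cases j) (auto simp: irrefl_def)
    show ?thesis
    proof (cases "j = 1")
      case False
      then have "j \<ge> 2" using \<open>j \<noteq> 0\<close> by simp
      let ?d = "take (Suc j) c"
      have "last ?d = v" using j by (simp add: last_conv_nth c0)
      moreover have "hd ?d = h" using c0 h_def by simp
      ultimately have "is_cycle E ?d"
        using \<open>j \<ge> 2\<close> j c v assms(3) by (auto simp: is_cycle_def sym_def)
      then show ?thesis using assms(6) by blast
    qed (use j in simp)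
  qed
  have e: "(h, c ! 1) \<in> E" using c c0 by auto
  then have "h \<noteq> c ! 1" using assms(4) by (auto simp: irrefl_def)
  then show ?thesis using that[of h "c ! 1"] nb e by blast
qed

text \<open>Sending the leaf \<open>a\<close> to its neighbour \<open>b\<close> collapses the edge
  between them and keeps all others, so walks survive.\<close>

lemma leaf_retract_connected:
  assumes "sym E" "{v. (a, v) \<in> E} = {b}" "a \<noteq> b" "(u, v) \<in> E\<^sup>*" "u \<noteq> a" "v \<noteq> a"
  shows "(u, v) \<in> (E \<inter> (- {a}) \<times> (- {a}))\<^sup>*"
proof -
  let ?f = "\<lambda>z. if z = a then b else z"
  have "(?f u, ?f v) \<in> (E \<inter> (- {a}) \<times> (- {a}))\<^sup>*"
  proof (rule rtrancl_map_or_eq[OF assms(4)])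
    fix x y assume xy: "(x, y) \<in> E"
    then have "(y, x) \<in> E" using assms(1) by (auto simp: sym_def)
    then have "x = a \<Longrightarrow> y = b" "y = a \<Longrightarrow> x = b" using assms(2) xy by auto
    then show "?f x = ?f y \<or> (?f x, ?f y) \<in> E \<inter> (- {a}) \<times> (- {a})" using xy assms(3) by auto
  qed
  then show ?thesis using assms by simp
qed

lemma is_cycle_mono: "is_cycle E c \<Longrightarrow> E \<subseteq> F \<Longrightarrow> is_cycle F c"
  unfolding is_cycle_def by blast

lemma grown_treeI:
  assumes "finite V" "E \<subseteq> V \<times> V" "sym E" "irrefl E" "\<And>c. \<not> is_cycle E c" "V \<noteq> {}"
    "\<And>u v. u \<in> V \<Longrightarrow> v \<in> V \<Longrightarrow> (u, v) \<in> E\<^sup>*"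
  shows "grown_tree V E"
  using assms
proof (induction "card V" arbitrary: V E rule: less_induct)
  case less
  show ?case
  proof (cases "E = {}")
    case True
    obtain v where v: "v \<in> V" using less.prems(6) by auto
    have "V = {v}" using less.prems(7)[OF v] v True by fastforce
    then show ?thesis using True by (simp add: single)
  next
    case False
    obtain a b where ab: "a \<noteq> b" "{v. (a, v) \<in> E} = {b}"
      using ex_leaf[OF less.prems(1-4) False less.prems(5)] by blast
    let ?V = "V - {a}" and ?E = "E \<inter> (- {a}) \<times> (- {a})"
    have E: "(a, b) \<in> E" "(b, a) \<in> E" using ab less.prems(3) by (auto simp: sym_def)
    then have V: "a \<in> V" "b \<in> V" using less.prems(2) by auto
    have "grown_tree ?V ?E"
    proof (rule less.hyps)
      show "card ?V < card V" using V less.prems(1) by (meson card_Diff1_less)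
      show "(u, v) \<in> ?E\<^sup>*" if "u \<in> ?V" "v \<in> ?V" for u v
        using that leaf_retract_connected[OF less.prems(3) ab(2,1)] less.prems(7) by blast
      show "\<not> is_cycle ?E c" for c using less.prems(5) is_cycle_mono[of ?E c E] by blast
    qed (use less.prems V ab in \<open>auto simp: sym_def irrefl_def\<close>)
    then have "grown_tree (insert a ?V) (insert (a, b) (insert (b, a) ?E))"
      using V ab by (intro add_leaf) auto
    moreover have "insert a ?V = V" using V by auto
    moreover have "insert (a, b) (insert (b, a) ?E) = E"
    proof -
      have "x = a \<Longrightarrow> y = b" "y = a \<Longrightarrow> x = b" if "(x, y) \<in> E" for x y
        using that ab less.prems(3) by (auto simp: sym_def)
      then have "(x, y) \<in> insert (a, b) (insert (b, a) ?E)" if "(x, y) \<in> E" for x y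
        using that by (cases "x = a \<or> y = a") blast+
      then show ?thesis using E by (intro equalityI subrelI) auto
    qed
    ultimately show ?thesis by simp
  qed
qed

lemma is_tree_grown: "is_tree T \<Longrightarrow> grown_tree (verts T) (adj T)"
  by (rule grown_treeI) (use is_treeD in blast)+

text \<open>\<open>c\<close> names the two sides of the edge \<open>(a, b)\<close>. As a certificate
  of acyclicity it is easier to carry through a merge of vertices than the absence of
  cycles.\<close>

lemma grown_tree_bridge:
  assumes "grown_tree V E" "(a, b) \<in> E"
  obtains c :: "nat \<Rightarrow> bool" where "c a \<noteq> c b"
    "\<And>u v. (u, v) \<in> E \<Longrightarrow> c u \<noteq> c v \<Longrightarrow> {u, v} = {a, b}"
proof -
  have "\<exists>c :: nat \<Rightarrow> bool. c a \<noteq> c b \<and> (\<forall>(u, v) \<in> E. c u \<noteq> c v \<longrightarrow> {u, v} = {a, b})"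
    using assms
  proof (induction)
    case (add_leaf V E b' a')
    have E: "E \<subseteq> V \<times> V" using grown_tree_props add_leaf by auto
    show ?case
    proof (cases "(a, b) \<in> E")
      case True
      then obtain c :: "nat \<Rightarrow> bool" where c: "c a \<noteq> c b" "\<forall>(u, v) \<in> E. c u \<noteq> c v \<longrightarrow> {u, v} = {a, b}"
        using add_leaf.IH[OF True] by (elim exE conjE) (rule that)
      have ne: "a \<noteq> a'" "b \<noteq> a'" "b' \<noteq> a'" "\<And>u v. (u, v) \<in> E \<Longrightarrow> u \<noteq> a' \<and> v \<noteq> a'"
        using True E add_leaf.hyps by blast+
      show ?thesis
        by (rule exI[of _ "c(a' := c b')"]) (use c ne in auto)
    next
      case False
      then have "(a, b) = (a', b') \<or> (a, b) = (b', a')" using add_leaf by auto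
      then show ?thesis
        by (intro exI[of _ "\<lambda>z. z = a'"]) (use add_leaf E in auto)
    qed
  qed simp
  then obtain c :: "nat \<Rightarrow> bool" where "c a \<noteq> c b" "\<forall>(u, v) \<in> E. c u \<noteq> c v \<longrightarrow> {u, v} = {a, b}"
    by blast
  then show ?thesis using that[of c] by auto
qed

text \<open>The rest of a cycle leads from one end of its first edge to the other without using that
  edge, hence without changing sides.\<close>

lemma no_cycle_if_bridges:
  assumes "\<And>a b. (a, b) \<in> E \<Longrightarrow> \<exists>k :: nat \<Rightarrow> bool. k a \<noteq> k b \<and>
    (\<forall>u v. (u, v) \<in> E \<longrightarrow> k u \<noteq> k v \<longrightarrow> {u, v} = {a, b})"
  shows "\<not> is_cycle E c"
proof
  assume c: "is_cycle E c"
  then have L: "length c \<ge> 3" and d: "distinct c"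
    and s: "\<And>i. Suc i < length c \<Longrightarrow> (c ! i, c ! Suc i) \<in> E" and l: "(last c, hd c) \<in> E"
    by (auto simp: is_cycle_def)
  have ne: "c \<noteq> []" using L by auto
  have "(c ! 0, c ! 1) \<in> E" using s[of 0] L by simp
  from assms[OF this] obtain k :: "nat \<Rightarrow> bool" where k0: "k (c ! 0) \<noteq> k (c ! 1) \<and>
      (\<forall>u v. (u, v) \<in> E \<longrightarrow> k u \<noteq> k v \<longrightarrow> {u, v} = {c ! 0, c ! 1})" ..
  then have k: "k (c ! 0) \<noteq> k (c ! 1)"
      "\<And>u v. (u, v) \<in> E \<Longrightarrow> k u \<noteq> k v \<Longrightarrow> {u, v} = {c ! 0, c ! 1}"
    by auto
  have "k (c ! Suc j) = k (c ! 1)" if "Suc j < length c" for j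
    using that
  proof (induction j)
    case (Suc j)
    have "{c ! Suc j, c ! Suc (Suc j)} \<noteq> {c ! 0, c ! 1}"
      using d Suc.prems L ne by (auto simp: doubleton_eq_iff nth_eq_iff_index_eq)
    then show ?case using Suc k(2)[OF s[of "Suc j"]] by auto
  qed simp
  from this[of "length c - 2"] have "k (last c) = k (c ! 1)"
    using L by (simp add: last_conv_nth ne Suc_diff_Suc numeral_2_eq_2)
  moreover have "{last c, hd c} \<noteq> {c ! 0, c ! 1}"
    using d L ne by (auto simp: doubleton_eq_iff nth_eq_iff_index_eq last_conv_nth hd_conv_nth)
  ultimately show False using k(1) k(2)[OF l] ne by (auto simp: hd_conv_nth)
qed

lemma is_treeI:
  assumes "finite (verts T)" "adj T \<subseteq> verts T \<times> verts T" "sym (adj T)" "irrefl (adj T)"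
    "(lroot T, rroot T) \<in> adj T"
    "\<And>u v. u \<in> verts T \<Longrightarrow> v \<in> verts T \<Longrightarrow> (u, v) \<in> (adj T)\<^sup>*"
    "\<And>a b. (a, b) \<in> adj T \<Longrightarrow> \<exists>k :: nat \<Rightarrow> bool. k a \<noteq> k b \<and>
      (\<forall>u v. (u, v) \<in> adj T \<longrightarrow> k u \<noteq> k v \<longrightarrow> {u, v} = {a, b})"
  shows "is_tree T"
  unfolding is_tree_def using assms no_cycle_if_bridges[of "adj T"] by blast

lemma is_tree_bridge:
  assumes "is_tree T" "(a, b) \<in> adj T"
  obtains k :: "nat \<Rightarrow> bool" where "k a \<noteq> k b"
    "\<And>u v. (u, v) \<in> adj T \<Longrightarrow> k u \<noteq> k v \<Longrightarrow> {u, v} = {a, b}"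
  using grown_tree_bridge[OF is_tree_grown[OF assms(1)] assms(2)] by blast

section \<open>Reductions preserve trees\<close>

lemma is_tree_delete:
  assumes "is_tree T" "nonessential_thorn T a"
  shows "is_tree (delete_vertex T a)"
proof -
  note t = is_treeD[OF assms(1)]
  obtain b where b: "{v. (a, v) \<in> adj T} = {b}" and ra: "a \<noteq> lroot T" "a \<noteq> rroot T"
    using assms(2) by (auto simp: nonessential_thorn_def)
  have "a \<noteq> b" using b t(4) by (auto simp: irrefl_def)
  show ?thesis
  proof (rule is_treeI; unfold delete_vertex_def; simp)
    show "(u, v) \<in> (adj T \<inter> (- {a}) \<times> (- {a}))\<^sup>*"
      if "u \<in> verts T \<and> u \<noteq> a" "v \<in> verts T \<and> v \<noteq> a" for u v
      using leaf_retract_connected[OF t(3) b \<open>a \<noteq> b\<close> t(5)] that by blast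
    show "\<exists>k :: nat \<Rightarrow> bool. k x = (\<not> k y) \<and>
        (\<forall>u v. (u, v) \<in> adj T \<and> u \<noteq> a \<and> v \<noteq> a \<longrightarrow> k u = (\<not> k v) \<longrightarrow> {u, v} = {x, y})"
      if xy: "(x, y) \<in> adj T \<and> x \<noteq> a \<and> y \<noteq> a" for x y
      by (rule is_tree_bridge[OF assms(1), of x y]) (use xy in blast)+
  qed (use t ra in \<open>auto simp: sym_def irrefl_def\<close>)
qed

text \<open>An edge away from the fold keeps its sides, because \<open>u\<close>, \<open>v\<close>
  and \<open>w\<close> lie together there. Only the two edges that become one call for a new
  division.\<close>

lemma is_tree_merge:
  assumes T: "is_tree T" and f: "foldable T u v"
  shows "is_tree (merge_vertices T u v)"
proof -
  note t = is_treeD[OF T]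
  obtain w where uv: "u \<noteq> v" and w: "(u, w) \<in> adj T" "(v, w) \<in> adj T"
    using f by (auto simp: foldable_def)
  define g where "g = (\<lambda>z. if z = v then u else z)"
  have M: "merge_vertices T u v = T\<lparr>verts := g ` verts T, adj := map_prod g g ` adj T,
       lroot := g (lroot T), rroot := g (rroot T)\<rparr>"
    unfolding merge_vertices_def Let_def g_def ..
  have wuv: "w \<noteq> u" "w \<noteq> v" using w t(4) by (auto simp: irrefl_def)
  have gw: "g w = w" "g u = u" "g v = u" using wuv by (auto simp: g_def)
  obtain k1 :: "nat \<Rightarrow> bool" where k1: "k1 u \<noteq> k1 w"
    "\<And>x y. (x, y) \<in> adj T \<Longrightarrow> k1 x \<noteq> k1 y \<Longrightarrow> {x, y} = {u, w}"
    using is_tree_bridge[OF T w(1)] by blast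
  obtain k2 :: "nat \<Rightarrow> bool" where k2: "k2 v \<noteq> k2 w"
    "\<And>x y. (x, y) \<in> adj T \<Longrightarrow> k2 x \<noteq> k2 y \<Longrightarrow> {x, y} = {v, w}"
    using is_tree_bridge[OF T w(2)] by blast
  \<comment> \<open>An edge between \<open>u\<close> and \<open>v\<close> would become a
    loop.\<close>
  have notuv: "(u, v) \<notin> adj T"
  proof
    assume "(u, v) \<in> adj T"
    then have "k1 u = k1 v" using k1(2)[of u v] wuv uv by (auto simp: doubleton_eq_iff)
    moreover have "k1 v = k1 w" using k1(2)[OF w(2)] uv wuv by (auto simp: doubleton_eq_iff)
    ultimately show False using k1(1) by simp
  qed
  then have notvu: "(v, u) \<notin> adj T" using t(3) by (auto simp: sym_def)
  have key: "\<exists>k :: nat \<Rightarrow> bool. k (g x) \<noteq> k (g y) \<and>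
    (\<forall>a b. (a, b) \<in> adj T \<longrightarrow> k (g a) \<noteq> k (g b) \<longrightarrow> {g a, g b} = {g x, g y})" if xy: "(x, y) \<in> adj T" for x y
  proof (cases "{x, y} = {u, w} \<or> {x, y} = {v, w}")
    case True
    \<comment> \<open>The sum modulo 2 of the two old divisions: it separates \<open>w\<close> from
      both \<open>u\<close> and \<open>v\<close>, so it is constant on the merged vertex.\<close>
    let ?k = "\<lambda>z. k1 z \<noteq> k2 z"
    have kuw: "k2 u = k2 w" using k2(2)[OF w(1)] uv wuv by (auto simp: doubleton_eq_iff)
    have kvw: "k1 v = k1 w" using k1(2)[OF w(2)] uv wuv by (auto simp: doubleton_eq_iff)
    have kg: "?k (g z) = ?k z" for z using kuw kvw k1(1) k2(1) by (auto simp: g_def)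
    have "?k x \<noteq> ?k y" using True kuw kvw k1(1) k2(1) by (auto simp: doubleton_eq_iff)
    moreover have "{g a, g b} = {g x, g y}" if ab: "(a, b) \<in> adj T" "?k a \<noteq> ?k b" for a b
    proof -
      have "{a, b} = {u, w} \<or> {a, b} = {v, w}" using ab k1(2)[OF ab(1)] k2(2)[OF ab(1)] by blast
      then show ?thesis using True gw by (auto simp: doubleton_eq_iff)
    qed
    ultimately show ?thesis using kg by (intro exI[of _ ?k]) simp
  next
    case False
    obtain k :: "nat \<Rightarrow> bool" where k: "k x \<noteq> k y"
      "\<And>a b. (a, b) \<in> adj T \<Longrightarrow> k a \<noteq> k b \<Longrightarrow> {a, b} = {x, y}"
      using is_tree_bridge[OF T xy] by blast
    have "k u = k w" "k v = k w" using k(2)[OF w(1)] k(2)[OF w(2)] False by auto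
    then have kg: "k (g z) = k z" for z by (simp add: g_def)
    show ?thesis
    proof (intro exI[of _ k] conjI allI impI)
      show "k (g x) \<noteq> k (g y)" using k(1) by (simp add: kg)
      fix a b assume "(a, b) \<in> adj T" "k (g a) \<noteq> k (g b)"
      then have "{a, b} = {x, y}" using k(2) by (simp add: kg)
      then show "{g a, g b} = {g x, g y}" by (auto simp: doubleton_eq_iff)
    qed
  qed
  show ?thesis unfolding M
  proof (rule is_treeI; simp)
    show "sym (map_prod g g ` adj T)"
      using t(3) by (force simp: sym_def)
    show "irrefl (map_prod g g ` adj T)"
      using t(4) notuv notvu by (auto simp: irrefl_def g_def split: if_splits)
    show "map_prod g g ` adj T \<subseteq> g ` verts T \<times> g ` verts T" using t(2) by auto
    show "(g (lroot T), g (rroot T)) \<in> map_prod g g ` adj T" using t(7) by force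
    show "(x, y) \<in> (map_prod g g ` adj T)\<^sup>*" if xy: "x \<in> g ` verts T" "y \<in> g ` verts T" for x y
    proof -
      obtain x' y' where "x = g x'" "y = g y'" "x' \<in> verts T" "y' \<in> verts T" using xy by auto
      then show ?thesis
        using rtrancl_map_or_eq[OF t(5)[of x' y'], of g "map_prod g g ` adj T"]
        by (metis map_prod_imageI)
    qed
    show "\<exists>k :: nat \<Rightarrow> bool. k a = (\<not> k b) \<and> (\<forall>x y. (x, y) \<in> map_prod g g ` adj T \<longrightarrow>
        k x = (\<not> k y) \<longrightarrow> {x, y} = {a, b})" if ab: "(a, b) \<in> map_prod g g ` adj T" for a b
    proof -
      obtain x y where xy: "(x, y) \<in> adj T" "a = g x" "b = g y" using ab by auto
      obtain k :: "nat \<Rightarrow> bool" where k: "k (g x) \<noteq> k (g y)"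
        "\<forall>a b. (a, b) \<in> adj T \<longrightarrow> k (g a) \<noteq> k (g b) \<longrightarrow> {g a, g b} = {g x, g y}"
        using key[OF xy(1)] by (elim exE conjE) (rule that)
      show ?thesis
      proof (intro exI[of _ k] conjI allI impI)
        show "k a = (\<not> k b)" using k(1) by (simp add: xy)
        fix c d assume "(c, d) \<in> map_prod g g ` adj T" and kk: "k c = (\<not> k d)"
        then obtain c' d' where cd: "(c', d') \<in> adj T" "c = g c'" "d = g d'" by auto
        with kk have "k (g c') \<noteq> k (g d')" by simp
        then show "{c, d} = {a, b}" using k(2) cd xy by blast
      qed
    qed
  qed (use t(1) in simp)
qed

lemma is_tree_pre_step: "pre_step S T \<Longrightarrow> is_tree S \<Longrightarrow> is_tree T"
  by (auto elim!: pre_step.cases intro: is_tree_delete is_tree_merge)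

section \<open>The group model\<close>

text \<open>Contracting all edges with equal end labels turns a folded tree into a subtree of the universal
  cover of the complete digraph on the letters. In \<open>(l, T, r)\<close> the letters \<open>l\<close> and \<open>r\<close> label the roots,
  and \<open>T\<close> holds the vertices with their labels, a vertex being given by its position relative to the
  left root in the free group on the pairs of letters. A pair \<open>(x, x)\<close> counts as the identity.\<close>

type_synonym 'x model = "'x \<times> (('x \<times> 'x) free_group \<times> 'x) set \<times> 'x"

definition translate :: "'g::plus \<Rightarrow> ('g \<times> 'x) set \<Rightarrow> ('g \<times> 'x) set" where
  "translate g T = (\<lambda>(w, y). (g + w, y)) ` T"

text \<open>The left root of \<open>M\<close> is the origin. In the join the right root of
  \<open>N\<close> becomes its neighbour, at \<open>edge_gen l r'\<close>, whereas inside
  \<open>N\<close> it sits at \<open>edge_gen l' r'\<close>; the translation makes the two agree.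
  Vertices that would be folded then coincide.\<close>

definition model_meet :: "'x model \<Rightarrow> 'x model \<Rightarrow> 'x model" where
  "model_meet M N = (case (M, N) of ((l, S, r), (l', T, r')) \<Rightarrow>
     (l, S \<union> translate (edge_gen l r' - edge_gen l' r') T, r'))"

definition model_letter :: "'x \<Rightarrow> 'x model" where
  "model_letter y = (y, {(0, y)}, y)"

text \<open>These are exactly the models of trees (\<open>model_generated\<close>,
  \<open>generated_model\<close>); a substitution with values here comes from an
  endomorphism.\<close>

inductive_set generated :: "'x model set" where
  letter: "model_letter y \<in> generated"
| meet: "M \<in> generated \<Longrightarrow> N \<in> generated \<Longrightarrow> model_meet M N \<in> generated"

text \<open>The index type is arbitrary because both the vertices of a tree and the integers of a line
  will be placed.\<close>

definition placed :: "('v \<Rightarrow> ('x \<times> 'x) free_group) \<Rightarrow> ('v \<Rightarrow> 'x) \<Rightarrow> 'v \<Rightarrow> 'v \<Rightarrow> 'v set \<Rightarrow> 'x model" where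
  "placed p f l r V = (f l, (\<lambda>v. (- p l + p v, f v)) ` V, f r)"

text \<open>Arcs run from left to right vertices. They are reflexive because an edge with equal end
  labels is contracted, so that one point serves as both ends.\<close>

definition arc :: "('v \<Rightarrow> ('x \<times> 'x) free_group) \<Rightarrow> ('v \<Rightarrow> 'x) \<Rightarrow> 'v \<Rightarrow> 'v \<Rightarrow> bool" where
  "arc p f a b \<longleftrightarrow> p b = p a + edge_gen (f a) (f b)"

lemma arc_refl [simp]: "arc p f a a"
  by (simp add: arc_def)

lemma placed_letter: "placed p f a a {a} = model_letter (f a)"
  by (simp add: placed_def model_letter_def)

text \<open>Both arguments are parts of one placed graph: the two arcs into \<open>r'\<close> turn
  the translation into \<open>- p l + p l'\<close>, which exchanges the base point of the second
  argument for that of the first.\<close>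

lemma placed_meet:
  assumes "arc p f l r'" "arc p f l' r'"
  shows "model_meet (placed p f l r V) (placed p f l' r' W) = placed p f l r' (V \<union> W)"
proof -
  have "edge_gen (f l) (f r') - edge_gen (f l') (f r') = - p l + p l'"
  proof -
    have "edge_gen (f l) (f r') = - p l + p r'"
      using assms(1) unfolding arc_def by (simp only: minus_add_cancel)
    moreover have "edge_gen (f l') (f r') = - p l' + p r'"
      using assms(2) unfolding arc_def by (simp only: minus_add_cancel)
    ultimately show ?thesis
      by (simp only: diff_conv_add_uminus minus_add minus_minus add.assoc add_minus_cancel)
  qed
  moreover have "- p l + p l' + (- p l' + p v) = - p l + p v" for v
    by (simp add: add.assoc)
  ultimately show ?thesis
    by (simp add: model_meet_def placed_def translate_def image_Un image_image)
qed

text \<open>Multiplying by letters moves the roots along an arc. A relation \<open>Q\<close> is used so that this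
  covers congruences as well as the generated subalgebra.\<close>

locale meet_relation =
  fixes Q :: "'x model \<Rightarrow> 'x model \<Rightarrow> bool"
  assumes letter_rel: "Q (model_letter y) (model_letter y)"
    and meet_rel: "Q M N \<Longrightarrow> Q M' N' \<Longrightarrow> Q (model_meet M M') (model_meet N N')"
begin

lemma point_rel: "Q (placed p f b b {b}) (placed p f b b {b})"
  unfolding placed_letter by (rule letter_rel)

text \<open>A meet keeps the left root of its first factor and the right root of its second.
  Multiplying by the letter at \<open>b\<close> on both sides therefore moves both roots; the
  direction of the arc decides which root must move first.\<close>

lemma root_step:
  assumes "Q (placed p f a a V) (placed p f a a W)" "arc p f a b \<or> arc p f b a"
  shows "Q (placed p f b b (insert b V)) (placed p f b b (insert b W))"
  using assms(2)
proof
  assume ab: "arc p f a b"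
  from meet_rel[OF assms(1) point_rel[of p f b]]
  have "Q (placed p f a b (insert b V)) (placed p f a b (insert b W))"
    using placed_meet[OF ab, of b a _ "{b}"] by simp
  from meet_rel[OF point_rel[of p f b] this] show ?thesis
    using placed_meet[OF arc_refl ab, of b "{b}"] by simp
next
  assume ba: "arc p f b a"
  from meet_rel[OF point_rel[of p f b] assms(1)]
  have "Q (placed p f b a (insert b V)) (placed p f b a (insert b W))"
    using placed_meet[OF ba, of a b "{b}"] by simp
  from meet_rel[OF this point_rel[of p f b]] show ?thesis
    using placed_meet[OF arc_refl arc_refl, of p f b a _ "{b}"] by simp
qed

lemma roots_apart:
  assumes "Q (placed p f a a V) (placed p f a a W)" "arc p f a b" "b \<in> V" "b \<in> W"
  shows "Q (placed p f a b V) (placed p f a b W)"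
  using meet_rel[OF assms(1) point_rel[of p f b]] placed_meet[OF assms(2), of b a _ "{b}"] assms(3,4)
  by (simp add: insert_absorb)

lemma roots_together:
  assumes "Q (placed p f a b V) (placed p f a b W)" "a \<in> V" "a \<in> W"
  shows "Q (placed p f a a V) (placed p f a a W)"
  using meet_rel[OF assms(1) point_rel[of p f a]]
    placed_meet[OF arc_refl arc_refl, of p f a b _ "{a}"] assms(2,3)
  by (simp add: insert_absorb)

end

text \<open>A predicate is treated as a relation that ignores its second argument; side conditions
  on the second set can then be met with \<open>UNIV\<close>.\<close>

interpretation generated: meet_relation "\<lambda>M N. M \<in> generated"
  by unfold_locales (auto intro: generated.intros)

lemmas placed_root_step = generated.root_step
lemmas placed_roots_apart = generated.roots_apart[where W = UNIV, OF _ _ _ UNIV_I]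

lemmas placed_point_generated = generated.point_rel

text \<open>A leaf is added by moving the roots onto it, since \<open>root_step\<close> inserts its
  target. The roots then walk back through the old tree to any prescribed vertex.\<close>

lemma placed_tree_generated:
  fixes p :: "nat \<Rightarrow> ('x \<times> 'x) free_group"
  assumes "grown_tree V E" "\<And>a b. (a, b) \<in> E \<Longrightarrow> arc p f a b \<or> arc p f b a" "v \<in> V"
  shows "placed p f v v V \<in> generated"
  using assms
proof (induction arbitrary: v)
  case (single u)
  then show ?case by (simp add: placed_letter letter)
next
  case (add_leaf V E b a)
  have "placed p f b b V \<in> generated" using add_leaf by blast
  then have a: "placed p f a a (insert a V) \<in> generated"
    by (rule placed_root_step) (use add_leaf.hyps add_leaf.prems(1)[of a b] in auto)
  show ?case
  proof (cases "v = a")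
    case False
    then have "v \<in> V" using add_leaf by simp
    then have "placed p f v v V \<in> generated" using add_leaf by blast
    have 2: "placed p f b b (insert a V) \<in> generated"
      using placed_root_step[OF a, of b] add_leaf by (simp add: insert_absorb)
    have conn: "(b, u) \<in> E\<^sup>* \<Longrightarrow> placed p f u u (insert a V) \<in> generated \<and> u \<in> V" for u
    proof (induction rule: rtrancl_induct)
      case (step y z)
      have y: "y \<in> V" "z \<in> V" using step(2) grown_tree_props(2)[OF add_leaf.hyps(1)] by blast+
      have "arc p f y z \<or> arc p f z y" by (rule add_leaf.prems(1)) (use step in simp)
      from placed_root_step[OF _ this, of "insert a V"] step.IH y show ?case
        by (simp add: insert_absorb)
    qed (use 2 add_leaf in auto)
    have "(b, v) \<in> E\<^sup>*" using grown_tree_connected add_leaf.hyps \<open>v \<in> V\<close> by blast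
    then show ?thesis using conn by blast
  qed (use a in simp)
qed

section \<open>Potentials on trees\<close>

text \<open>\<open>k\<close> marks the left vertices and \<open>p\<close> sums weights directed from
  left to right. The weights are left open because two are used: \<open>edge_gen\<close>, for
  positions in the free group, and the integer \<open>shift\<close> along the cycle.\<close>

definition potential :: "'x rgraph \<Rightarrow> (nat \<Rightarrow> bool) \<Rightarrow> (nat \<Rightarrow> 'g) \<Rightarrow> ('x \<Rightarrow> 'x \<Rightarrow> 'g::group_add) \<Rightarrow> bool" where
  "potential T k p w \<longleftrightarrow> k (lroot T) \<and> p (lroot T) = 0 \<and>
     (\<forall>a b. (a, b) \<in> adj T \<longrightarrow> k a \<noteq> k b \<and> (k a \<longrightarrow> p b = p a + w (lab T a) (lab T b)))"

lemma grown_tree_potential: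
  assumes "grown_tree V E"
  shows "\<exists>k (p :: nat \<Rightarrow> 'g::group_add). \<forall>a b. (a, b) \<in> E \<longrightarrow> k a \<noteq> k b \<and> (k a \<longrightarrow> p b = p a + w a b)"
  using assms
proof induction
  case (add_leaf V E b a)
  then obtain k and p :: "nat \<Rightarrow> 'g" where
    kp: "\<And>a b. (a, b) \<in> E \<Longrightarrow> k a \<noteq> k b \<and> (k a \<longrightarrow> p b = p a + w a b)" by blast
  have E: "\<And>u v. (u, v) \<in> E \<Longrightarrow> u \<noteq> a \<and> v \<noteq> a" and "b \<noteq> a"
    using grown_tree_props(2)[OF add_leaf.hyps(1)] add_leaf.hyps by blast+
  then show ?case
    by (intro exI[of _ "k(a := \<not> k b)"] exI[of _ "p(a := (if k b then p b + w b a else p b - w a b))"])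
      (use kp in auto)
qed simp

lemma is_tree_potential:
  fixes w :: "'x \<Rightarrow> 'x \<Rightarrow> 'g::group_add"
  assumes "is_tree T"
  obtains k p where "potential T k p w"
proof -
  obtain k :: "nat \<Rightarrow> bool" and p :: "nat \<Rightarrow> 'g" where kp: "\<And>a b. (a, b) \<in> adj T \<Longrightarrow>
      k a \<noteq> k b \<and> (k a = k (lroot T) \<longrightarrow> p b = p a + w (lab T a) (lab T b))"
  proof -
    \<comment> \<open>\<open>grown_tree_potential\<close> chooses the two-colouring itself, so
      weights that depend on the side take two runs: zero weights fix \<open>k\<close>, and the
      second run uses it.\<close>
    obtain k :: "nat \<Rightarrow> bool" and p' :: "nat \<Rightarrow> 'g" where k: "\<forall>a b. (a, b) \<in> adj T \<longrightarrow> k a \<noteq> k b \<and> (k a \<longrightarrow> p' b = p' a + 0)"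
      using grown_tree_potential[OF is_tree_grown[OF assms], of "\<lambda>_ _. 0"] by blast
    obtain k' :: "nat \<Rightarrow> bool" and p :: "nat \<Rightarrow> 'g" where p: "\<forall>a b. (a, b) \<in> adj T \<longrightarrow> k' a \<noteq> k' b \<and>
        (k' a \<longrightarrow> p b = p a + (if k a = k (lroot T) then w (lab T a) (lab T b) else - w (lab T b) (lab T a)))"
      using grown_tree_potential[OF is_tree_grown[OF assms],
        of "\<lambda>a b. if k a = k (lroot T) then w (lab T a) (lab T b) else - w (lab T b) (lab T a)"] by blast
    \<comment> \<open>The colouring \<open>k'\<close> of the second run may be opposite to
      \<open>k\<close>; the edge is then read backwards and the negated weight compensates.\<close>
    have "p b = p a + w (lab T a) (lab T b)" if ab: "(a, b) \<in> adj T" "k a = k (lroot T)" for a b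
    proof (cases "k' a")
      case True
      then show ?thesis using p ab by auto
    next
      case False
      have ba: "(b, a) \<in> adj T" using ab is_treeD(3)[OF assms] by (auto simp: sym_def)
      then have "k b \<noteq> k (lroot T)" "k' b" using k p ab False by blast+
      then have "p a = p b + - w (lab T a) (lab T b)" using p ba by auto
      then show ?thesis by (simp add: add.assoc)
    qed
    note eq = this
    show ?thesis by (rule that[of k p]) (use k eq in blast)
  qed
  let ?c = "p (lroot T)"
  have "potential T (\<lambda>v. k v = k (lroot T)) (\<lambda>v. - ?c + p v) w"
    unfolding potential_def using kp by (auto simp: add.assoc)
  then show ?thesis by (rule that)
qed

lemma potential_unique:
  assumes "is_tree T" "potential T k p w" "potential T k' p' w" "v \<in> verts T"
  shows "k v = k' v" "p v = p' v"
proof -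
  have "(lroot T, v) \<in> (adj T)\<^sup>*" using is_treeD[OF assms(1)] assms(4) by blast
  then have "k v = k' v \<and> p v = p' v"
  proof (induction rule: rtrancl_induct)
    case base
    then show ?case using assms(2,3) by (simp add: potential_def)
  next
    case (step y z)
    have zy: "(z, y) \<in> adj T" using step(2) is_treeD(3)[OF assms(1)] by (auto simp: sym_def)
    have k: "k y \<noteq> k z" "k' y \<noteq> k' z" using assms(2,3) step(2) unfolding potential_def by blast+
    show ?case
    proof (cases "k y")
      case True
      then show ?thesis using assms(2,3) step k unfolding potential_def by auto
    next
      case False
      then have "p y = p z + w (lab T z) (lab T y)" "p' y = p' z + w (lab T z) (lab T y)"
        using assms(2,3) zy k step.IH unfolding potential_def by blast+
      then have "p z = p' z" using step.IH by (metis add_right_cancel)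
      then show ?thesis using k step.IH by blast
    qed
  qed
  then show "k v = k' v" "p v = p' v" by auto
qed

text \<open>Sides alternate along a walk, so the parity of any walk from the left root decides them,
  in particular that of a shortest one.\<close>

lemma potential_side:
  assumes "is_tree T" "potential T k p w" "v \<in> verts T"
  shows "left_vertex T v \<longleftrightarrow> k v" "right_vertex T v \<longleftrightarrow> \<not> k v"
proof -
  have par: "(u, v) \<in> adj T ^^ m \<Longrightarrow> k v = (k u = even m)" for u v m
  proof (induction m arbitrary: v)
    case (Suc m)
    then obtain y where y: "(u, y) \<in> adj T ^^ m" "(y, v) \<in> adj T" by auto
    then have "k y \<noteq> k v" using assms(2) unfolding potential_def by blast
    then show ?case using Suc.IH[OF y(1)] by auto
  qed simp
  have "(lroot T, v) \<in> (adj T)\<^sup>*" using is_treeD[OF assms(1)] assms(3) by blast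
  then obtain m where "(lroot T, v) \<in> adj T ^^ m" using rtrancl_power by blast
  then have "(lroot T, v) \<in> adj T ^^ graph_dist (adj T) (lroot T) v"
    unfolding graph_dist_def by (rule LeastI)
  from par[OF this] have "k v = even (graph_dist (adj T) (lroot T) v)"
    using assms(2) by (simp add: potential_def)
  then show "left_vertex T v \<longleftrightarrow> k v" "right_vertex T v \<longleftrightarrow> \<not> k v"
    using assms(3) by (auto simp: left_vertex_def right_vertex_def)
qed

section \<open>The model of a tree\<close>

text \<open>By \<open>potential_unique\<close> all admissible \<open>p\<close> agree on the
  vertices, so the choice is immaterial.\<close>

definition pre_model :: "'x rgraph \<Rightarrow> 'x model" where
  "pre_model T = (let p = (SOME p. \<exists>k. potential T k p edge_gen) in
     (lab T (lroot T), (\<lambda>v. (p v, lab T v)) ` verts T, lab T (rroot T)))"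

lemma pre_model_eq:
  assumes "is_tree T" "potential T k p edge_gen"
  shows "pre_model T = (lab T (lroot T), (\<lambda>v. (p v, lab T v)) ` verts T, lab T (rroot T))"
proof -
  let ?q = "SOME p. \<exists>k. potential T k p edge_gen"
  have "\<exists>k. potential T k ?q edge_gen"
    using someI[of "\<lambda>p. \<exists>k. potential T k p edge_gen" p] assms(2) by blast
  then obtain k' where "potential T k' ?q edge_gen" ..
  note q = potential_unique(2)[OF assms(1) this assms(2)]
  have "(\<lambda>v. (?q v, lab T v)) ` verts T = (\<lambda>v. (p v, lab T v)) ` verts T"
    by (rule image_cong) (simp_all add: q)
  then show ?thesis by (simp add: pre_model_def)
qed

lemma potential_edge:
  assumes "potential T k p w" "(a, b) \<in> adj T"
  shows "k a \<noteq> k b" "k a \<Longrightarrow> p b = p a + w (lab T a) (lab T b)"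
  using assms unfolding potential_def by blast+

lemma pre_model_iso:
  assumes "tree_iso S T"
  shows "pre_model S = pre_model T"
proof -
  from assms obtain f where f: "iso_map f S T" and t: "is_tree S" "is_tree T"
    by (auto simp: tree_iso_def)
  obtain k p where kp: "potential T k p edge_gen" using is_tree_potential[OF t(2)] by blast
  note r = is_treeD[OF t(1)]
  have "potential S (k \<circ> f) (p \<circ> f) edge_gen"
    unfolding potential_def
  proof (intro conjI allI impI; simp?)
    show "k (f (lroot S))" "p (f (lroot S)) = 0" using kp f by (auto simp: potential_def iso_map_def)
    fix a b assume ab: "(a, b) \<in> adj S"
    then have v: "a \<in> verts S" "b \<in> verts S" using r by auto
    then have "(f a, f b) \<in> adj T" using f ab by (auto simp: iso_map_def)
    from potential_edge[OF kp this] f v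
    show "k (f a) = (\<not> k (f b))"
      and "k (f a) \<Longrightarrow> p (f b) = p (f a) + edge_gen (lab S a) (lab S b)"
      by (auto simp: iso_map_def)
  qed
  note pot = this
  have "(\<lambda>v. (p v, lab T v)) ` (f ` verts S) = (\<lambda>v. ((p \<circ> f) v, lab S v)) ` verts S"
    unfolding image_image by (rule image_cong) (use f in \<open>auto simp: iso_map_def\<close>)
  moreover have "f ` verts S = verts T" "lab T (lroot T) = lab S (lroot S)" "lab T (rroot T) = lab S (rroot S)"
    using f r(8,9) by (auto simp: iso_map_def bij_betw_def)
  ultimately show ?thesis by (simp add: pre_model_eq[OF t(1) pot] pre_model_eq[OF t(2) kp])
qed

lemma pre_model_join:
  assumes "is_tree S" "is_tree T"
  shows "pre_model (pre_join S T) = model_meet (pre_model S) (pre_model T)"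
proof -
  obtain k p where kp: "potential S k p edge_gen" using is_tree_potential[OF assms(1)] by blast
  obtain k' p' where kp': "potential T k' p' edge_gen" using is_tree_potential[OF assms(2)] by blast
  let ?l = "lab S (lroot S)" and ?r' = "lab T (rroot T)" and ?l' = "lab T (lroot T)"
  let ?g = "edge_gen ?l ?r' - edge_gen ?l' ?r'"
  let ?k = "\<lambda>z. if even z then k (z div 2) else k' (z div 2)"
  let ?p = "\<lambda>z. if even z then p (z div 2) else ?g + p' (z div 2)"
  let ?J = "pre_join S T"
  have l: "k (lroot S)" "p (lroot S) = 0" "k' (lroot T)" "p' (lroot T) = 0"
    using kp kp' by (auto simp: potential_def)
  have r: "\<not> k' (rroot T)" "p' (rroot T) = edge_gen ?l' ?r'"
    using potential_edge[OF kp' is_treeD(7)[OF assms(2)]] l by auto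
  have J: "lroot ?J = 2 * lroot S" "rroot ?J = 2 * rroot T + 1"
    "lab ?J = (\<lambda>v. if even v then lab S (v div 2) else lab T (v div 2))"
    by (simp_all add: pre_join_def)
  have "potential ?J ?k ?p edge_gen"
    unfolding potential_def
  proof (intro conjI allI impI)
    show "?k (lroot ?J)" "?p (lroot ?J) = 0" using l J by auto
    fix a b assume "(a, b) \<in> adj ?J"
    then consider (1) u v where "a = 2 * u" "b = 2 * v" "(u, v) \<in> adj S"
      | (2) u v where "a = 2 * u + 1" "b = 2 * v + 1" "(u, v) \<in> adj T"
      | (3) "a = 2 * lroot S" "b = 2 * rroot T + 1"
      | (4) "a = 2 * rroot T + 1" "b = 2 * lroot S"
      by (auto simp: pre_join_def)
    then have "?k a \<noteq> ?k b \<and> (?k a \<longrightarrow> ?p b = ?p a + edge_gen (lab ?J a) (lab ?J b))"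
    proof cases
      case 1
      then show ?thesis using potential_edge[OF kp 1(3)] by (simp add: J)
    next
      case 2
      then show ?thesis using potential_edge[OF kp' 2(3)] by (simp add: J add.assoc)
    qed (use l r in \<open>simp_all add: J\<close>)
    then show "?k a \<noteq> ?k b" and "?k a \<Longrightarrow> ?p b = ?p a + edge_gen (lab ?J a) (lab ?J b)"
      by blast+
  qed
  from pre_model_eq[OF is_tree_join[OF assms] this]
  have "pre_model ?J = (?l, (\<lambda>v. (?p v, lab ?J v)) ` verts ?J, ?r')"
    by (simp add: J)
  also have "(\<lambda>v. (?p v, lab ?J v)) ` verts ?J =
      (\<lambda>v. (p v, lab S v)) ` verts S \<union> translate ?g ((\<lambda>v. (p' v, lab T v)) ` verts T)"
    unfolding J by (simp add: pre_join_def image_Un image_image translate_def)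
  finally show ?thesis
    by (simp add: model_meet_def pre_model_eq[OF assms(1) kp] pre_model_eq[OF assms(2) kp'])
qed

text \<open>A thorn has the position and label of its neighbour, and folded vertices have equal
  labels and a common neighbour, hence equal positions. So the set of labelled positions stays the
  same.\<close>

lemma pre_model_step:
  assumes "pre_step S T" "is_tree S"
  shows "pre_model T = pre_model S"
proof -
  have T: "is_tree T" using is_tree_pre_step assms .
  note t = is_treeD[OF assms(2)]
  obtain k p where kp: "potential S k p edge_gen" using is_tree_potential[OF assms(2)] by blast
  have l: "k (lroot S)" "p (lroot S) = 0" using kp by (auto simp: potential_def)
  show ?thesis
    using assms(1)
  proof cases
    case (thorn a)
    obtain b where b: "a \<in> verts S" "{v. (a, v) \<in> adj S} = {b}" "lab S a = lab S b"
      using thorn(2) by (auto simp: nonessential_thorn_def)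
    have e: "(a, b) \<in> adj S" "(b, a) \<in> adj S" using b t(3) by (auto simp: sym_def)
    then have "p a = p b" "b \<noteq> a" "b \<in> verts S"
      using potential_edge[OF kp e(1)] potential_edge[OF kp e(2)] b t(2) by auto
    then have "(\<lambda>v. (p v, lab S v)) ` (verts S - {a}) = (\<lambda>v. (p v, lab S v)) ` verts S"
      using b by (auto simp: image_iff)
    moreover have "potential T k p edge_gen"
      using kp unfolding potential_def thorn(1) delete_vertex_def by auto
    ultimately show ?thesis
      using pre_model_eq[OF T, of k p] pre_model_eq[OF assms(2) kp] by (simp add: thorn(1) delete_vertex_def)
  next
    case (edge_fold u v)
    obtain w where uv: "lab S u = lab S v" and w: "(u, w) \<in> adj S" "(v, w) \<in> adj S"
      using edge_fold(2) by (auto simp: foldable_def)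
    have w': "(w, u) \<in> adj S" "(w, v) \<in> adj S" using w t(3) by (auto simp: sym_def)
    define g where "g = (\<lambda>z. if z = v then u else z)"
    have M: "T = S\<lparr>verts := g ` verts S, adj := map_prod g g ` adj S,
         lroot := g (lroot S), rroot := g (rroot S)\<rparr>"
      unfolding edge_fold(1) merge_vertices_def Let_def g_def ..
    have k: "k u \<noteq> k w" "k v \<noteq> k w" using potential_edge(1)[OF kp] w by auto
    have "p u = p v"
    proof (cases "k w")
      case True
      then show ?thesis using potential_edge(2)[OF kp w'(1)] potential_edge(2)[OF kp w'(2)] uv by simp
    next
      case False
      then have "p w = p u + edge_gen (lab S u) (lab S w)" "p w = p v + edge_gen (lab S v) (lab S w)"
        using k potential_edge(2)[OF kp w(1)] potential_edge(2)[OF kp w(2)] by auto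
      then show ?thesis using uv by (metis add_right_cancel)
    qed
    then have g: "p (g z) = p z" "k (g z) = k z" "lab S (g z) = lab S z" for z
      using k uv by (auto simp: g_def)
    have "potential T k p edge_gen"
      using kp g unfolding potential_def M by auto
    from pre_model_eq[OF T this] pre_model_eq[OF assms(2) kp]
    show ?thesis by (simp add: M g image_image)
  qed
qed

lemma pre_model_generated:
  assumes "is_tree T"
  shows "pre_model T \<in> generated"
proof -
  note t = is_treeD[OF assms]
  obtain k p where kp: "potential T k p edge_gen" using is_tree_potential[OF assms] by blast
  have arc: "arc p (lab T) a b \<or> arc p (lab T) b a" if "(a, b) \<in> adj T" for a b
    using potential_edge[OF kp that] potential_edge[OF kp, of b a] that t(3)
    unfolding arc_def sym_def by blast
  have "placed p (lab T) (lroot T) (lroot T) (verts T) \<in> generated"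
    by (rule placed_tree_generated[OF is_tree_grown[OF assms] arc t(8)])
  moreover have "arc p (lab T) (lroot T) (rroot T)"
    using potential_edge(2)[OF kp t(7)] kp by (auto simp: potential_def arc_def)
  ultimately have "placed p (lab T) (lroot T) (rroot T) (verts T) \<in> generated"
    using t(9) by (rule placed_roots_apart)
  then show ?thesis
    using kp by (simp add: pre_model_eq[OF assms kp] placed_def potential_def)
qed

section \<open>Reduced trees are determined by their models\<close>

lemma rtrancl_simple_path:
  assumes "(u, v) \<in> E\<^sup>*"
  obtains vs where "distinct (u # vs)" "successively (\<lambda>a b. (a, b) \<in> E) (u # vs)" "last (u # vs) = v"
proof -
  have "\<exists>vs. distinct (u # vs) \<and> successively (\<lambda>a b. (a, b) \<in> E) (u # vs) \<and> last (u # vs) = v"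
    using assms
  proof (induction rule: converse_rtrancl_induct)
    case (step y z)
    then obtain vs where vs: "distinct (z # vs)" "successively (\<lambda>a b. (a, b) \<in> E) (z # vs)"
      "last (z # vs) = v" by blast
    show ?case
    proof (cases "y \<in> set (z # vs)")
      case True
      then obtain xs ys where s: "z # vs = xs @ y # ys" by (meson split_list)
      then have "distinct (y # ys)" using vs(1) by (metis distinct_append)
      moreover have "successively (\<lambda>a b. (a, b) \<in> E) (y # ys)"
        using vs(2) unfolding s by (simp add: successively_append_iff)
      moreover have "last (y # ys) = v" using vs(3) unfolding s by simp
      ultimately show ?thesis by blast
    next
      case False
      then show ?thesis using vs step(1) by (intro exI[of _ "z # vs"]) auto
    qed
  qed (intro exI[of _ "[]"]; simp)
  then show ?thesis using that by blast
qed

definition irreducible :: "'x rgraph \<Rightarrow> bool" where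
  "irreducible T \<longleftrightarrow> (\<forall>u v. \<not> foldable T u v) \<and> (\<forall>a. \<not> nonessential_thorn T a)"

definition step_word :: "'x rgraph \<Rightarrow> (nat \<Rightarrow> bool) \<Rightarrow> nat \<Rightarrow> nat \<Rightarrow> (('x \<times> 'x) \<times> bool) list" where
  "step_word T k a b = (if lab T a = lab T b then []
     else if k a then [((lab T a, lab T b), True)] else [((lab T b, lab T a), False)])"

fun path_word :: "'x rgraph \<Rightarrow> (nat \<Rightarrow> bool) \<Rightarrow> nat list \<Rightarrow> (('x \<times> 'x) \<times> bool) list" where
  "path_word T k (a # b # vs) = step_word T k a b @ path_word T k (b # vs)"
| "path_word T k vs = []"

locale folded_tree =
  fixes T :: "'x rgraph" and k :: "nat \<Rightarrow> bool" and p :: "nat \<Rightarrow> ('x \<times> 'x) free_group"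
  assumes tree: "is_tree T"
    and irr: "irreducible T"
    and pot: "potential T k p edge_gen"
begin

lemmas t = is_treeD[OF tree]
lemmas edge = potential_edge[OF pot]

lemma adj_sym: "(a, b) \<in> adj T \<Longrightarrow> (b, a) \<in> adj T"
  using t(3) by (auto simp: sym_def)

lemma folded: "(u, w) \<in> adj T \<Longrightarrow> (v, w) \<in> adj T \<Longrightarrow> lab T u = lab T v \<Longrightarrow> u = v"
  using irr unfolding irreducible_def foldable_def by blast

abbreviation path :: "nat list \<Rightarrow> bool" where
  "path vs \<equiv> distinct vs \<and> successively (\<lambda>a b. (a, b) \<in> adj T) vs"

lemma path_labels:
  assumes "path (a # b # c # vs)"
  shows "lab T a \<noteq> lab T c"
  using folded[of a b c] adj_sym assms by auto

lemma edge_position: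
  assumes "(a, b) \<in> adj T"
  shows "- p a + p b = (if lab T a = lab T b then 0
    else gen (if k a then ((lab T a, lab T b), True) else ((lab T b, lab T a), False)))"
proof (cases "k a")
  case True
  from edge(2)[OF assms this] show ?thesis using True by (simp add: edge_gen_def)
next
  case False
  then have "k b" using edge(1)[OF assms] by simp
  from edge(2)[OF adj_sym[OF assms] this] have "- p a + p b = - edge_gen (lab T b) (lab T a)"
    by (simp add: minus_add)
  then show ?thesis using False gen_inv[of "((lab T b, lab T a), True)"] by (simp add: edge_gen_def)
qed

text \<open>Successive letters could cancel only if the outer ends \<open>a\<close> and
  \<open>c\<close> had equal labels, and these would be foldable. If an edge with equal labels lies
  between, the edges around it start on the same side, so their letters have the same
  exponent.\<close>

lemma path_word_hd:
  assumes "path (a # b # vs)" "lab T a \<noteq> lab T b" "path_word T k (b # vs) \<noteq> []"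
  shows "hd (path_word T k (b # vs)) \<noteq> inv_letter (hd (step_word T k a b))"
proof -
  obtain c ws where vs: "vs = c # ws" using assms(3) by (cases vs) auto
  have ab: "k a \<noteq> k b" and bc: "k b \<noteq> k c" using edge(1) assms(1) vs by auto
  have ac: "lab T a \<noteq> lab T c" using path_labels assms(1) vs by simp
  show ?thesis
  proof (cases "lab T b = lab T c")
    case False
    then show ?thesis using ab bc ac assms(2) by (auto simp: vs step_word_def)
  next
    case True
    then obtain d us where ws: "ws = d # us" using assms(3) vs by (cases ws) (auto simp: step_word_def)
    have "lab T b \<noteq> lab T d" using path_labels[of b c d us] assms(1) vs ws by simp
    then show ?thesis using True ab bc ac assms(2) by (auto simp: vs ws step_word_def)
  qed
qed

lemma word_of_path:
  assumes "path (a # vs)"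
  shows "word_of (- p a + p (last (a # vs))) = path_word T k (a # vs)"
  using assms
proof (induction vs arbitrary: a)
  case Nil
  then show ?case by (simp add: zero_free_group.rep_eq)
next
  case (Cons b vs)
  let ?z = "p (last (b # vs))"
  have IH: "word_of (- p b + ?z) = path_word T k (b # vs)" using Cons by simp
  have ab: "(a, b) \<in> adj T" using Cons.prems by simp
  have split: "- p a + ?z = (- p a + p b) + (- p b + ?z)" by (simp add: add.assoc)
  show ?case
  proof (cases "lab T a = lab T b")
    case True
    then show ?thesis using split IH edge_position[OF ab] by (simp add: step_word_def)
  next
    case False
    let ?s = "if k a then ((lab T a, lab T b), True) else ((lab T b, lab T a), False)"
    have sw: "step_word T k a b = [?s]" using False by (simp add: step_word_def)
    have "word_of (- p a + ?z) = cancel_cons ?s (path_word T k (b # vs))"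
      unfolding split edge_position[OF ab] using False word_of_gen_add[of ?s] IH by (simp only: if_False)
    also have "\<dots> = ?s # path_word T k (b # vs)"
      using path_word_hd[OF Cons.prems False] by (auto simp: cancel_cons_def sw)
    finally show ?thesis by (simp add: sw)
  qed
qed

text \<open>Two consecutive edges with equal end labels would admit a fold.\<close>

lemma path_word_Nil:
  assumes "path (a # vs)" "path_word T k (a # vs) = []"
  shows "vs = [] \<or> (\<exists>b. vs = [b] \<and> (a, b) \<in> adj T \<and> lab T a = lab T b)"
proof (cases vs)
  case (Cons b ws)
  then have "lab T a = lab T b" using assms(2) by (auto simp: step_word_def split: if_splits)
  moreover have "ws = []"
  proof (cases ws)
    case (Cons c us)
    then show ?thesis using assms \<open>vs = b # ws\<close> path_labels[of a b c us] by (auto simp: step_word_def split: if_splits)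
  qed
  ultimately show ?thesis using assms Cons by simp
qed simp

lemma simple_path:
  assumes "u \<in> verts T" "v \<in> verts T"
  obtains vs where "path (u # vs)" "last (u # vs) = v"
  using rtrancl_simple_path[OF t(5)[OF assms]] by blast

lemma same_position:
  assumes "u \<in> verts T" "v \<in> verts T" "p u = p v"
  shows "u = v \<or> (u, v) \<in> adj T"
proof -
  obtain vs where vs: "path (u # vs)" "last (u # vs) = v" using simple_path assms by blast
  have "path_word T k (u # vs) = []"
    using word_of_path[OF vs(1)] vs(2) assms(3) by (simp add: zero_free_group.rep_eq)
  from path_word_Nil[OF vs(1) this] vs(2) show ?thesis by auto
qed

text \<open>The simple path from \<open>u\<close> to \<open>v\<close> spells a single letter, so it
  is one edge with distinct labels, possibly with a contracted edge before or after it;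
  \<open>a\<close> and \<open>b\<close> are the ends of the middle edge.\<close>

lemma adjacent_position:
  assumes uv: "u \<in> verts T" "v \<in> verts T" and xy: "lab T u \<noteq> lab T v"
    and pv: "p v = p u + edge_gen (lab T u) (lab T v)"
  obtains a b where "(a, b) \<in> adj T" "k a" "lab T a = lab T u" "lab T b = lab T v" "p a = p u" "p b = p v"
    "a = u \<or> (u, a) \<in> adj T" "b = v \<or> (b, v) \<in> adj T"
proof -
  obtain vs where vs: "path (u # vs)" "last (u # vs) = v" using simple_path uv by blast
  have w: "path_word T k (u # vs) = [((lab T u, lab T v), True)]"
    using word_of_path[OF vs(1)] vs(2) pv xy by (simp add: edge_gen_def gen.rep_eq)
  then obtain b ws where vs': "vs = b # ws" by (cases vs) auto
  have ub: "(u, b) \<in> adj T" using vs vs' by simp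
  have pb: "p b = p u" if "lab T u = lab T b"
    using edge(2)[OF ub] edge(2)[OF adj_sym[OF ub]] edge(1)[OF ub] that by (cases "k u") auto
  show ?thesis
  proof (cases "lab T u = lab T b")
    case False
    then have s: "step_word T k u b = [((lab T u, lab T v), True)]" "path_word T k (b # ws) = []"
      using w vs' by (auto simp: step_word_def split: if_splits)
    then have ku: "k u" "lab T b = lab T v" using False by (auto simp: step_word_def split: if_splits)
    have "path (b # ws)" using vs vs' by simp
    from path_word_Nil[OF this s(2)] have "b = v \<or> (b, v) \<in> adj T" using vs(2) vs' by auto
    moreover have "p b = p v" using edge(2)[OF ub ku(1)] ku(2) pv by simp
    ultimately show ?thesis using that[of u b] ub ku by blast
  next
    case True
    then have w2: "path_word T k (b # ws) = [((lab T u, lab T v), True)]"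
      using w vs' by (simp add: step_word_def)
    then obtain c us where ws: "ws = c # us" by (cases ws) auto
    have bc: "(b, c) \<in> adj T" using vs vs' ws by simp
    have "lab T b \<noteq> lab T c" using path_labels[of u b c us] vs vs' ws True by simp
    then have s: "step_word T k b c = [((lab T u, lab T v), True)]" "path_word T k (c # us) = []"
      using w2 ws by (auto simp: step_word_def split: if_splits)
    then have kb: "k b" "lab T c = lab T v" using \<open>lab T b \<noteq> lab T c\<close>
      by (auto simp: step_word_def split: if_splits)
    have "path (c # us)" using vs vs' ws by simp
    from path_word_Nil[OF this s(2)] have "c = v \<or> (c, v) \<in> adj T" using vs(2) vs' ws by auto
    moreover have "p c = p v" using edge(2)[OF bc kb(1)] kb(2) pv pb[OF True] True by simp
    ultimately show ?thesis using that[of b c] bc kb ub True pb[OF True] by auto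
  qed
qed

lemma adj_iff:
  assumes "u \<in> verts T" "v \<in> verts T"
  shows "(u, v) \<in> adj T \<longleftrightarrow> (k u \<and> \<not> k v \<and> p v = p u + edge_gen (lab T u) (lab T v)) \<or>
    (k v \<and> \<not> k u \<and> p u = p v + edge_gen (lab T v) (lab T u))"
proof -
  have *: "(u, v) \<in> adj T" if uv: "u \<in> verts T" "v \<in> verts T" "k u" "\<not> k v"
    "p v = p u + edge_gen (lab T u) (lab T v)" for u v
  proof (cases "lab T u = lab T v")
    case True
    then have "p u = p v" using that by simp
    then show ?thesis using same_position that by blast
  next
    case False
    obtain a b where ab: "(a, b) \<in> adj T" "k a" "a = u \<or> (u, a) \<in> adj T" "b = v \<or> (b, v) \<in> adj T"
      using adjacent_position[OF uv(1,2) False uv(5)] by blast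
    have "a = u" using ab(2,3) edge(1)[of u a] that(3) by blast
    moreover have "b = v" using ab(1,2,4) edge(1)[of a b] edge(1)[of b v] that(4) by blast
    ultimately show ?thesis using ab(1) by simp
  qed
  show ?thesis
  proof
    assume uv: "(u, v) \<in> adj T"
    then show "(k u \<and> \<not> k v \<and> p v = p u + edge_gen (lab T u) (lab T v)) \<or>
      (k v \<and> \<not> k u \<and> p u = p v + edge_gen (lab T v) (lab T u))"
      using edge[OF uv] edge[OF adj_sym[OF uv]] by blast
  qed (use * assms adj_sym in blast)
qed

abbreviation triple :: "nat \<Rightarrow> ('x \<times> 'x) free_group \<times> 'x \<times> bool" where
  "triple v \<equiv> (p v, lab T v, k v)"

lemma inj_triple: "inj_on triple (verts T)"
proof (rule inj_onI)
  fix u v assume "u \<in> verts T" "v \<in> verts T" "triple u = triple v"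
  then show "u = v" using same_position[of u v] edge(1)[of u v] by auto
qed

text \<open>A neighbour with the label of \<open>v\<close> cannot be the only one, or
  \<open>v\<close> would be a thorn; and a second neighbour with that label would fold onto
  it.\<close>

lemma other_label_neighbour:
  assumes "v \<in> verts T" "v \<noteq> lroot T" "v \<noteq> rroot T"
  obtains c where "(v, c) \<in> adj T" "lab T c \<noteq> lab T v"
proof -
  obtain b where b: "(v, b) \<in> adj T"
    using t(5)[OF assms(1) t(8)] assms(2) by (meson converse_rtranclE)
  show ?thesis
  proof (cases "lab T b = lab T v")
    case True
    have "{c. (v, c) \<in> adj T} \<noteq> {b}"
    proof
      assume "{c. (v, c) \<in> adj T} = {b}"
      then have "nonessential_thorn T v" using assms True unfolding nonessential_thorn_def by auto
      then show False using irr unfolding irreducible_def by blast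
    qed
    then obtain c where "(v, c) \<in> adj T" "c \<noteq> b" using b by blast
    moreover then have "lab T c \<noteq> lab T b" using folded[of c v b] b adj_sym by blast
    ultimately show ?thesis using that True by simp
  qed (use that b in blast)
qed

abbreviation points :: "(('x \<times> 'x) free_group \<times> 'x) set" where
  "points \<equiv> (\<lambda>v. (p v, lab T v)) ` verts T"

abbreviation ll :: 'x where "ll \<equiv> lab T (lroot T)"
abbreviation lr :: 'x where "lr \<equiv> lab T (rroot T)"

lemma root_triples: "triple (lroot T) = (0, ll, True)" "triple (rroot T) = (edge_gen ll lr, lr, False)"
  using pot edge[OF t(7)] by (auto simp: potential_def)

text \<open>A left vertex other than the root has an edge to another label, which leaves a trace in
  \<open>points\<close>; conversely such a trace forces an edge by \<open>adjacent_position\<close>.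
  The criterion mentions only data that the model retains.\<close>

lemma triple_True:
  "(w, y, True) \<in> triple ` verts T \<longleftrightarrow>
     (w, y) \<in> points \<and> ((w, y) = (0, ll) \<or> (\<exists>z. z \<noteq> y \<and> (w + edge_gen y z, z) \<in> points))"
proof
  assume "(w, y, True) \<in> triple ` verts T"
  then obtain v where v: "v \<in> verts T" "p v = w" "lab T v = y" "k v" by auto
  show "(w, y) \<in> points \<and> ((w, y) = (0, ll) \<or> (\<exists>z. z \<noteq> y \<and> (w + edge_gen y z, z) \<in> points))"
  proof (cases "v = lroot T")
    case True
    moreover have "(w, y) \<in> points" using v by auto
    ultimately show ?thesis using v root_triples by simp
  next
    case False
    have "v \<noteq> rroot T" using v root_triples by auto
    from other_label_neighbour[OF v(1) False this] obtain c where c: "(v, c) \<in> adj T" "lab T c \<noteq> lab T v" .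
    then have "p c = w + edge_gen y (lab T c)" "c \<in> verts T" using edge(2) v t(2) by auto
    then have "(w + edge_gen y (lab T c), lab T c) \<in> points"
      by (intro image_eqI[of _ _ c]) simp_all
    moreover have "(w, y) \<in> points" "lab T c \<noteq> y" using v c by auto
    ultimately show ?thesis by blast
  qed
next
  assume a: "(w, y) \<in> points \<and> ((w, y) = (0, ll) \<or> (\<exists>z. z \<noteq> y \<and> (w + edge_gen y z, z) \<in> points))"
  show "(w, y, True) \<in> triple ` verts T"
  proof (cases "(w, y) = (0, ll)")
    case True
    then have "(w, y, True) = triple (lroot T)" using root_triples by simp
    then show ?thesis using t(8) by blast
  next
    case False
    with a obtain z where z: "z \<noteq> y" "(w + edge_gen y z, z) \<in> points" "(w, y) \<in> points" by blast
    obtain u where u: "u \<in> verts T" "p u = w" "lab T u = y" using z(3) by auto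
    obtain v where v: "v \<in> verts T" "p v = w + edge_gen y z" "lab T v = z" using z(2) by auto
    have uv: "u \<in> verts T" "v \<in> verts T" "p u = w" "lab T u = y"
      "lab T u \<noteq> lab T v" "p v = p u + edge_gen (lab T u) (lab T v)" using u v z(1) by simp_all
    obtain a b where "(a, b) \<in> adj T" "k a" "lab T a = lab T u" "p a = p u"
      using adjacent_position[OF uv(1,2,5,6)] by blast
    then have "(w, y, True) = triple a" "a \<in> verts T" using uv t(2) by auto
    then show ?thesis by blast
  qed
qed

lemma triple_False:
  "(w, y, False) \<in> triple ` verts T \<longleftrightarrow> (w, y) \<in> points \<and>
     ((w, y) = (edge_gen ll lr, lr) \<or> (\<exists>z. z \<noteq> y \<and> (w - edge_gen z y, z) \<in> points))"
proof
  assume "(w, y, False) \<in> triple ` verts T"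
  then obtain v where v: "v \<in> verts T" "p v = w" "lab T v = y" "\<not> k v" by auto
  show "(w, y) \<in> points \<and> ((w, y) = (edge_gen ll lr, lr) \<or> (\<exists>z. z \<noteq> y \<and> (w - edge_gen z y, z) \<in> points))"
  proof (cases "v = rroot T")
    case True
    moreover have "(w, y) \<in> points" using v by auto
    ultimately show ?thesis using v root_triples by simp
  next
    case False
    have "v \<noteq> lroot T" using v root_triples by auto
    from other_label_neighbour[OF v(1) this False] obtain c where c: "(v, c) \<in> adj T" "lab T c \<noteq> lab T v" .
    then have "k c" using edge(1) v by blast
    then have "p c = w - edge_gen (lab T c) y" "c \<in> verts T"
      using edge(2)[OF adj_sym[OF c(1)]] v t(2) c by auto
    then have "(w - edge_gen (lab T c) y, lab T c) \<in> points"
      by (intro image_eqI[of _ _ c]) simp_all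
    moreover have "(w, y) \<in> points" "lab T c \<noteq> y" using v c by auto
    ultimately show ?thesis by blast
  qed
next
  assume a: "(w, y) \<in> points \<and> ((w, y) = (edge_gen ll lr, lr) \<or> (\<exists>z. z \<noteq> y \<and> (w - edge_gen z y, z) \<in> points))"
  show "(w, y, False) \<in> triple ` verts T"
  proof (cases "(w, y) = (edge_gen ll lr, lr)")
    case True
    then have "(w, y, False) = triple (rroot T)" using root_triples by simp
    then show ?thesis using t(9) by blast
  next
    case False
    with a obtain z where z: "z \<noteq> y" "(w - edge_gen z y, z) \<in> points" "(w, y) \<in> points" by blast
    obtain v where v: "v \<in> verts T" "p v = w" "lab T v = y" using z(3) by auto
    obtain u where u: "u \<in> verts T" "p u = w - edge_gen z y" "lab T u = z" using z(2) by auto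
    have uv: "u \<in> verts T" "v \<in> verts T" "p v = w" "lab T v = y" "lab T u \<noteq> lab T v"
      using u v z(1) by simp_all
    have "p v = p u + edge_gen (lab T u) (lab T v)" using u v by simp
    from adjacent_position[OF uv(1,2,5) this] obtain a b where
      ab: "(a, b) \<in> adj T" "k a" "lab T b = lab T v" "p b = p v" by blast
    then have "(w, y, False) = triple b" "b \<in> verts T" using uv t(2) edge(1) by auto
    then show ?thesis by blast
  qed
qed

end

text \<open>The model forgets whether the left or the right copy of a contracted vertex is present. The
  absence of thorns recovers this: see \<open>triple_True\<close> and \<open>triple_False\<close>.\<close>

lemma irreducible_unique:
  assumes "is_tree S" "is_tree T" "irreducible S" "irreducible T" "pre_model S = pre_model T"
  shows "tree_iso S T"
proof -
  obtain k p where kp: "potential S k p edge_gen" using is_tree_potential[OF assms(1)] by blast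
  obtain k' p' where kp': "potential T k' p' edge_gen" using is_tree_potential[OF assms(2)] by blast
  interpret S: folded_tree S k p using assms kp by unfold_locales
  interpret T: folded_tree T k' p' using assms kp' by unfold_locales
  have eq: "S.points = T.points" "S.ll = T.ll" "S.lr = T.lr"
    using assms(5) by (simp_all add: pre_model_eq[OF assms(1) kp] pre_model_eq[OF assms(2) kp'])
  have "q \<in> S.triple ` verts S \<longleftrightarrow> q \<in> T.triple ` verts T" for q
    using S.triple_True T.triple_True S.triple_False T.triple_False eq by (cases q; cases "snd (snd q)") simp_all
  then have im: "S.triple ` verts S = T.triple ` verts T" by blast
  define f where "f = inv_into (verts T) T.triple \<circ> S.triple"
  have f: "f v \<in> verts T" "p' (f v) = p v" "lab T (f v) = lab S v" "k' (f v) = k v" if "v \<in> verts S" for v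
  proof -
    have v: "S.triple v \<in> T.triple ` verts T" using that im by blast
    show "f v \<in> verts T" unfolding f_def using inv_into_into[OF v] by simp
    have "T.triple (f v) = S.triple v" unfolding f_def using f_inv_into_f[OF v] by simp
    then show "p' (f v) = p v" "lab T (f v) = lab S v" "k' (f v) = k v" by auto
  qed
  have "bij_betw f (verts S) (verts T)"
    unfolding f_def
  proof (rule bij_betw_trans)
    show "bij_betw S.triple (verts S) (S.triple ` verts S)"
      using S.inj_triple by (simp add: bij_betw_def)
    show "bij_betw (inv_into (verts T) T.triple) (S.triple ` verts S) (verts T)"
      unfolding im using T.inj_triple by (simp add: bij_betw_inv_into bij_betw_def inj_on_inv_into)
  qed
  moreover have "f (lroot S) = lroot T"
    by (rule inj_onD[OF T.inj_triple])
      (use S.root_triples(1) T.root_triples(1) f[OF S.t(8)] T.t(8) eq in simp_all)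
  moreover have "f (rroot S) = rroot T"
    by (rule inj_onD[OF T.inj_triple])
      (use S.root_triples(2) T.root_triples(2) f[OF S.t(9)] T.t(9) eq in simp_all)
  ultimately have "iso_map f S T"
    unfolding iso_map_def using f S.adj_iff T.adj_iff by auto
  then show ?thesis using assms unfolding tree_iso_def by blast
qed

section \<open>The free pseudosemilattice inside the model\<close>

lemma abs_birooted_eq_iff:
  "is_tree S \<Longrightarrow> is_tree T \<Longrightarrow> abs_birooted S = abs_birooted T \<longleftrightarrow> tree_iso S T"
  using Quotient3_rel[OF Quotient3_birooted, of S T] iso_map_id unfolding tree_iso_def by blast

lemma tree_iso_refl: "is_tree T \<Longrightarrow> tree_iso T T"
  using iso_map_id unfolding tree_iso_def by blast

lemma abs_birooted_cases:
  obtains S where "is_tree S" "\<alpha> = abs_birooted S"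
proof -
  have "tree_iso (rep_birooted \<alpha>) (rep_birooted \<alpha>)"
    by (rule Quotient3_rep_reflp[OF Quotient3_birooted])
  then show ?thesis
    using that[of "rep_birooted \<alpha>"] Quotient3_abs_rep[OF Quotient3_birooted, of \<alpha>]
    by (simp add: tree_iso_def)
qed

lift_definition model :: "'x birooted \<Rightarrow> 'x model" is pre_model
  by (rule pre_model_iso)

lemma model_abs: "is_tree S \<Longrightarrow> model (abs_birooted S) = pre_model S"
  by (rule model.abs_eq) (rule tree_iso_refl)

lemma model_join: "model (\<alpha> \<sqinter>\<^sub>t \<beta>) = model_meet (model \<alpha>) (model \<beta>)"
proof -
  obtain S T where "is_tree S" "\<alpha> = abs_birooted S" "is_tree T" "\<beta> = abs_birooted T"
    using abs_birooted_cases by metis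
  then show ?thesis
    by (simp add: model_abs join.abs_eq tree_iso_refl pre_model_join is_tree_join)
qed

lemma foldable_iso:
  assumes "iso_map f S T" "is_tree S" "foldable S u v"
  shows "foldable T (f u) (f v)"
proof -
  obtain w where w: "u \<noteq> v" "lab S u = lab S v" "(u, w) \<in> adj S" "(v, w) \<in> adj S"
    using assms(3) by (auto simp: foldable_def)
  then have v: "u \<in> verts S" "v \<in> verts S" "w \<in> verts S" using is_treeD(2)[OF assms(2)] by auto
  then have "f u \<noteq> f v" using assms(1) w(1) by (auto simp: iso_map_def bij_betw_def dest: inj_onD)
  moreover have "lab T (f u) = lab T (f v)" "(f u, f w) \<in> adj T" "(f v, f w) \<in> adj T"
    using assms(1) w v by (auto simp: iso_map_def)
  ultimately show ?thesis unfolding foldable_def by blast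
qed

lemma thorn_iso:
  assumes f: "iso_map f S T" and "is_tree S" "is_tree T" and a: "nonessential_thorn S a"
  shows "nonessential_thorn T (f a)"
proof -
  obtain b where b: "a \<in> verts S" "a \<noteq> lroot S" "a \<noteq> rroot S" "{v. (a, v) \<in> adj S} = {b}" "lab S a = lab S b"
    using a by (auto simp: nonessential_thorn_def)
  have inj: "inj_on f (verts S)" and im: "f ` verts S = verts T"
    using f by (auto simp: iso_map_def bij_betw_def)
  have e: "(f u, f v) \<in> adj T \<longleftrightarrow> (u, v) \<in> adj S" if "u \<in> verts S" "v \<in> verts S" for u v
    using f that by (auto simp: iso_map_def)
  have bv: "b \<in> verts S" using b(4) is_treeD(2)[OF assms(2)] by auto
  have "{v. (f a, v) \<in> adj T} = {f b}"
  proof -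
    have "v = f b" if v: "(f a, v) \<in> adj T" for v
    proof -
      have "v \<in> f ` verts S" using v is_treeD(2)[OF assms(3)] im by auto
      then obtain c where c: "c \<in> verts S" "v = f c" by blast
      then have "(a, c) \<in> adj S" using e[OF b(1) c(1)] v by simp
      then have "c = b" using b(4) by auto
      then show ?thesis using c by simp
    qed
    moreover have "(f a, f b) \<in> adj T" using e[OF b(1) bv] b(4) by blast
    ultimately show ?thesis by blast
  qed
  moreover have "f a \<noteq> f (lroot S)" "f a \<noteq> f (rroot S)"
    using b(1-3) is_treeD(8,9)[OF assms(2)] by (simp_all add: inj_on_eq_iff[OF inj])
  moreover have "f (lroot S) = lroot T" "f (rroot S) = rroot T" "lab T (f a) = lab T (f b)" "f a \<in> verts T"
    using f b(1,5) bv im by (auto simp: iso_map_def)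
  ultimately show ?thesis unfolding nonessential_thorn_def by simp
qed

lemma irreducible_iso:
  assumes "tree_iso S T" "irreducible T"
  shows "irreducible S"
  using assms foldable_iso thorn_iso unfolding tree_iso_def irreducible_def by blast

lemma reduced_iff: 
  assumes "is_tree S"
  shows "reduced (abs_birooted S) \<longleftrightarrow> irreducible S"
proof
  assume "reduced (abs_birooted S)"
  then have "\<not> pre_step S T" for T
    using assms unfolding reduced_def reduces_to_def by blast
  then show "irreducible S"
    unfolding irreducible_def using pre_step.intros by blast
next
  assume irr: "irreducible S"
  show "reduced (abs_birooted S)"
    unfolding reduced_def reduces_to_def
  proof (intro notI, elim exE conjE)
    fix \<beta> S' T assume S': "is_tree S'" "pre_step S' T" "abs_birooted S = abs_birooted S'"
    then have "tree_iso S' S" using abs_birooted_eq_iff[OF S'(1) assms] by simp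
    then have "irreducible S'" using irreducible_iso irr by blast
    then show False using S'(2) unfolding irreducible_def by (auto elim: pre_step.cases)
  qed
qed

lemma model_reduces: "reduces_to \<alpha> \<beta> \<Longrightarrow> model \<beta> = model \<alpha>"
  unfolding reduces_to_def using model_abs pre_model_step is_tree_pre_step by metis

lemma model_reduces_rtrancl: "reduces_to\<^sup>*\<^sup>* \<alpha> \<beta> \<Longrightarrow> model \<beta> = model \<alpha>"
  by (induction rule: rtranclp_induct) (auto dest: model_reduces)

lemma model_inj:
  assumes "reduced \<alpha>" "reduced \<beta>" "model \<alpha> = model \<beta>"
  shows "\<alpha> = \<beta>"
proof -
  obtain S T where ST: "is_tree S" "\<alpha> = abs_birooted S" "is_tree T" "\<beta> = abs_birooted T"
    using abs_birooted_cases by metis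
  then have "tree_iso S T"
    using assms irreducible_unique[of S T] by (simp add: reduced_iff model_abs)
  then show ?thesis using ST abs_birooted_eq_iff by blast
qed

lemma card_pre_step:
  assumes "pre_step S T" "is_tree S"
  shows "card (verts T) < card (verts S)"
  using assms(1)
proof cases
  case (thorn a)
  then have "a \<in> verts S" "verts T = verts S - {a}"
    by (simp_all add: nonessential_thorn_def delete_vertex_def)
  then show ?thesis using is_treeD(1)[OF assms(2)] by (simp only: card_Diff1_less)
next
  case (edge_fold u v)
  then have uv: "u \<in> verts S" "v \<in> verts S" "u \<noteq> v"
    using is_treeD(2)[OF assms(2)] by (auto simp: foldable_def)
  have "verts T \<subseteq> verts S - {v}"
    using edge_fold uv by (auto simp: merge_vertices_def Let_def)
  then have "card (verts T) \<le> card (verts S - {v})"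
    using is_treeD(1)[OF assms(2)] by (intro card_mono) auto
  also have "\<dots> < card (verts S)"
    using is_treeD(1)[OF assms(2)] uv by (intro card_Diff1_less)
  finally show ?thesis .
qed

lemma ex_reduced_form: "\<exists>\<beta>. reduces_to\<^sup>*\<^sup>* \<alpha> \<beta> \<and> reduced \<beta>"
proof -
  have "is_tree S \<Longrightarrow> \<exists>\<beta>. reduces_to\<^sup>*\<^sup>* (abs_birooted S) \<beta> \<and> reduced \<beta>" for S :: "'a rgraph"
  proof (induction "card (verts S)" arbitrary: S rule: less_induct)
    case less
    show ?case
    proof (cases "irreducible S")
      case True
      then show ?thesis using reduced_iff[OF less.prems] by blast
    next
      case False
      then obtain T where T: "pre_step S T"
        unfolding irreducible_def using pre_step.intros by blast
      then have "is_tree T" "reduces_to (abs_birooted S) (abs_birooted T)"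
        using is_tree_pre_step less.prems unfolding reduces_to_def by blast+
      then show ?thesis
        using less.hyps[OF card_pre_step[OF T less.prems]] converse_rtranclp_into_rtranclp[of reduces_to] by metis
    qed
  qed
  then show ?thesis using abs_birooted_cases by metis
qed

text \<open>Uniqueness without confluence: all reducts share one model, and by
  \<open>model_inj\<close> the model determines the reduced tree.\<close>

lemma reduced_form_props: "reduced (reduced_form \<alpha>)" "model (reduced_form \<alpha>) = model \<alpha>"
proof -
  have "\<exists>!\<beta>. reduces_to\<^sup>*\<^sup>* \<alpha> \<beta> \<and> reduced \<beta>"
    using ex_reduced_form[of \<alpha>] model_reduces_rtrancl model_inj by metis
  from theI'[OF this] show "reduced (reduced_form \<alpha>)" "model (reduced_form \<alpha>) = model \<alpha>"
    unfolding reduced_form_def using model_reduces_rtrancl by blast+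
qed

lemma meet_A_X: "\<alpha> \<and>\<^sub>t \<beta> \<in> A_X"
  by (simp add: meet_def A_X_def reduced_form_props)

lemma model_meet_eq: "model (\<alpha> \<and>\<^sub>t \<beta>) = model_meet (model \<alpha>) (model \<beta>)"
  by (simp add: meet_def reduced_form_props model_join)

lemma model_generated: "model \<alpha> \<in> generated"
  using abs_birooted_cases[of \<alpha>] by (metis model_abs pre_model_generated)

lemma generated_model:
  assumes "M \<in> generated"
  obtains \<alpha> where "\<alpha> \<in> A_X" "model \<alpha> = M"
proof -
  have "\<exists>\<alpha>. model \<alpha> = M"
    using assms
  proof induction
    case (letter y)
    let ?T = "\<lparr>verts = {0..1}, adj = {(p, q). p \<in> {0..1} \<and> q \<in> {0..1} \<and> (q = p + 1 \<or> p = q + 1)},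
      lab = \<lambda>_. y, lroot = 0, rroot = 0 + 1\<rparr> :: 'a rgraph"
    have "is_tree ?T" by (rule is_tree_path) auto
    moreover have "potential ?T (\<lambda>v. v = 0) (\<lambda>_. 0) edge_gen"
      by (auto simp: potential_def)
    ultimately have "model (abs_birooted ?T) = model_letter y"
      using pre_model_eq[of ?T] by (auto simp: model_abs model_letter_def)
    then show ?case ..
  next
    case (meet M N)
    then show ?case using model_join by metis
  qed
  then obtain \<alpha> where "model \<alpha> = M" ..
  then show ?thesis using that[of "reduced_form \<alpha>"] by (simp add: A_X_def reduced_form_props)
qed

section \<open>Substitutions\<close>

lemma translate_translate: "translate g (translate h S) = translate (g + h :: 'g::semigroup_add) S"
  by (force simp: translate_def add.assoc)

lemma translate_0 [simp]: "translate (0 :: 'g::monoid_add) S = S"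
  by (force simp: translate_def)

lemma translate_UN: "translate g (\<Union>q\<in>T. f q) = (\<Union>q\<in>T. translate g (f q))"
  by (simp add: translate_def image_UN)

text \<open>The image of the generator \<open>(a, b)\<close> is the displacement from the left root
  of \<open>s a\<close> to that of \<open>s b\<close> when an edge joins the left root of
  \<open>s a\<close> to the right root of \<open>s b\<close>, as in
  \<open>model_meet\<close>.\<close>

definition subst_hom :: "('x \<Rightarrow> 'y model) \<Rightarrow> ('x \<times> 'x) free_group \<Rightarrow> ('y \<times> 'y) free_group" where
  "subst_hom s = extend_hom (\<lambda>(a, b). edge_gen (fst (s a)) (snd (snd (s b)))
     - edge_gen (fst (s b)) (snd (snd (s b))))"

definition subst_model :: "('x \<Rightarrow> 'y model) \<Rightarrow> 'x model \<Rightarrow> 'y model" where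
  "subst_model s M = (case M of (l, T, r) \<Rightarrow>
     (fst (s l), \<Union>(w, y)\<in>T. translate (subst_hom s w) (fst (snd (s y))), snd (snd (s r))))"

lemma subst_hom_edge_gen:
  "subst_hom s (edge_gen a b) = edge_gen (fst (s a)) (snd (snd (s b))) - edge_gen (fst (s b)) (snd (snd (s b)))"
  by (auto simp: edge_gen_def[of a b] subst_hom_def extend_hom_gen extend_hom_zero)

lemma subst_hom_add: "subst_hom s (v + w) = subst_hom s v + subst_hom s w"
  by (simp add: subst_hom_def extend_hom_add)

lemma subst_hom_0: "subst_hom s 0 = 0"
  by (simp add: subst_hom_def extend_hom_zero)

lemma subst_hom_uminus: "subst_hom s (- v) = - subst_hom s v"
  by (simp add: subst_hom_def extend_hom_uminus)

lemma subst_model_letter: "subst_model s (model_letter y) = s y"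
  by (simp add: subst_model_def model_letter_def subst_hom_0)

lemma subst_model_meet:
  "subst_model s (model_meet M N) = model_meet (subst_model s M) (subst_model s N)"
proof -
  obtain l S r where M: "M = (l, S, r)" by (cases M)
  obtain l' T r' where N: "N = (l', T, r')" by (cases N)
  let ?g = "edge_gen l r' - edge_gen l' r'"
  let ?P = "\<lambda>y. fst (snd (s y))"
  have g: "subst_hom s ?g = edge_gen (fst (s l)) (snd (snd (s r'))) - edge_gen (fst (s l')) (snd (snd (s r')))"
    by (simp only: diff_conv_add_uminus subst_hom_add subst_hom_uminus subst_hom_edge_gen
        minus_add minus_minus add.assoc minus_add_cancel)
  have "(\<Union>(w, y)\<in>translate ?g T. translate (subst_hom s w) (?P y)) =
      (\<Union>(w, y)\<in>T. translate (subst_hom s (?g + w)) (?P y))"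
    unfolding translate_def[of ?g] image_image split_beta by simp
  also have "\<dots> = translate (subst_hom s ?g) (\<Union>(w, y)\<in>T. translate (subst_hom s w) (?P y))"
    unfolding subst_hom_add translate_translate[symmetric] translate_UN split_beta ..
  finally show ?thesis
    unfolding M N model_meet_def subst_model_def by (simp add: g)
qed

lemma subst_model_generated:
  assumes "\<And>y. s y \<in> generated" "M \<in> generated"
  shows "subst_model s M \<in> generated"
  using assms(2)
  by induction (simp_all add: subst_model_letter subst_model_meet assms(1) generated.meet)

text \<open>A reduced tree is chosen for each substituted model; meets are respected because reduced
  trees with equal models are equal.\<close>

lemma ex_endomorphism:
  assumes "\<And>y. s y \<in> generated"
  obtains \<phi> where "endomorphism \<phi>" "\<And>\<alpha>. model (\<phi> \<alpha>) = subst_model s (model \<alpha>)"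
proof -
  have "\<exists>\<beta>. \<beta> \<in> A_X \<and> model \<beta> = subst_model s (model \<alpha>)" for \<alpha>
  proof -
    have "subst_model s (model \<alpha>) \<in> generated"
      by (rule subst_model_generated[OF assms model_generated])
    then obtain \<beta> where "\<beta> \<in> A_X" "model \<beta> = subst_model s (model \<alpha>)"
      by (rule generated_model)
    then show ?thesis by blast
  qed
  then obtain \<phi> where \<phi>: "\<And>\<alpha>. \<phi> \<alpha> \<in> A_X" "\<And>\<alpha>. model (\<phi> \<alpha>) = subst_model s (model \<alpha>)"
    by metis
  have "\<phi> (\<alpha> \<and>\<^sub>t \<beta>) = \<phi> \<alpha> \<and>\<^sub>t \<phi> \<beta>" for \<alpha> \<beta>
    by (rule model_inj) (use \<phi> meet_A_X in \<open>auto simp: A_X_def model_meet_eq subst_model_meet\<close>)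
  then have "endomorphism \<phi>" using \<phi>(1) by (simp add: endomorphism_def)
  then show ?thesis using that \<phi>(2) by blast
qed

locale model_congruence =
  fixes R :: "'x model \<Rightarrow> 'x model \<Rightarrow> bool"
  assumes R_refl: "M \<in> generated \<Longrightarrow> R M M"
    and R_sym: "R M N \<Longrightarrow> R N M"
    and R_trans: "R M N \<Longrightarrow> R N L \<Longrightarrow> R M L"
    and R_meet: "R M N \<Longrightarrow> R M' N' \<Longrightarrow> R (model_meet M M') (model_meet N N')"
    and R_subst: "(\<And>y. s y \<in> generated) \<Longrightarrow> R M N \<Longrightarrow> R (subst_model s M) (subst_model s N)"

sublocale model_congruence \<subseteq> meet_relation R
  by unfold_locales (auto intro: R_refl R_meet generated.letter)

definition model_rel :: "('x birooted \<times> 'x birooted) set \<Rightarrow> 'x model \<Rightarrow> 'x model \<Rightarrow> bool" where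
  "model_rel \<theta> M N \<longleftrightarrow> (\<exists>\<alpha> \<beta>. (\<alpha>, \<beta>) \<in> \<theta> \<and> model \<alpha> = M \<and> model \<beta> = N)"

lemma model_rel_iff:
  assumes "congruence \<theta>" "\<alpha> \<in> A_X" "\<beta> \<in> A_X"
  shows "model_rel \<theta> (model \<alpha>) (model \<beta>) \<longleftrightarrow> (\<alpha>, \<beta>) \<in> \<theta>"
proof
  assume "model_rel \<theta> (model \<alpha>) (model \<beta>)"
  then obtain \<alpha>' \<beta>' where *: "(\<alpha>', \<beta>') \<in> \<theta>" "model \<alpha>' = model \<alpha>" "model \<beta>' = model \<beta>"
    unfolding model_rel_def by blast
  then have "\<alpha>' \<in> A_X" "\<beta>' \<in> A_X" using assms(1) unfolding congruence_def equiv_def by auto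
  then show "(\<alpha>, \<beta>) \<in> \<theta>" using * assms(2,3) model_inj by (auto simp: A_X_def)
qed (auto simp: model_rel_def)

lemma model_congruence_rel:
  assumes "congruence \<theta>" "fully_invariant \<theta>"
  shows "model_congruence (model_rel \<theta>)"
proof
  have eq: "refl_on A_X \<theta>" "sym \<theta>" "trans \<theta>" and sub: "\<theta> \<subseteq> A_X \<times> A_X"
    using assms(1) by (auto simp: congruence_def equiv_def)
  fix M N L M' N' :: "'a model" and s :: "'a \<Rightarrow> 'a model"
  show "model_rel \<theta> M M" if M: "M \<in> generated"
    using generated_model[OF M] eq(1) by (metis model_rel_def refl_onD)
  show "model_rel \<theta> N M" if "model_rel \<theta> M N"
    using that symD[OF eq(2)] unfolding model_rel_def by blast
  show "model_rel \<theta> M L" if MN: "model_rel \<theta> M N" and NL: "model_rel \<theta> N L"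
  proof -
    obtain \<alpha> \<beta> where 1: "(\<alpha>, \<beta>) \<in> \<theta>" "model \<alpha> = M" "model \<beta> = N" using MN unfolding model_rel_def by blast
    obtain \<beta>' \<gamma> where 2: "(\<beta>', \<gamma>) \<in> \<theta>" "model \<beta>' = N" "model \<gamma> = L" using NL unfolding model_rel_def by blast
    have "\<beta> = \<beta>'" using 1 2 sub model_inj[of \<beta> \<beta>'] by (auto simp: A_X_def)
    then show ?thesis using 1 2 transD[OF eq(3)] unfolding model_rel_def by blast
  qed
  show "model_rel \<theta> (model_meet M M') (model_meet N N')" if R: "model_rel \<theta> M N" "model_rel \<theta> M' N'"
  proof -
    obtain \<alpha> \<beta> where 1: "(\<alpha>, \<beta>) \<in> \<theta>" "model \<alpha> = M" "model \<beta> = N" using R(1) unfolding model_rel_def by blast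
    obtain \<alpha>' \<beta>' where 2: "(\<alpha>', \<beta>') \<in> \<theta>" "model \<alpha>' = M'" "model \<beta>' = N'" using R(2) unfolding model_rel_def by blast
    have "(\<alpha> \<and>\<^sub>t \<alpha>', \<beta> \<and>\<^sub>t \<beta>') \<in> \<theta>" using assms(1) 1 2 unfolding congruence_def by blast
    then show ?thesis using 1 2 model_meet_eq unfolding model_rel_def by blast
  qed
  show "model_rel \<theta> (subst_model s M) (subst_model s N)" if s: "\<And>y. s y \<in> generated" and R: "model_rel \<theta> M N"
  proof -
    obtain \<alpha> \<beta> where 1: "(\<alpha>, \<beta>) \<in> \<theta>" "model \<alpha> = M" "model \<beta> = N" using R unfolding model_rel_def by blast
    obtain \<phi> where \<phi>: "endomorphism \<phi>" "\<And>\<alpha>. model (\<phi> \<alpha>) = subst_model s (model \<alpha>)"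
      using ex_endomorphism[of s, OF s] by metis
    then have "(\<phi> \<alpha>, \<phi> \<beta>) \<in> \<theta>" using assms(2) 1 unfolding fully_invariant_def by blast
    then show ?thesis using \<phi>(2) 1 unfolding model_rel_def by blast
  qed
qed

section \<open>Intervals of a bi-infinite path\<close>

text \<open>Odd integers are the sources and even integers the targets of the edges.\<close>

definition line_step :: "(int \<Rightarrow> 'x) \<Rightarrow> int \<Rightarrow> ('x \<times> 'x) free_group" where
  "line_step \<xi> i = (if odd i then edge_gen (\<xi> i) (\<xi> (i + 1)) else - edge_gen (\<xi> (i + 1)) (\<xi> i))"

definition line :: "(int \<Rightarrow> 'x) \<Rightarrow> int \<Rightarrow> ('x \<times> 'x) free_group" where
  "line \<xi> i = (if 0 \<le> i then sum_list (map (line_step \<xi>) [0..i - 1])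
     else - sum_list (map (line_step \<xi>) [i..-1]))"

lemma line_succ: "line \<xi> (i + 1) = line \<xi> i + line_step \<xi> i"
proof (cases "0 \<le> i")
  case True
  then show ?thesis using upto_rec2[of 0 i] by (simp add: line_def)
next
  case False
  have "[i..-1] = i # [i + 1..-1]" using False by (simp add: upto_rec1)
  then have "line \<xi> i + line_step \<xi> i = - sum_list (map (line_step \<xi>) [i + 1..-1])"
    using False by (simp add: line_def minus_add add.assoc)
  moreover have "line \<xi> (i + 1) = - sum_list (map (line_step \<xi>) [i + 1..-1])"
    using False by (cases "i = -1") (auto simp: line_def)
  ultimately show ?thesis by simp
qed

text \<open>\<open>l = r\<close> covers roots with equal labels, whose edge is contracted.\<close>

abbreviation ok_roots :: "int \<Rightarrow> int \<Rightarrow> bool" where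
  "ok_roots l r \<equiv> l = r \<or> odd l \<and> (r = l + 1 \<or> r = l - 1)"

lemma arc_line:
  assumes "ok_roots l r"
  shows "arc (line \<xi>) \<xi> l r"
proof -
  consider "l = r" | "odd l" "r = l + 1" | "odd l" "r = l - 1" using assms by blast
  then show ?thesis
  proof cases
    case 3
    then show ?thesis using line_succ[of \<xi> "l - 1"] by (simp add: arc_def line_step_def)
  qed (auto simp: arc_def line_succ line_step_def)
qed

lemma arc_line_next: "arc (line \<xi>) \<xi> i (i + 1) \<or> arc (line \<xi>) \<xi> (i + 1) i"
  by (cases "odd i") (auto intro: arc_line)

lemma arc_line_prev: "arc (line \<xi>) \<xi> i (i - 1) \<or> arc (line \<xi>) \<xi> (i - 1) i"
  using arc_line_next[of \<xi> "i - 1"] by auto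

abbreviation segment :: "(int \<Rightarrow> 'x) \<Rightarrow> int \<Rightarrow> int \<Rightarrow> int \<Rightarrow> int \<Rightarrow> 'x model" where
  "segment \<xi> l r a b \<equiv> placed (line \<xi>) \<xi> l r {a..b}"

context meet_relation
begin

lemma root_walk:
  assumes "Q (placed (line \<xi>) \<xi> l l V) (placed (line \<xi>) \<xi> l l W)"
    "{min l l'..max l l'} \<subseteq> V" "{min l l'..max l l'} \<subseteq> W"
  shows "Q (placed (line \<xi>) \<xi> l' l' V) (placed (line \<xi>) \<xi> l' l' W)"
proof (cases "l \<le> l'")
  case True
  then show ?thesis using assms(2,3)
  proof (induction rule: int_ge_induct)
    case (step i)
    have "Q (placed (line \<xi>) \<xi> i i V) (placed (line \<xi>) \<xi> i i W)"
      by (rule step.IH) (use step in \<open>auto simp: subset_iff\<close>)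
    moreover have "insert (i + 1) V = V" "insert (i + 1) W = W" using step by auto
    ultimately show ?case using root_step[OF _ arc_line_next, of \<xi> i V W] by simp
  qed (rule assms(1))
next
  case False
  then have "l' \<le> l" by simp
  then show ?thesis using assms(2,3)
  proof (induction rule: int_le_induct)
    case (step i)
    have "Q (placed (line \<xi>) \<xi> i i V) (placed (line \<xi>) \<xi> i i W)"
      by (rule step.IH) (use step in \<open>auto simp: subset_iff\<close>)
    moreover have "insert (i - 1) V = V" "insert (i - 1) W = W" using step by auto
    ultimately show ?case using root_step[OF _ arc_line_prev, of \<xi> i V W] by simp
  qed (rule assms(1))
qed

end

lemma segment_generated:
  assumes "ok_roots l r" "l \<in> {a..b}" "r \<in> {a..b}"
  shows "segment \<xi> l r a b \<in> generated"
proof -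
  have "a \<le> b" using assms by simp
  then have "segment \<xi> b b a b \<in> generated"
  proof (induction rule: int_ge_induct)
    case base
    then show ?case using placed_point_generated[of "line \<xi>" \<xi> a] by simp
  next
    case (step i)
    have "insert (i + 1) {a..i} = {a..i + 1}" using step(1) by auto
    then show ?case using placed_root_step[OF step(2) arc_line_next] by simp
  qed
  then have "segment \<xi> l l a b \<in> generated"
    by (rule generated.root_walk[where W = UNIV]) (use assms in auto)
  then show ?thesis by (rule placed_roots_apart[OF _ arc_line]) (use assms in auto)
qed

text \<open>Each step of the first line is sent to the displacement between the images of its ends.
  So \<open>subst_hom s\<close> carries one line to the other up to a left factor \<open>K\<close>,
  which disappears once positions are measured from the left root.\<close>

lemma subst_line:
  assumes s: "\<And>i. s (\<xi> i) = placed (line \<xi>') \<xi>' (\<tau> i) (\<tau> i) (N i)"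
    and \<tau>: "\<And>i. odd i \<Longrightarrow> ok_roots (\<tau> i) (\<tau> (i + 1)) \<and> ok_roots (\<tau> i) (\<tau> (i - 1))"
  shows "subst_model s (placed (line \<xi>) \<xi> l r V) = placed (line \<xi>') \<xi>' (\<tau> l) (\<tau> r) (\<Union>i\<in>V. N i)"
proof -
  let ?h = "subst_hom s" and ?c = "line \<xi>" and ?d = "line \<xi>'"
  have ends: "fst (s (\<xi> i)) = \<xi>' (\<tau> i)" "snd (snd (s (\<xi> i))) = \<xi>' (\<tau> i)" for i
    by (simp_all add: s placed_def)
  have e: "?h (edge_gen (\<xi> i) (\<xi> j)) = edge_gen (\<xi>' (\<tau> i)) (\<xi>' (\<tau> j))" for i j
    by (simp add: subst_hom_edge_gen ends)
  have step: "?d (\<tau> (i + 1)) = ?d (\<tau> i) + ?h (line_step \<xi> i)" for i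
  proof (cases "odd i")
    case True
    then show ?thesis using arc_line[of "\<tau> i" "\<tau> (i + 1)" \<xi>'] \<tau>[OF True]
      by (simp add: line_step_def e arc_def)
  next
    case False
    then have "ok_roots (\<tau> (i + 1)) (\<tau> i)" using \<tau>[of "i + 1"] by simp
    from arc_line[OF this, of \<xi>'] show ?thesis using False
      by (simp add: line_step_def subst_hom_uminus e arc_def)
  qed
  define K where "K = ?h (?c 0) - ?d (\<tau> 0)"
  have K: "?h (?c i) = K + ?d (\<tau> i)" for i
  proof (induction i rule: int_induct[of _ 0])
    case (step1 i)
    then show ?case by (simp add: line_succ subst_hom_add step add.assoc)
  next
    case (step2 i)
    have "?h (?c (i - 1)) + ?h (line_step \<xi> (i - 1)) = K + ?d (\<tau> (i - 1)) + ?h (line_step \<xi> (i - 1))"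
      using step2 line_succ[of \<xi> "i - 1"] step[of "i - 1"] by (simp add: subst_hom_add add.assoc)
    then show ?case by (simp only: add_right_cancel)
  qed (simp add: K_def)
  have pos: "?h (- ?c l + ?c i) = - ?d (\<tau> l) + ?d (\<tau> i)" for i
    by (simp only: subst_hom_add subst_hom_uminus K minus_add add.assoc minus_add_cancel)
  have "translate (- ?d (\<tau> l) + ?d (\<tau> i)) (fst (snd (s (\<xi> i)))) =
      (\<lambda>v. (- ?d (\<tau> l) + ?d v, \<xi>' v)) ` N i" for i
    by (simp add: s placed_def translate_def image_image add.assoc)
  then show ?thesis
    by (simp add: subst_model_def placed_def[of ?c] placed_def[of ?d \<xi>' "\<tau> l"] pos ends image_UN)
qed

locale cyclic_letters =
  fixes x :: "nat \<Rightarrow> 'x" and n :: nat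
  assumes inj_x: "inj_on x {1..}" and n2: "n \<ge> 2"
begin

definition \<xi> :: "int \<Rightarrow> 'x" where
  "\<xi> i = x (nat ((i - 1) mod (2 * int n)) + 1)"

text \<open>The starred trees have their edges directed the other way; the shift by one makes odd
  positions the sources again.\<close>

definition \<xi>' :: "int \<Rightarrow> 'x" where
  "\<xi>' i = \<xi> (i - 1)"

lemma xi_eq_iff: "\<xi> i = \<xi> j \<longleftrightarrow> 2 * int n dvd i - j"
proof -
  let ?m = "2 * int n"
  have m: "?m > 0" using n2 by simp
  have "\<xi> i = \<xi> j \<longleftrightarrow> nat ((i - 1) mod ?m) + 1 = nat ((j - 1) mod ?m) + 1"
    unfolding \<xi>_def using inj_x by (auto simp: inj_on_eq_iff)
  also have "\<dots> \<longleftrightarrow> (i - 1) mod ?m = (j - 1) mod ?m"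
    using m by (simp add: nat_eq_iff)
  also have "\<dots> \<longleftrightarrow> ?m dvd i - j" by (simp add: mod_eq_dvd_iff)
  finally show ?thesis .
qed

lemma xi_shift: "\<xi> (i + 2 * int n * q) = \<xi> i"
  by (simp add: xi_eq_iff)

lemma xi_nat: "1 \<le> t \<Longrightarrow> t \<le> 2 * n \<Longrightarrow> \<xi> (int t) = x t"
proof -
  assume t: "1 \<le> t" "t \<le> 2 * n"
  then have "(int t - 1) mod (2 * int n) = int t - 1" by (intro mod_pos_pos_trivial) auto
  moreover have "nat (int t - 1) + 1 = t" using t by arith
  ultimately show ?thesis by (simp only: \<xi>_def)
qed

lemma small_dvd:
  assumes "2 * int n dvd d" "\<bar>d\<bar> < 2 * int n"
  shows "d = 0"
  using assms zdvd_imp_le[of "2 * int n" "\<bar>d\<bar>"] by fastforce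

text \<open>The bound 3 is what \<open>n2\<close> provides: the labels have period at least
  4.\<close>

lemma xi_neq: "d \<noteq> 0 \<Longrightarrow> \<bar>d\<bar> \<le> 3 \<Longrightarrow> \<xi> (i + d) \<noteq> \<xi> i"
  using small_dvd[of d] n2 by (auto simp: xi_eq_iff)

lemma xi_odd: "\<xi> i = \<xi> j \<Longrightarrow> odd i \<longleftrightarrow> odd j"
proof -
  assume "\<xi> i = \<xi> j"
  then have "2 dvd i - j" unfolding xi_eq_iff by (rule dvd_mult_left)
  then show ?thesis by presburger
qed

lemma xi_add_cong: "\<xi> i = \<xi> j \<Longrightarrow> \<xi> (i + d) = \<xi> (j + d)"
  by (simp add: xi_eq_iff)

lemma ex_xi_representative: "\<exists>j. \<xi> j = \<xi> i \<and> 1 \<le> j \<and> j \<le> 2 * int n"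
proof -
  let ?j = "(i - 1) mod (2 * int n) + 1"
  have m: "2 * int n > 0" using n2 by simp
  have "i - ?j = 2 * int n * ((i - 1) div (2 * int n))" by (simp add: minus_mod_eq_mult_div [symmetric])
  then have "2 * int n dvd i - ?j" by simp
  then have "\<xi> i = \<xi> ?j" by (simp only: xi_eq_iff)
  moreover have "1 \<le> ?j" "?j \<le> 2 * int n" 
    using pos_mod_sign[OF m, of "i - 1"] pos_mod_bound[OF m, of "i - 1"] by linarith+
  ultimately show ?thesis by metis
qed

text \<open>Both sides arise from the letterwise identity substitution, read as the translation of the
  line by \<open>q\<close> periods and as the identity.\<close>

lemma placed_period:
  "placed (line \<xi>) \<xi> (l + 2 * int n * q) (r + 2 * int n * q) ((\<lambda>i. i + 2 * int n * q) ` V) =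
   placed (line \<xi>) \<xi> l r V"
proof -
  have "subst_model model_letter (placed (line \<xi>) \<xi> l r V) =
      placed (line \<xi>) \<xi> (l + 2 * int n * q) (r + 2 * int n * q) (\<Union>i\<in>V. {i + 2 * int n * q})"
    by (rule subst_line) (auto simp: placed_letter xi_shift)
  moreover have "subst_model model_letter (placed (line \<xi>) \<xi> l r V) = placed (line \<xi>) \<xi> l r (\<Union>i\<in>V. {i})"
    by (rule subst_line) (auto simp: placed_letter)
  moreover have "(\<lambda>i. i + 2 * int n * q) ` V = (\<Union>i\<in>V. {i + 2 * int n * q})" by auto
  ultimately show ?thesis by simp
qed

text \<open>\<open>D_content\<close> lists the edges of a cycle whose sources are the odd letters.
  The closing pair \<open>(x 1, x (2*n))\<close> is the edge from 1 to 0 on the line.\<close>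

lemma edge_in_D_iff:
  "(y, z) \<in> D_content x n \<longleftrightarrow>
     (\<exists>i. y = \<xi> i \<and> z = \<xi> i) \<or> (\<exists>i. odd i \<and> y = \<xi> i \<and> (z = \<xi> (i + 1) \<or> z = \<xi> (i - 1)))"
proof
  assume "(y, z) \<in> D_content x n"
  then consider (1) t where "1 \<le> t" "t < n" "y = x (2 * t - 1)" "z = x (2 * t)"
    | (2) t where "1 \<le> t" "t < n" "y = x (2 * t + 1)" "z = x (2 * t)"
    | (3) "y = x 1" "z = x (2 * n)"
    | (4) "y = x (2 * n - 1)" "z = x (2 * n)"
    | (5) t where "1 \<le> t" "t \<le> 2 * n" "y = x t" "z = x t"
    unfolding D_content_def by auto
  then show "(\<exists>i. y = \<xi> i \<and> z = \<xi> i) \<or> (\<exists>i. odd i \<and> y = \<xi> i \<and> (z = \<xi> (i + 1) \<or> z = \<xi> (i - 1)))"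
  proof cases
    case 1
    then have "y = \<xi> (2 * int t - 1)" "z = \<xi> (2 * int t)"
      using xi_nat[of "2 * t - 1"] xi_nat[of "2 * t"] by (auto simp: of_nat_diff)
    then show ?thesis by (intro disjI2 exI[of _ "2 * int t - 1"]) simp
  next
    case 2
    then have "y = \<xi> (2 * int t + 1)" "z = \<xi> (2 * int t)"
      using xi_nat[of "2 * t + 1"] xi_nat[of "2 * t"] by (auto simp: add.commute)
    then show ?thesis by (intro disjI2 exI[of _ "2 * int t + 1"]) simp
  next
    case 3
    then have "y = \<xi> 1" "z = \<xi> 0"
      using xi_nat[of 1] xi_nat[of "2 * n"] n2 xi_shift[of 0 1] by auto
    then show ?thesis by (intro disjI2 exI[of _ 1]) simp
  next
    case 4
    then have "y = \<xi> (2 * int n - 1)" "z = \<xi> (2 * int n)"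
      using xi_nat[of "2 * n - 1"] xi_nat[of "2 * n"] n2 by (auto simp: of_nat_diff)
    then show ?thesis by (intro disjI2 exI[of _ "2 * int n - 1"]) simp
  next
    case 5
    then show ?thesis using xi_nat[of t] by metis
  qed
next
  assume "(\<exists>i. y = \<xi> i \<and> z = \<xi> i) \<or> (\<exists>i. odd i \<and> y = \<xi> i \<and> (z = \<xi> (i + 1) \<or> z = \<xi> (i - 1)))"
  then show "(y, z) \<in> D_content x n"
  proof (elim disjE exE conjE)
    fix i assume "y = \<xi> i" "z = \<xi> i"
    moreover obtain j where j: "\<xi> j = \<xi> i" "1 \<le> j" "j \<le> 2 * int n" using ex_xi_representative by blast
    moreover have "\<xi> j = x (nat j)" using xi_nat[of "nat j"] j by simp
    ultimately have "(y, z) = (x (nat j), x (nat j))" "1 \<le> nat j" "nat j \<le> 2 * n" by auto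
    then show ?thesis unfolding D_content_def by blast
  next
    fix i assume i: "odd i" "y = \<xi> i" "z = \<xi> (i + 1)"
    obtain j where j: "\<xi> j = \<xi> i" "1 \<le> j" "j \<le> 2 * int n" using ex_xi_representative by blast
    then have "odd j" and z: "\<xi> (j + 1) = \<xi> (i + 1)" using i xi_odd xi_add_cong by blast+
    from \<open>odd j\<close> obtain k where k: "j = 2 * k + 1" by (rule oddE)
    define t where "t = nat (k + 1)"
    have t: "1 \<le> t" "t \<le> n" "j = int (2 * t - 1)" "j + 1 = int (2 * t)"
      using k j by (auto simp: t_def of_nat_diff)
    have "1 \<le> 2 * t - 1" "2 * t - 1 \<le> 2 * n" "1 \<le> 2 * t" "2 * t \<le> 2 * n" using t(1,2) by linarith+
    then have "\<xi> j = x (2 * t - 1)" "\<xi> (j + 1) = x (2 * t)"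
      using xi_nat[of "2 * t - 1"] xi_nat[of "2 * t"] unfolding t(4) by (simp_all only: t(3))
    then have "y = x (2 * t - 1)" "z = x (2 * t)" using i j(1) z by auto
    moreover have "(x (2 * t - 1), x (2 * t)) \<in> D_content x n"
    proof (cases "t = n")
      case False
      then have "t \<in> {1..<n}" using t(1,2) by simp
      then show ?thesis unfolding D_content_def by (intro UnI1 UN_I[of t]) simp_all
    qed (simp add: D_content_def)
    ultimately show ?thesis by simp
  next
    fix i assume i: "odd i" "y = \<xi> i" "z = \<xi> (i - 1)"
    obtain j where j: "\<xi> j = \<xi> i" "1 \<le> j" "j \<le> 2 * int n" using ex_xi_representative by blast
    then have "odd j" and z: "\<xi> (j - 1) = \<xi> (i - 1)" using i xi_odd[of j i] xi_add_cong[of j i "-1"] by simp_all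
    from \<open>odd j\<close> obtain k where k: "j = 2 * k + 1" by (rule oddE)
    show ?thesis
    proof (cases "k = 0")
      case True
      then have "y = x 1" "z = x (2 * n)"
        using i j(1) k z xi_nat[of 1] xi_nat[of "2 * n"] n2 xi_shift[of 0 1] by auto
      then show ?thesis unfolding D_content_def by simp
    next
      case False
      define t where "t = nat k"
      have t: "1 \<le> t" "t < n" "j = int (2 * t + 1)" "j - 1 = int (2 * t)"
        using k j False by (auto simp: t_def)
      have "y = x (2 * t + 1)" "z = x (2 * t)"
        using i j(1) z xi_nat[of "2 * t + 1"] xi_nat[of "2 * t"] t by auto
      moreover have "t \<in> {1..<n}" using t(1,2) by simp
      then have "(x (2 * t + 1), x (2 * t)) \<in> D_content x n"
        unfolding D_content_def by (intro UnI1 UN_I[of t]) simp_all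
      ultimately show ?thesis by simp
    qed
  qed
qed

end

section \<open>Extension rules for intervals\<close>

locale cyclic_congruence = cyclic_letters x n + model_congruence R
  for x :: "nat \<Rightarrow> 'x" and n :: nat and R :: "'x model \<Rightarrow> 'x model \<Rightarrow> bool"
begin

lemma R_subst_line:
  assumes B: "\<And>i. placed (line \<zeta>) \<zeta> (\<tau> i) (\<tau> i) (N i) \<in> generated"
    and well: "\<And>i j. \<eta> i = \<eta> j \<Longrightarrow>
      placed (line \<zeta>) \<zeta> (\<tau> i) (\<tau> i) (N i) = placed (line \<zeta>) \<zeta> (\<tau> j) (\<tau> j) (N j)"
    and \<tau>: "\<And>i. odd i \<Longrightarrow> ok_roots (\<tau> i) (\<tau> (i + 1)) \<and> ok_roots (\<tau> i) (\<tau> (i - 1))"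
    and R: "R (placed (line \<eta>) \<eta> l r V) (placed (line \<eta>) \<eta> l r W)"
  shows "R (placed (line \<zeta>) \<zeta> (\<tau> l) (\<tau> r) (\<Union>i\<in>V. N i)) (placed (line \<zeta>) \<zeta> (\<tau> l) (\<tau> r) (\<Union>i\<in>W. N i))"
proof -
  let ?B = "\<lambda>i. placed (line \<zeta>) \<zeta> (\<tau> i) (\<tau> i) (N i)"
  \<comment> \<open>A letter labels many indices; \<open>well\<close> makes its image independent of
    the index picked by \<open>inv\<close>. Letters off the line stay fixed.\<close>
  define s where "s y = (if y \<in> range \<eta> then ?B (inv \<eta> y) else model_letter y)" for y
  have s: "s (\<eta> i) = ?B i" for i
    using well[OF f_inv_into_f[of "\<eta> i" \<eta> UNIV]] by (simp add: s_def)
  have "s y \<in> generated" for y using B by (simp add: s_def generated.letter)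
  note s_gen = this
  have "subst_model s (placed (line \<eta>) \<eta> l r V) = placed (line \<zeta>) \<zeta> (\<tau> l) (\<tau> r) (\<Union>i\<in>V. N i)" for V
    by (rule subst_line) (rule s, rule \<tau>, assumption)
  then show ?thesis using R_subst[of s, OF s_gen R] by simp
qed

lemma R_relabel:
  assumes "\<And>i j. \<eta> i = \<eta> j \<Longrightarrow> \<zeta> (\<tau> i) = \<zeta> (\<tau> j)"
    and "\<And>i. odd i \<Longrightarrow> ok_roots (\<tau> i) (\<tau> (i + 1)) \<and> ok_roots (\<tau> i) (\<tau> (i - 1))"
    and "R (placed (line \<eta>) \<eta> l r V) (placed (line \<eta>) \<eta> l r W)"
  shows "R (placed (line \<zeta>) \<zeta> (\<tau> l) (\<tau> r) (\<tau> ` V)) (placed (line \<zeta>) \<zeta> (\<tau> l) (\<tau> r) (\<tau> ` W))"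
proof -
  have "placed (line \<zeta>) \<zeta> (\<tau> i) (\<tau> i) {\<tau> i} = placed (line \<zeta>) \<zeta> (\<tau> j) (\<tau> j) {\<tau> j}"
    if "\<eta> i = \<eta> j" for i j
    unfolding placed_letter using assms(1)[OF that] by simp
  note well = this
  have "R (placed (line \<zeta>) \<zeta> (\<tau> l) (\<tau> r) (\<Union>i\<in>V. {\<tau> i})) (placed (line \<zeta>) \<zeta> (\<tau> l) (\<tau> r) (\<Union>i\<in>W. {\<tau> i}))"
    by (rule R_subst_line[where N = "\<lambda>i. {\<tau> i}", OF _ _ _ assms(3)])
      (rule placed_point_generated, rule well, assumption, rule assms(2), assumption)
  then show ?thesis by (simp only: UNION_singleton_eq_range)
qed

text \<open>Vacuously true for disjoint intervals, hence the overlap hypotheses below.\<close>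

definition linked :: "int \<Rightarrow> int \<Rightarrow> int \<Rightarrow> int \<Rightarrow> bool" where
  "linked a b a' b' \<longleftrightarrow> (\<forall>l \<in> {a..b} \<inter> {a'..b'}. R (segment \<xi> l l a b) (segment \<xi> l l a' b'))"

text \<open>One common root suffices, since the overlap of two intervals is an interval along which
  \<open>root_walk\<close> moves the roots.\<close>

lemma linkedI:
  assumes "R (segment \<xi> l l a b) (segment \<xi> l l a' b')" "l \<in> {a..b}" "l \<in> {a'..b'}"
  shows "linked a b a' b'"
  unfolding linked_def by (intro ballI root_walk[OF assms(1)]) (use assms(2,3) in auto)

lemma linkedD: "linked a b a' b' \<Longrightarrow> l \<in> {a..b} \<Longrightarrow> l \<in> {a'..b'} \<Longrightarrow> R (segment \<xi> l l a b) (segment \<xi> l l a' b')"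
  unfolding linked_def by blast

lemma linked_iff:
  assumes "ok_roots l r" "l \<in> {a..b}" "l \<in> {a'..b'}" "r \<in> {a..b}" "r \<in> {a'..b'}"
  shows "R (segment \<xi> l r a b) (segment \<xi> l r a' b') \<longleftrightarrow> linked a b a' b'"
  using roots_together[of "line \<xi>" \<xi> l r] roots_apart[OF _ arc_line[OF assms(1)]] linkedI linkedD assms(2-5) by meson

lemma linked_refl: "linked a b a b"
  unfolding linked_def by (auto intro!: R_refl segment_generated)

lemma linked_sym: "linked a b a' b' \<Longrightarrow> linked a' b' a b"
  unfolding linked_def using R_sym by blast

lemma linked_trans:
  assumes "linked a b a' b'" "linked a' b' a'' b''" "l \<in> {a..b}" "l \<in> {a'..b'}" "l \<in> {a''..b''}"
  shows "linked a b a'' b''"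
  using R_trans[OF linkedD[OF assms(1,3,4)] linkedD[OF assms(2,4,5)]] assms(3,5) by (rule linkedI)

lemma linked_join:
  assumes "linked a b a' b'" "l \<in> {a..b}" "l \<in> {a'..b'}" "l \<in> {c..d}"
  shows "linked (min a c) (max b d) (min a' c) (max b' d)"
proof -
  have "R (segment \<xi> l l c d) (segment \<xi> l l c d)"
    using assms(4) by (intro R_refl segment_generated) auto
  from R_meet[OF linkedD[OF assms(1-3)] this]
  have "R (placed (line \<xi>) \<xi> l l ({a..b} \<union> {c..d})) (placed (line \<xi>) \<xi> l l ({a'..b'} \<union> {c..d}))"
    by (simp add: placed_meet)
  moreover have "{a..b} \<union> {c..d} = {min a c..max b d}" "{a'..b'} \<union> {c..d} = {min a' c..max b' d}"
    using assms(2-4) by auto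
  ultimately have "R (segment \<xi> l l (min a c) (max b d)) (segment \<xi> l l (min a' c) (max b' d))" by simp
  then show ?thesis by (rule linkedI) (use assms(2-4) in auto)
qed

text \<open>The substitution rotates the cycle of letters; \<open>d\<close> is even because sources
  sit at odd positions.\<close>

lemma linked_shift:
  assumes "linked a b a' b'" "l \<in> {a..b}" "l \<in> {a'..b'}" "even d"
  shows "linked (a + d) (b + d) (a' + d) (b' + d)"
proof -
  have "R (placed (line \<xi>) \<xi> (l + d) (l + d) ((\<lambda>i. i + d) ` {a..b}))
      (placed (line \<xi>) \<xi> (l + d) (l + d) ((\<lambda>i. i + d) ` {a'..b'}))"
    by (rule R_relabel[OF _ _ linkedD[OF assms(1-3)]]) (use assms(4) in \<open>auto intro: xi_add_cong\<close>)
  then have "R (segment \<xi> (l + d) (l + d) (a + d) (b + d)) (segment \<xi> (l + d) (l + d) (a' + d) (b' + d))"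
    by simp
  then show ?thesis by (rule linkedI) (use assms(2,3) in auto)
qed

text \<open>The substitution reverses the cycle of letters; negation keeps parity and thus the
  direction of edges.\<close>

lemma linked_reflect:
  assumes "linked a b a' b'" "l \<in> {a..b}" "l \<in> {a'..b'}"
  shows "linked (- b) (- a) (- b') (- a')"
proof -
  have "R (placed (line \<xi>) \<xi> (- l) (- l) (uminus ` {a..b})) (placed (line \<xi>) \<xi> (- l) (- l) (uminus ` {a'..b'}))"
    by (rule R_relabel[OF _ _ linkedD[OF assms(1-3)]]) (auto simp: xi_eq_iff dvd_diff_commute)
  then have "R (segment \<xi> (- l) (- l) (- b) (- a)) (segment \<xi> (- l) (- l) (- b') (- a'))"
    by simp
  then show ?thesis by (rule linkedI) (use assms(2,3) in auto)
qed

text \<open>Every letter is replaced by a tree that also contains its left neighbour on the line.\<close>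

lemma linked_attach:
  assumes "linked a b a' b'" "l \<in> {a..b}" "l \<in> {a'..b'}"
  shows "linked (a - 1) b (a' - 1) b'"
proof -
  have "R (placed (line \<xi>) \<xi> l l (\<Union>i\<in>{a..b}. {i - 1..i})) (placed (line \<xi>) \<xi> l l (\<Union>i\<in>{a'..b'}. {i - 1..i}))"
  proof (rule R_subst_line[where \<tau> = "\<lambda>i. i", OF _ _ _ linkedD[OF assms(1-3)]])
    show "segment \<xi> i i (i - 1) i \<in> generated" for i by (rule segment_generated) auto
    show "segment \<xi> i i (i - 1) i = segment \<xi> j j (j - 1) j" if ij: "\<xi> i = \<xi> j" for i j
    proof -
      obtain q where "i - j = 2 * int n * q" using ij unfolding xi_eq_iff by (rule dvdE)
      then have q: "i = j + 2 * int n * q" by simp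
      show ?thesis using placed_period[of j q j "{j - 1..j}"] unfolding q by (simp add: algebra_simps)
    qed
  qed auto
  moreover have "(\<Union>i\<in>{a..b}. {i - 1..i}) = {a - 1..b}" if "a \<le> b" for a b :: int
  proof (intro equalityI subsetI)
    fix j assume "j \<in> {a - 1..b}"
    then have "max a j \<in> {a..b}" "j \<in> {max a j - 1..max a j}" using that by auto
    then show "j \<in> (\<Union>i\<in>{a..b}. {i - 1..i})" by blast
  qed auto
  ultimately have "R (segment \<xi> l l (a - 1) b) (segment \<xi> l l (a' - 1) b')" using assms(2,3) by simp
  then show ?thesis by (rule linkedI) (use assms(2,3) in auto)
qed

text \<open>Only the parity of \<open>a\<close> matters. The odd rules are the pairs \<open>(\<alpha>, \<beta>)\<close> of the special family,
  the even ones the pairs \<open>(\<alpha>*, \<beta>*)\<close>, on paths with \<open>m\<close> vertices.\<close>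

definition rule :: "int \<Rightarrow> int \<Rightarrow> bool" where
  "rule a m \<longleftrightarrow> linked a (a + m - 1) (a - 1) (a + m - 1)"

lemma rule_parity:
  assumes "rule a m" "m \<ge> 1" "even (a - a')"
  shows "rule a' m"
  using linked_shift[of a "a + m - 1" "a - 1" "a + m - 1" a "a' - a"] assms by (simp add: rule_def algebra_simps)

lemma rule_iff: "m \<ge> 1 \<Longrightarrow> even (a - a') \<Longrightarrow> rule a m \<longleftrightarrow> rule a' m"
  using rule_parity[of a m a'] rule_parity[of a' m a] by (simp add: even_diff_iff) blast

lemma rule_Suc_same:
  assumes "rule a m" "m \<ge> 1"
  shows "rule a (m + 1)"
  using linked_join[of a "a + m - 1" "a - 1" "a + m - 1" a a "a + m"] assms
  by (simp add: rule_def max_def min_def)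

lemma rule_Suc_other:
  assumes "rule a m" "m \<ge> 1"
  shows "rule (a - 1) (m + 1)"
  using linked_attach[of a "a + m - 1" "a - 1" "a + m - 1" a] assms by (simp add: rule_def)

lemma rule_Suc:
  assumes "rule a m" "m \<ge> 1"
  shows "rule a' (m + 1)"
proof (cases "even (a - a')")
  case True
  then show ?thesis using rule_Suc_same[OF assms] rule_parity[of a "m + 1" a'] assms(2) by simp
next
  case False
  then have "even (a - 1 - a')" by simp
  then show ?thesis using rule_Suc_other[OF assms] rule_parity[of "a - 1" "m + 1" a'] assms(2) by simp
qed

lemma rule_mono:
  assumes "rule a m" "m \<ge> 1" "m < m'"
  shows "rule a' m'"
proof -
  have "m + 1 \<le> m'" using assms(3) by simp
  then have "\<forall>a'. rule a' m'"
  proof (induction rule: int_ge_induct)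
    case base
    then show ?case using rule_Suc assms by blast
  next
    case (step i)
    then show ?case using rule_Suc[of _ i] assms(2) by auto
  qed
  then show ?thesis by blast
qed

lemma extend_left: "rule a (b - a + 1) \<Longrightarrow> linked a b (a - 1) b"
  by (simp add: rule_def)

text \<open>Reflection turns the right end \<open>b\<close> into the left end \<open>- b\<close>, of
  the same parity.\<close>

lemma extend_right_iff: "a \<le> b \<Longrightarrow> linked a b a (b + 1) \<longleftrightarrow> rule b (b - a + 1)"
proof -
  assume ab: "a \<le> b"
  have "linked a b a (b + 1) \<longleftrightarrow> linked (- b) (- a) (- b - 1) (- a)"
  proof
    assume L: "linked a b a (b + 1)"
    have "linked (- b) (- a) (- (b + 1)) (- a)" by (rule linked_reflect[OF L, of a]) (use ab in auto)
    then show "linked (- b) (- a) (- b - 1) (- a)" by simp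
  next
    assume L: "linked (- b) (- a) (- b - 1) (- a)"
    have "linked (- (- a)) (- (- b)) (- (- a)) (- (- b - 1))"
      by (rule linked_reflect[OF L, of "- a"]) (use ab in auto)
    moreover have "- (- b - 1) = b + 1" by simp
    ultimately show "linked a b a (b + 1)" by (simp only: minus_minus)
  qed
  also have "\<dots> \<longleftrightarrow> rule (- b) (b - a + 1)" by (simp add: rule_def)
  also have "\<dots> \<longleftrightarrow> rule b (b - a + 1)" by (rule rule_iff) (use ab in auto)
  finally show ?thesis .
qed

text \<open>With \<open>b - a \<ge> m\<close> the interval has more than \<open>m\<close> vertices,
  so rules of both parities hold at its size and beyond, and it grows vertex by vertex.\<close>

lemma linked_larger:
  assumes r: "rule c m" "m \<ge> 1" and ab: "b - a \<ge> m" "a' \<le> a" "b \<le> b'"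
  shows "linked a b a' b'"
proof -
  have all: "rule e m'" if "m' > m" for e m' using rule_mono[OF r that] .
  have left: "linked a b a' b"
    using ab(2)
  proof (induction a' rule: int_le_induct)
    case base
    then show ?case by (rule linked_refl)
  next
    case (step i)
    have "linked i b (i - 1) b" by (rule extend_left, rule all) (use step(1) ab in auto)
    then show ?case using linked_trans[OF step(2), of "i - 1" b b] step(1) ab r(2) by auto
  qed
  have right: "linked a' b a' b'"
    using ab(3)
  proof (induction b' rule: int_ge_induct)
    case base
    then show ?case by (rule linked_refl)
  next
    case (step i)
    have "linked a' i a' (i + 1)"
      by (subst extend_right_iff) (use step(1) ab r(2) all in auto)
    then show ?case using linked_trans[OF step(2), of a' "i + 1" b] step(1) ab r(2) by auto
  qed
  show ?thesis using linked_trans[OF left right, of b] ab r(2) by auto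
qed

text \<open>For even \<open>m\<close> the two ends have opposite parity. After the given extension
  on the left the interval is long enough for \<open>linked_larger\<close>: it grows on the right,
  then shrinks on the left, which amounts to an extension on the right alone.\<close>

lemma rule_even:
  assumes "rule a m" "even m" "m \<ge> 2"
  shows "rule a' m"
proof (cases "even (a - a')")
  case True
  then show ?thesis using rule_parity assms by auto
next
  case False
  define b where "b = a + m - 1"
  have 1: "linked a b (a - 1) b" using assms(1) by (simp add: rule_def b_def)
  have 2: "linked (a - 1) b (a - 1) (b + 1)" "linked a (b + 1) (a - 1) (b + 1)"
    by (rule linked_larger[OF assms(1)]; use assms(3) in \<open>simp add: b_def\<close>)+
  have "linked a b (a - 1) (b + 1)"
    using linked_trans[OF 1 2(1), of b] assms(3) by (auto simp: b_def)
  then have "linked a b a (b + 1)"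
    using linked_trans[OF _ linked_sym[OF 2(2)], of a b b] assms(3) by (auto simp: b_def)
  then have "rule b m" using extend_right_iff[of a b] assms(3) by (simp add: b_def)
  then show ?thesis by (rule rule_parity) (use False assms in \<open>auto simp: b_def\<close>)
qed

text \<open>Meeting with a single vertex beyond an end isolates the first extension there.
  Conversely, after one extension the interval is long enough for
  \<open>linked_larger\<close>.\<close>

lemma linked_superset_iff:
  assumes "A \<le> a" "a \<le> b" "b \<le> B"
  shows "linked a b A B \<longleftrightarrow> (A < a \<longrightarrow> rule a (b - a + 1)) \<and> (b < B \<longrightarrow> rule b (b - a + 1))"
proof
  assume L: "linked a b A B"
  show "(A < a \<longrightarrow> rule a (b - a + 1)) \<and> (b < B \<longrightarrow> rule b (b - a + 1))"
  proof (intro conjI impI)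
    assume "A < a"
    then have "linked (a - 1) b A B"
      using linked_join[OF L, of b "a - 1" b] assms by (simp add: min_def max_def)
    from linked_trans[OF L linked_sym[OF this], of b] have "linked a b (a - 1) b" using assms by auto
    then show "rule a (b - a + 1)" by (simp add: rule_def)
  next
    assume "b < B"
    then have "linked a (b + 1) A B"
      using linked_join[OF L, of b a "b + 1"] assms by (simp add: min_absorb1 max_absorb1 max_absorb2)
    from linked_trans[OF L linked_sym[OF this], of b] have "linked a b a (b + 1)" using assms by auto
    then show "rule b (b - a + 1)" using extend_right_iff assms by simp
  qed
next
  assume N: "(A < a \<longrightarrow> rule a (b - a + 1)) \<and> (b < B \<longrightarrow> rule b (b - a + 1))"
  consider "A < a" | "A = a" "b < B" | "A = a" "b = B" using assms by linarith
  then show "linked a b A B"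
  proof cases
    case 1
    then have "rule a (b - a + 1)" using N by blast
    moreover from linked_larger[OF this, of b "a - 1" A B] have "linked (a - 1) b A B" using 1 assms by auto
    ultimately show ?thesis using linked_trans[OF extend_left, of a b A B b] assms by auto
  next
    case 2
    then have r: "rule b (b - a + 1)" using N by blast
    from linked_larger[OF this, of "b + 1" a A B] have "linked a (b + 1) A B" using 2 assms by auto
    moreover have "linked a b a (b + 1)" using extend_right_iff assms r by simp
    ultimately show ?thesis using linked_trans[of a b a "b + 1" A B b] 2 assms by auto
  qed (use linked_refl in simp)
qed

text \<open>Meeting both members with one of the intervals leaves that interval and turns the other
  into the hull.\<close>

lemma linked_hull_iff:
  assumes "l \<in> {a..b}" "l \<in> {a'..b'}"
  shows "linked a b a' b' \<longleftrightarrow> linked a b (min a a') (max b b') \<and> linked a' b' (min a a') (max b b')"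
proof
  assume L: "linked a b a' b'"
  show "linked a b (min a a') (max b b') \<and> linked a' b' (min a a') (max b b')"
    using linked_join[OF L, of l a b] linked_join[OF linked_sym[OF L], of l a' b'] assms
    by (simp add: min.commute max.commute)
next
  assume "linked a b (min a a') (max b b') \<and> linked a' b' (min a a') (max b b')"
  then show "linked a b a' b'"
    using linked_trans[OF _ linked_sym, of a b "min a a'" "max b b'" a' b' l] assms
    by (auto simp: min_le_iff_disj le_max_iff_disj)
qed

end

text \<open>\<open>(e, m)\<close> demands an extension at the end \<open>e\<close> of the interval
  with \<open>m\<close> vertices, wherever the hull goes beyond it. Right ends fall under the same
  rules by \<open>extend_right_iff\<close>.\<close>

definition interval_rules :: "int \<Rightarrow> int \<Rightarrow> int \<Rightarrow> int \<Rightarrow> (int \<times> int) set" where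
  "interval_rules a b a' b' =
     {(e, m). m = b - a + 1 \<and> (a' < a \<and> e = a \<or> b < b' \<and> e = b)} \<union>
     {(e, m). m = b' - a' + 1 \<and> (a < a' \<and> e = a' \<or> b' < b \<and> e = b')}"

lemma (in cyclic_congruence) linked_rules_iff:
  assumes "l \<in> {a..b}" "l \<in> {a'..b'}"
  shows "linked a b a' b' \<longleftrightarrow> (\<forall>(e, m) \<in> interval_rules a b a' b'. rule e m)"
proof -
  have "linked a b (min a a') (max b b') \<longleftrightarrow> (a' < a \<longrightarrow> rule a (b - a + 1)) \<and> (b < b' \<longrightarrow> rule b (b - a + 1))"
    using linked_superset_iff[of "min a a'" a b "max b b'"] assms by (auto simp: min_def max_def)
  moreover have "linked a' b' (min a a') (max b b') \<longleftrightarrow>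
      (a < a' \<longrightarrow> rule a' (b' - a' + 1)) \<and> (b' < b \<longrightarrow> rule b' (b' - a' + 1))"
    using linked_superset_iff[of "min a a'" a' b' "max b b'"] assms by (auto simp: min_def max_def)
  ultimately show ?thesis
    unfolding linked_hull_iff[OF assms] interval_rules_def by auto
qed

section \<open>Trees with cyclic 2-content\<close>

context cyclic_letters
begin

text \<open>Displacement along the line of an edge with these labels. The default -1 is meaningful
  only for pairs in \<open>D_content x n\<close>.\<close>

definition shift :: "'x \<Rightarrow> 'x \<Rightarrow> int" where
  "shift y z = (if y = z then 0 else if \<exists>i. odd i \<and> y = \<xi> i \<and> z = \<xi> (i + 1) then 1 else -1)"

lemma shift_cases:
  assumes "(y, z) \<in> D_content x n"
  shows "y = z \<and> shift y z = 0 \<or>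
    (\<exists>i. odd i \<and> y = \<xi> i \<and> z = \<xi> (i + shift y z) \<and> shift y z \<in> {1, -1})"
proof -
  have "(\<exists>i. y = \<xi> i \<and> z = \<xi> i) \<or> (\<exists>i. odd i \<and> y = \<xi> i \<and> (z = \<xi> (i + 1) \<or> z = \<xi> (i - 1)))"
    using assms unfolding edge_in_D_iff .
  then show ?thesis
  proof (elim disjE exE conjE)
    fix i assume i: "odd i" "y = \<xi> i" "z = \<xi> (i + 1)"
    then have "shift y z = 1" using xi_neq[of 1 i] by (auto simp: shift_def)
    then show ?thesis using i by auto
  next
    fix i assume i: "odd i" "y = \<xi> i" "z = \<xi> (i - 1)"
    have "\<xi> (i + 1) \<noteq> \<xi> (i - 1)" using xi_neq[of 2 "i - 1"] by (simp add: algebra_simps)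
    then have "z \<noteq> \<xi> (j + 1)" if "y = \<xi> j" for j
      using xi_add_cong[of i j 1] i that by auto
    then have "shift y z = -1" using xi_neq[of "-1" i] i by (auto simp: shift_def)
    then show ?thesis using i by auto
  qed (auto simp: shift_def)
qed

text \<open>The tree is unwound from the cycle onto the line: the integer potential with weights
  \<open>shift\<close> gives each vertex an index. Taking \<open>l\<close> in one period makes it
  depend on the left label only.\<close>

lemma cyclic_tree_segment:
  assumes T: "is_tree T" and D: "pre_c2 T = D_content x n"
  obtains l r a b where "ok_roots l r" "1 \<le> l" "l \<le> 2 * int n" "l \<in> {a..b}" "r \<in> {a..b}"
    "b - a \<ge> 2 * int n" "pre_model T = segment \<xi> l r a b"
proof -
  note t = is_treeD[OF T]
  obtain k p where kp: "potential T k p edge_gen" using is_tree_potential[OF T] by blast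
  obtain k' q where kq': "potential T k' q shift" using is_tree_potential[OF T] by blast
  note side = potential_side[OF T kp] and edge = potential_edge[OF kp]
  have kk: "k' v = k v" if "v \<in> verts T" for v
    using potential_side(1)[OF T kp that] potential_side(1)[OF T kq' that] by simp
  have edgeD: "(lab T a, lab T b) \<in> D_content x n" if "(a, b) \<in> adj T" "k a" for a b
  proof -
    have "a \<in> verts T" "b \<in> verts T" "\<not> k b" using that t(2) edge(1) by auto
    then have "(lab T a, lab T b) \<in> pre_c2 T"
      using that side unfolding pre_c2_def by blast
    then show ?thesis using D by simp
  qed
  have "(lab T (lroot T), lab T (lroot T)) \<in> D_content x n"
    unfolding D[symmetric] pre_c2_def using t(8) by blast
  then have "\<exists>i. lab T (lroot T) = \<xi> i" unfolding edge_in_D_iff by blast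
  then obtain l where l: "lab T (lroot T) = \<xi> l" "1 \<le> l" "l \<le> 2 * int n"
    using ex_xi_representative by metis
  define \<iota> where "\<iota> v = l + q v" for v
  have \<iota>l: "\<iota> (lroot T) = l" using kq' by (simp add: \<iota>_def potential_def)
  have \<iota>_step: "\<iota> b = \<iota> a + shift (lab T a) (lab T b)" if "(a, b) \<in> adj T" "k a" for a b
    using potential_edge(2)[OF kq' that(1)] kk[of a] that t(2) by (auto simp: \<iota>_def)
  have p_step: "p b = p a + edge_gen (lab T a) (lab T b)" if "(a, b) \<in> adj T" "k a" for a b
    by (rule edge(2)) (rule that)+
  have inv: "lab T v = \<xi> (\<iota> v) \<and> p v = - line \<xi> l + line \<xi> (\<iota> v)" if "v \<in> verts T" for v
    using t(5)[OF t(8) that]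
  proof (induction rule: rtrancl_induct)
    case base
    then show ?case using l(1) \<iota>l kp by (simp add: potential_def)
  next
    case (step y z)
    show ?case
    proof (cases "k y")
      case True
      have pz: "p z = p y + edge_gen (lab T y) (lab T z)" and iz: "\<iota> z = \<iota> y + shift (lab T y) (lab T z)"
        by (rule p_step[OF step(2) True], rule \<iota>_step[OF step(2) True])
      from shift_cases[OF edgeD[OF step(2) True]] show ?thesis
      proof (elim disjE exE conjE)
        assume "lab T y = lab T z" "shift (lab T y) (lab T z) = 0"
        then show ?thesis using step.IH pz iz by simp
      next
        fix i assume i: "odd i" "lab T y = \<xi> i" "lab T z = \<xi> (i + shift (lab T y) (lab T z))"
          and s: "shift (lab T y) (lab T z) \<in> {1, -1}"
        let ?s = "shift (lab T y) (lab T z)"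
        have e: "\<xi> (\<iota> y) = \<xi> i" using step.IH i(2) by simp
        have z: "lab T z = \<xi> (\<iota> z)" unfolding iz using i(3) xi_add_cong[OF e, of ?s] by simp
        have "ok_roots (\<iota> y) (\<iota> z)" unfolding iz using xi_odd[OF e] i(1) s by auto
        from arc_line[OF this, of \<xi>] have "line \<xi> (\<iota> z) = line \<xi> (\<iota> y) + edge_gen (lab T y) (lab T z)"
          using step.IH z by (simp add: arc_def)
        then show ?thesis using z pz step.IH by (simp add: add.assoc)
      qed
    next
      case False
      have zy: "(z, y) \<in> adj T" using step(2) t(3) by (auto simp: sym_def)
      then have kz: "k z" using edge(1) False by blast
      have py: "p y = p z + edge_gen (lab T z) (lab T y)" and iy: "\<iota> y = \<iota> z + shift (lab T z) (lab T y)"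
        by (rule p_step[OF zy kz], rule \<iota>_step[OF zy kz])
      from shift_cases[OF edgeD[OF zy kz]] show ?thesis
      proof (elim disjE exE conjE)
        assume e: "lab T z = lab T y" "shift (lab T z) (lab T y) = 0"
        have "\<iota> z = \<iota> y" using iy unfolding e(2) by (simp only: add_0_right)
        moreover have "p z = p y" using py unfolding e(1) edge_gen_same by (simp only: add_0_right)
        ultimately show ?thesis using step.IH by (simp only: e(1))
      next
        fix i assume i: "odd i" "lab T z = \<xi> i" "lab T y = \<xi> (i + shift (lab T z) (lab T y))"
          and s: "shift (lab T z) (lab T y) \<in> {1, -1}"
        let ?s = "shift (lab T z) (lab T y)"
        have "\<xi> (\<iota> y) = \<xi> (i + ?s)" using step.IH i(3) by simp
        from xi_add_cong[OF this, of "- ?s"] have e: "\<xi> (\<iota> z) = \<xi> i" using iy by simp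
        then have z: "lab T z = \<xi> (\<iota> z)" using i(2) by simp
        have "ok_roots (\<iota> z) (\<iota> y)" unfolding iy using xi_odd[OF e] i(1) s by auto
        from arc_line[OF this, of \<xi>] have "line \<xi> (\<iota> y) = line \<xi> (\<iota> z) + edge_gen (lab T z) (lab T y)"
          using step.IH z by (simp add: arc_def)
        then have "p z + edge_gen (lab T z) (lab T y) =
            (- line \<xi> l + line \<xi> (\<iota> z)) + edge_gen (lab T z) (lab T y)"
          using py step.IH by (simp add: add.assoc)
        then show ?thesis using z by (simp only: add_right_cancel)
      qed
    qed
  qed
  have nb: "ok_roots (\<iota> a) (\<iota> b)" if "(a, b) \<in> adj T" "k a" for a b
  proof -
    have "a \<in> verts T" using that t(2) by auto
    then have la: "lab T a = \<xi> (\<iota> a)" using inv by blast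
    from shift_cases[OF edgeD[OF that]] show ?thesis
    proof (elim disjE exE conjE)
      fix i assume "odd i" "lab T a = \<xi> i" and s: "shift (lab T a) (lab T b) \<in> {1, -1}"
      then have "odd (\<iota> a)" using la xi_odd[of "\<iota> a" i] by simp
      then show ?thesis unfolding \<iota>_step[OF that] using s by auto
    qed (simp add: \<iota>_step[OF that])
  qed
  let ?K = "\<iota> ` verts T"
  have K: "finite ?K" "?K \<noteq> {}" using t(1,8) by auto
  define a b where "a = Min ?K" and "b = Max ?K"
  have ab: "a \<in> ?K" "b \<in> ?K" using K by (simp_all add: a_def b_def)
  have sub: "\<iota> v \<in> {a..b}" if "v \<in> verts T" for v
    using K that by (simp add: a_def b_def)
  \<comment> \<open>The index changes by at most 1 along an edge, so no value between the ends can
    be skipped.\<close>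
  have "?K = {a..b}"
  proof (intro equalityI subsetI)
    fix i assume i: "i \<in> {a..b}"
    show "i \<in> ?K"
    proof (rule ccontr)
      assume no: "i \<notin> ?K"
      obtain u v where uv: "u \<in> verts T" "v \<in> verts T" "\<iota> u = a" "\<iota> v = b" using ab by auto
      have "\<iota> w < i" if "(u, w) \<in> (adj T)\<^sup>*" for w
        using that
      proof (induction rule: rtrancl_induct)
        case base
        have "a \<noteq> i" using no ab(1) by blast
        then show ?case using uv i by simp
      next
        case (step y z)
        have "(z, y) \<in> adj T" using step(2) t(3) by (auto simp: sym_def)
        then have "\<bar>\<iota> y - \<iota> z\<bar> \<le> 1" using nb[OF step(2)] nb[of z y] edge(1)[OF step(2)] by auto
        moreover have "\<iota> z \<noteq> i" using no step(2) t(2) by blast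
        ultimately show ?case using step.IH by linarith
      qed
      from this[OF t(5)[OF uv(1,2)]] show False using uv i by simp
    qed
  qed (use sub in auto)
  note K_eq = this
  have pm: "pre_model T = segment \<xi> l (\<iota> (rroot T)) a b"
  proof -
    have "(\<lambda>v. (p v, lab T v)) ` verts T = (\<lambda>i. (- line \<xi> l + line \<xi> i, \<xi> i)) ` ?K"
      unfolding image_image by (rule image_cong) (use inv in auto)
    then show ?thesis
      using l(1) inv[OF t(9)] unfolding pre_model_eq[OF T kp] placed_def K_eq[symmetric] by simp
  qed
  have ok: "ok_roots l (\<iota> (rroot T))" using nb[OF t(7)] kp \<iota>l by (simp add: potential_def)
  have "b - a \<ge> 2 * int n"
  proof (rule ccontr)
    assume short: "\<not> b - a \<ge> 2 * int n"
    \<comment> \<open>In a shorter interval the last label occurs at \<open>b\<close> only. The edge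
      of \<open>D_content\<close> joining it to the label \<open>\<xi> (b + 1)\<close> would then
      end at \<open>b + 1\<close>, which is outside, or at \<open>b - 1\<close>, which has another
      label.\<close>
    have at_b: "\<iota> v = b" if "v \<in> verts T" "lab T v = \<xi> b" for v
    proof -
      have "2 * int n dvd b - \<iota> v" using inv[OF that(1)] that(2) xi_eq_iff[of b "\<iota> v"] by simp
      then show ?thesis using small_dvd sub[OF that(1)] short by fastforce
    qed
    have "\<xi> (b + 1) \<noteq> \<xi> (b - 1)" using xi_neq[of 2 "b - 1"] by (simp add: algebra_simps)
    then have beyond: False if "v \<in> verts T" "lab T v = \<xi> (b + 1)" "\<iota> v = b + 1 \<or> \<iota> v = b - 1" for v
      using sub[OF that(1)] inv[OF that(1)] that(2,3) by auto
    have pairs: "\<exists>u v. (u, v) \<in> adj T \<and> k u \<and> lab T u = y \<and> lab T v = z"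
      if yz: "(y, z) \<in> D_content x n" "y \<noteq> z" for y z
    proof -
      have "(y, z) \<in> pre_c2 T" using yz(1) D by simp
      then obtain u v where uv: "(u, v) \<in> adj T" "left_vertex T u" "lab T u = y" "lab T v = z"
        unfolding pre_c2_def using yz(2) by auto
      then have "k u" using side(1)[of u] by (simp add: left_vertex_def)
      then show ?thesis using uv by blast
    qed
    have ne: "\<xi> (b + 1) \<noteq> \<xi> b" using xi_neq[of 1 b] by simp
    show False
    proof (cases "odd b")
      case True
      then have "(\<xi> b, \<xi> (b + 1)) \<in> D_content x n" unfolding edge_in_D_iff by blast
      from pairs[OF this ne[symmetric]] obtain u v where
        uv: "(u, v) \<in> adj T" "k u" "lab T u = \<xi> b" "lab T v = \<xi> (b + 1)" by blast
      then have v: "u \<in> verts T" "v \<in> verts T" using t(2) by auto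
      then have "\<iota> u = b" using at_b uv by blast
      moreover have "\<iota> v \<noteq> \<iota> u" using inv v uv ne by metis
      ultimately show False using nb[OF uv(1,2)] beyond[OF v(2) uv(4)] by auto
    next
      case False
      then have "(\<xi> (b + 1), \<xi> b) \<in> D_content x n"
        unfolding edge_in_D_iff by (intro disjI2 exI[of _ "b + 1"]) simp
      from pairs[OF this ne] obtain u v where
        uv: "(u, v) \<in> adj T" "k u" "lab T u = \<xi> (b + 1)" "lab T v = \<xi> b" by blast
      then have v: "u \<in> verts T" "v \<in> verts T" using t(2) by auto
      then have "\<iota> v = b" using at_b uv by blast
      moreover have "\<iota> v \<noteq> \<iota> u" using inv v uv ne by metis
      ultimately show False using nb[OF uv(1,2)] beyond[OF v(1) uv(3)] by auto
    qed
  qed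
  moreover have "l \<in> {a..b}" "\<iota> (rroot T) \<in> {a..b}" using sub[OF t(8)] sub[OF t(9)] \<iota>l by auto
  ultimately show ?thesis using that[OF ok l(2,3)] pm by blast
qed

section \<open>The special trees as intervals\<close>

lemma path_irreducible:
  assumes "\<And>a b. (a, b) \<in> adj T \<Longrightarrow> b = a + 1 \<or> a = b + 1"
    and "\<And>v. v \<in> verts T \<Longrightarrow> lab T v = \<xi> (int v)" and "is_tree T"
  shows "irreducible T"
proof -
  \<comment> \<open>Neighbours, and vertices with a common neighbour, are at most 2 apart, which
    \<open>xi_neq\<close> covers.\<close>
  have lab: "lab T a \<noteq> lab T b" if "a \<in> verts T" "b \<in> verts T" "a \<noteq> b" "\<bar>int a - int b\<bar> \<le> 2" for a b
    using xi_neq[of "int a - int b" "int b"] assms(2) that by simp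
  have V: "a \<in> verts T" "b \<in> verts T" if "(a, b) \<in> adj T" for a b
    using that is_treeD(2)[OF assms(3)] by auto
  have "\<not> foldable T u v" for u v
  proof
    assume "foldable T u v"
    then obtain w where w: "u \<noteq> v" "lab T u = lab T v" "(u, w) \<in> adj T" "(v, w) \<in> adj T"
      by (auto simp: foldable_def)
    then have "\<bar>int u - int v\<bar> \<le> 2" using assms(1)[of u w] assms(1)[of v w] by auto
    then show False using lab[of u v] w V by blast
  qed
  moreover have "\<not> nonessential_thorn T a" for a
  proof
    assume "nonessential_thorn T a"
    then obtain b where b: "(a, b) \<in> adj T" "lab T a = lab T b" by (auto simp: nonessential_thorn_def)
    then show False using lab[of a b] V[of a b] assms(1)[of a b] by auto
  qed
  ultimately show ?thesis by (simp add: irreducible_def)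
qed

text \<open>The offset \<open>d\<close> puts the left root at an odd position: 0 for the plain
  trees, 1 for the starred ones.\<close>

lemma path_model:
  fixes \<eta> :: "int \<Rightarrow> 'x"
  assumes adj: "\<And>a b. (a, b) \<in> adj T \<Longrightarrow> b = a + 1 \<or> a = b + 1"
    and lab: "\<And>v. v \<in> verts T \<Longrightarrow> lab T v = \<eta> (int v + d)" and T: "is_tree T"
    and v: "verts T = {lo..m}" and l: "odd (int (lroot T) + d)"
  shows "pre_model T = segment \<eta> (int (lroot T) + d) (int (rroot T) + d) (int lo + d) (int m + d)"
proof -
  note t = is_treeD[OF T]
  let ?l = "int (lroot T) + d"
  let ?k = "\<lambda>v. odd (int v + d)" and ?p = "\<lambda>v. - line \<eta> ?l + line \<eta> (int v + d)"
  have "potential T ?k ?p edge_gen"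
    unfolding potential_def
  proof (intro conjI allI impI)
    fix a b assume ab: "(a, b) \<in> adj T"
    show "?k a \<noteq> ?k b" using adj[OF ab] by auto
    assume "?k a"
    then have "ok_roots (int a + d) (int b + d)" using adj[OF ab] by auto
    from arc_line[OF this, of \<eta>] show "?p b = ?p a + edge_gen (lab T a) (lab T b)"
      using lab[of a] lab[of b] ab t(2) by (auto simp: arc_def add.assoc)
  qed (use l in simp_all)
  from pre_model_eq[OF T this]
  have "pre_model T = (\<eta> ?l, (\<lambda>v. (?p v, lab T v)) ` {lo..m}, \<eta> (int (rroot T) + d))"
    using lab t(8,9) v by simp
  also have "(\<lambda>v. (?p v, lab T v)) ` {lo..m} =
      (\<lambda>i. (- line \<eta> ?l + line \<eta> i, \<eta> i)) ` (\<lambda>v. int v + d) ` {lo..m}"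
    unfolding image_image by (rule image_cong) (use lab v in auto)
  also have "(\<lambda>v. int v + d) ` {lo..m} = {int lo + d..int m + d}"
  proof (intro equalityI subsetI)
    fix i assume "i \<in> {int lo + d..int m + d}"
    then have "i = int (nat (i - d)) + d" "nat (i - d) \<in> {lo..m}" by auto
    then show "i \<in> (\<lambda>v. int v + d) ` {lo..m}" by blast
  qed auto
  finally show ?thesis by (simp add: placed_def)
qed

lemma xi_of_nat: "p \<ge> 1 \<Longrightarrow> \<xi> (int p) = x ((p - 1) mod (2 * n) + 1)"
proof -
  assume "p \<ge> 1"
  then have "(int p - 1) mod (2 * int n) = int ((p - 1) mod (2 * n))"
    by (simp add: zmod_int of_nat_diff)
  then show ?thesis by (simp add: \<xi>_def)
qed

lemma special_tree_models:
  assumes m_def: "m = 2 * n * k + i" and m2: "m \<ge> 2"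
  shows "alpha x n k i \<in> A_X" "model (alpha x n k i) = segment \<xi> 1 2 1 (int m)"
    "beta x n k i \<in> A_X" "model (beta x n k i) = segment \<xi> 1 2 0 (int m)"
    "alpha_star x n k i \<in> A_X" "model (alpha_star x n k i) = segment \<xi>' 3 2 2 (int m + 1)"
    "beta_star x n k i \<in> A_X" "model (beta_star x n k i) = segment \<xi>' 3 2 1 (int m + 1)"
proof -
  let ?A = "pre_alpha x n k i" and ?B = "pre_beta x n k i"
  have A: "is_tree ?A" and B: "is_tree ?B" using is_tree_alpha is_tree_beta m2 by (simp_all add: m_def)
  have A': "is_tree (pre_swap ?A)" and B': "is_tree (pre_swap ?B)" using A B is_tree_swap by blast+
  have vA: "verts ?A = {1..m}" by (simp add: pre_alpha_def m_def)
  have vB: "verts ?B = {0..m}" using m2 by (auto simp: pre_beta_def Let_def vA)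
  have aA: "b = a + 1 \<or> a = b + 1" if "(a, b) \<in> adj ?A" for a b
    using that by (auto simp: pre_alpha_def)
  have aB: "b = a + 1 \<or> a = b + 1" if "(a, b) \<in> adj ?B" for a b
    using that aA[of a b] by (auto simp: pre_beta_def Let_def)
  have lA: "lab ?A v = \<xi> (int v)" if "v \<in> verts ?A" for v
    using that xi_of_nat[of v] by (simp add: vA pre_alpha_def)
  have lB: "lab ?B v = \<xi> (int v)" if "v \<in> verts ?B" for v
  proof (cases "v = 0")
    case True
    then show ?thesis using xi_nat[of "2 * n"] xi_shift[of 0 1] n2 by (simp add: pre_beta_def Let_def)
  next
    case False
    then show ?thesis using that lA[of v] by (simp add: pre_beta_def Let_def vA vB)
  qed
  have roots: "lroot ?A = 1" "rroot ?A = 2" "lroot ?B = 1" "rroot ?B = 2"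
    by (simp_all add: pre_alpha_def pre_beta_def Let_def)
  have sw: "verts (pre_swap T) = verts T" "adj (pre_swap T) = adj T" "lab (pre_swap T) = lab T"
    "lroot (pre_swap T) = rroot T" "rroot (pre_swap T) = lroot T" for T :: "'x rgraph"
    by (simp_all add: pre_swap_def)
  have star: "alpha_star x n k i = abs_birooted (pre_swap ?A)" "beta_star x n k i = abs_birooted (pre_swap ?B)"
    using swap_roots.abs_eq[OF tree_iso_refl[OF A]] swap_roots.abs_eq[OF tree_iso_refl[OF B]]
    by (simp_all add: alpha_star_def beta_star_def alpha_def beta_def)
  show "alpha x n k i \<in> A_X" "beta x n k i \<in> A_X" "alpha_star x n k i \<in> A_X" "beta_star x n k i \<in> A_X"
    using path_irreducible[of ?A] path_irreducible[of ?B]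
      path_irreducible[of "pre_swap ?A"] path_irreducible[of "pre_swap ?B"] aA aB lA lB A B A' B'
    unfolding star by (simp_all add: A_X_def alpha_def beta_def reduced_iff sw)
  show "model (alpha x n k i) = segment \<xi> 1 2 1 (int m)"
    using path_model[of ?A \<xi> 0 1 m, OF aA _ A vA] lA by (simp add: alpha_def model_abs[OF A] roots)
  show "model (beta x n k i) = segment \<xi> 1 2 0 (int m)"
    using path_model[of ?B \<xi> 0 0 m, OF aB _ B vB] lB by (simp add: beta_def model_abs[OF B] roots)
  \<comment> \<open>With offset 1 the left root, vertex 2, lies at 3 and the right root, vertex 1,
    at 2.\<close>
  show "model (alpha_star x n k i) = segment \<xi>' 3 2 2 (int m + 1)"
    using path_model[of "pre_swap ?A" \<xi>' 1 1 m] aA lA A' vA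
    by (simp add: star model_abs[OF A'] sw roots \<xi>'_def)
  show "model (beta_star x n k i) = segment \<xi>' 3 2 1 (int m + 1)"
    using path_model[of "pre_swap ?B" \<xi>' 1 0 m] aB lB B' vB
    by (simp add: star model_abs[OF B'] sw roots \<xi>'_def)
qed

end

text \<open>Both labellings have the same period, so the identity on positions is a relabelling in
  either direction.\<close>

lemma (in cyclic_congruence) starred_iff:
  "R (placed (line \<xi>') \<xi>' l r V) (placed (line \<xi>') \<xi>' l r W) \<longleftrightarrow>
   R (placed (line \<xi>) \<xi> l r V) (placed (line \<xi>) \<xi> l r W)"
proof -
  have ok: "ok_roots i (i + 1) \<and> ok_roots i (i - 1)" if "odd i" for i :: int using that by simp
  have 1: "\<xi> i = \<xi> j" if "\<xi>' i = \<xi>' j" for i j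
    using xi_add_cong[of "i - 1" "j - 1" 1] that by (simp add: \<xi>'_def)
  have 2: "\<xi>' i = \<xi>' j" if "\<xi> i = \<xi> j" for i j
    using xi_add_cong[of i j "-1"] that by (simp add: \<xi>'_def)
  show ?thesis
    using R_relabel[of \<xi>' \<xi> "\<lambda>i. i", OF 1 ok] R_relabel[of \<xi> \<xi>' "\<lambda>i. i", OF 2 ok] by auto
qed

section \<open>Fully invariant congruences and their rules\<close>

locale fic = cyclic_letters x n for x :: "nat \<Rightarrow> 'x" and n +
  fixes \<theta> :: "('x birooted \<times> 'x birooted) set"
  assumes cong: "congruence \<theta>" and inv: "fully_invariant \<theta>"

sublocale fic \<subseteq> cyclic_congruence x n "model_rel \<theta>"
  using model_congruence_rel[OF cong inv] by (simp add: cyclic_congruence_def cyclic_letters_axioms)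

context fic
begin

lemma alpha_beta_iff:
  assumes "m = 2 * n * k + i" "m \<ge> 2"
  shows "(alpha x n k i, beta x n k i) \<in> \<theta> \<longleftrightarrow> rule 1 (int m)"
  using special_tree_models[OF assms] model_rel_iff[OF cong, of "alpha x n k i" "beta x n k i"]
    linked_iff[of 1 2 1 "int m" 0 "int m"] assms(2)
  by (simp add: rule_def)

lemma alpha_beta_star_iff:
  assumes "m = 2 * n * k + i" "m \<ge> 2"
  shows "(alpha_star x n k i, beta_star x n k i) \<in> \<theta> \<longleftrightarrow> rule 2 (int m)"
  using special_tree_models[OF assms] model_rel_iff[OF cong, of "alpha_star x n k i" "beta_star x n k i"]
    linked_iff[of 3 2 2 "int m + 1" 1 "int m + 1"] assms(2)
  by (simp add: rule_def starred_iff add.commute)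

end

context cyclic_letters
begin

lemma fst_model: "fst (model \<alpha>) = left_label \<alpha>" and snd_model: "snd (snd (model \<alpha>)) = right_label \<alpha>"
proof -
  obtain S where "is_tree S" "\<alpha> = abs_birooted S" using abs_birooted_cases by blast
  then show "fst (model \<alpha>) = left_label \<alpha>" "snd (snd (model \<alpha>)) = right_label \<alpha>"
    by (simp_all add: model_abs left_label.abs_eq right_label.abs_eq tree_iso_refl pre_model_def Let_def)
qed

text \<open>Equal root labels give equal root indices: the left roots lie in one period, and the
  right roots then differ by at most 2, less than the period.\<close>

lemma rho_pair_segments:
  assumes "(\<alpha>, \<beta>) \<in> rho_SPS" "\<alpha> \<noteq> \<beta>" "c2 \<alpha> = D_content x n"
  obtains l r a b a' b' where "ok_roots l r" "l \<in> {a..b}" "r \<in> {a..b}" "l \<in> {a'..b'}" "r \<in> {a'..b'}"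
    "b - a \<ge> 2 * int n" "b' - a' \<ge> 2 * int n" "(a, b) \<noteq> (a', b')"
    "model \<alpha> = segment \<xi> l r a b" "model \<beta> = segment \<xi> l r a' b'"
proof -
  have red: "reduced \<alpha>" "reduced \<beta>" and c: "c2 \<beta> = D_content x n"
    and lab: "left_label \<alpha> = left_label \<beta>" "right_label \<alpha> = right_label \<beta>"
    using assms by (auto simp: rho_SPS_def A_X_def)
  obtain S T where ST: "is_tree S" "\<alpha> = abs_birooted S" "is_tree T" "\<beta> = abs_birooted T"
    using abs_birooted_cases by metis
  have "pre_c2 S = D_content x n" "pre_c2 T = D_content x n"
    using ST assms(3) c by (simp_all add: c2.abs_eq tree_iso_refl)
  note D = this
  from cyclic_tree_segment[OF ST(1) D(1)] obtain l r a b where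
    1: "ok_roots l r" "1 \<le> l" "l \<le> 2 * int n" "l \<in> {a..b}" "r \<in> {a..b}"
      "b - a \<ge> 2 * int n" "model \<alpha> = segment \<xi> l r a b"
    unfolding ST(2) model_abs[OF ST(1)] .
  from cyclic_tree_segment[OF ST(3) D(2)] obtain l' r' a' b' where
    2: "ok_roots l' r'" "1 \<le> l'" "l' \<le> 2 * int n" "l' \<in> {a'..b'}" "r' \<in> {a'..b'}"
      "b' - a' \<ge> 2 * int n" "model \<beta> = segment \<xi> l' r' a' b'"
    unfolding ST(4) model_abs[OF ST(3)] .
  have "\<xi> l = \<xi> l'" "\<xi> r = \<xi> r'"
    using lab fst_model[of \<alpha>] fst_model[of \<beta>] snd_model[of \<alpha>] snd_model[of \<beta>] 1(7) 2(7)
    by (simp_all add: placed_def)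
  then have l: "l = l'" using small_dvd[of "l - l'"] 1(2,3) 2(2,3) by (simp add: xi_eq_iff)
  have "\<bar>r - r'\<bar> \<le> 2" using 1(1) 2(1) l by auto
  then have r: "r = r'" using small_dvd[of "r - r'"] \<open>\<xi> r = \<xi> r'\<close> n2 by (simp add: xi_eq_iff)
  have "(a, b) \<noteq> (a', b')" using model_inj[OF red] assms(2) 1(7) 2(7) l r by auto
  then show ?thesis using that[OF 1(1,4,5) _ _ 1(6) 2(6) _ 1(7)] 2 l r by simp
qed

text \<open>\<open>N\<close> comes from the two intervals alone and serves every \<theta> at once,
  which allows sets of pairs to be compared through their rules.\<close>

lemma rho_pair_rules:
  assumes "(\<alpha>, \<beta>) \<in> rho_SPS" "\<alpha> \<noteq> \<beta>" "c2 \<alpha> = D_content x n"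
  obtains N where "N \<noteq> {}" "\<And>e m. (e, m) \<in> N \<Longrightarrow> 2 * int n + 1 \<le> m"
    "\<And>\<theta>. fic x n \<theta> \<Longrightarrow>
      (\<alpha>, \<beta>) \<in> \<theta> \<longleftrightarrow> (\<forall>(e, m) \<in> N. cyclic_congruence.rule x n (model_rel \<theta>) e m)"
proof -
  from assms(1) have AX: "\<alpha> \<in> A_X" "\<beta> \<in> A_X" by (auto simp: rho_SPS_def)
  from rho_pair_segments[OF assms] obtain l r a b a' b' where *: "ok_roots l r" "l \<in> {a..b}" "r \<in> {a..b}"
    "l \<in> {a'..b'}" "r \<in> {a'..b'}" "b - a \<ge> 2 * int n" "b' - a' \<ge> 2 * int n" "(a, b) \<noteq> (a', b')"
    "model \<alpha> = segment \<xi> l r a b" "model \<beta> = segment \<xi> l r a' b'" by metis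
  show ?thesis
  proof (rule that[of "interval_rules a b a' b'"])
    let ?N = "interval_rules a b a' b'"
    have "a' < a \<Longrightarrow> (a, b - a + 1) \<in> ?N" "a < a' \<Longrightarrow> (a', b' - a' + 1) \<in> ?N"
      "b < b' \<Longrightarrow> (b, b - a + 1) \<in> ?N" "b' < b \<Longrightarrow> (b', b' - a' + 1) \<in> ?N"
      by (simp_all add: interval_rules_def)
    moreover have "a' < a \<or> a < a' \<or> b < b' \<or> b' < b" using *(8) by auto
    ultimately show "?N \<noteq> {}" by blast
    show "2 * int n + 1 \<le> m" if "(e, m) \<in> interval_rules a b a' b'" for e m
      using that *(6,7) unfolding interval_rules_def by auto
    fix \<theta> :: "('x birooted \<times> 'x birooted) set" assume "fic x n \<theta>"
    then interpret fic x n \<theta> .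
    show "(\<alpha>, \<beta>) \<in> \<theta> \<longleftrightarrow> (\<forall>(e, m) \<in> interval_rules a b a' b'. rule e m)"
      using model_rel_iff[OF cong AX] linked_iff[OF *(1,2,4,3,5)] linked_rules_iff[OF *(2,4)] *(9,10) by simp
  qed
qed

end

text \<open>A generated congruence is the intersection of the fully invariant congruences containing
  the set.\<close>

lemma equivalent_pairsI:
  assumes "\<And>\<theta>. congruence \<theta> \<Longrightarrow> fully_invariant \<theta> \<Longrightarrow> I \<subseteq> \<theta> \<longleftrightarrow> J \<subseteq> \<theta>"
  shows "equivalent_pairs I J"
proof -
  have "{\<theta>. congruence \<theta> \<and> fully_invariant \<theta> \<and> I \<subseteq> \<theta>} = {\<theta>. congruence \<theta> \<and> fully_invariant \<theta> \<and> J \<subseteq> \<theta>}"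
    using assms by blast
  then show ?thesis by (simp add: equivalent_pairs_def fic_generated_def)
qed

theorem proposition3p8:
  fixes x :: "nat \<Rightarrow> 'x::{countable, infinite}"
    and n :: nat
    and I :: "('x birooted \<times> 'x birooted) set"
  assumes "inj_on x {1..}"
    and "n \<ge> 2"
    and "I \<noteq> {}"
    and "I \<subseteq> rho_SPS"
    and "\<And>\<alpha> \<beta>. (\<alpha>, \<beta>) \<in> I \<Longrightarrow> \<alpha> \<noteq> \<beta> \<and> c2 \<alpha> = D_content x n"
  shows "(\<exists>p\<in>I_pairs x n. equivalent_pairs I {p}) \<or>
    (\<exists>k i. k \<ge> 1 \<and> 1 \<le> i \<and> i \<le> 2 * n \<and> odd i \<and>
      equivalent_pairs I
        {(alpha x n k i, beta x n k i), (alpha_star x n k i, beta_star x n k i)})"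
proof -
  interpret cyclic_letters x n using assms(1,2) by unfold_locales
  have fic: "fic x n \<theta>" if "congruence \<theta>" "fully_invariant \<theta>" for \<theta>
    using that cyclic_letters_axioms by (simp add: fic_def fic_axioms_def)
  let ?rule = "\<lambda>\<theta>. cyclic_congruence.rule x n (model_rel \<theta>)"
  have "\<exists>N. N \<noteq> {} \<and> (\<forall>(e, m) \<in> N. 2 * int n + 1 \<le> m) \<and>
      (\<forall>\<theta>. fic x n \<theta> \<longrightarrow> q \<in> \<theta> \<longleftrightarrow> (\<forall>(e, m) \<in> N. ?rule \<theta> e m))" if "q \<in> I" for q
  proof -
    obtain \<alpha> \<beta> where q: "q = (\<alpha>, \<beta>)" by (cases q)
    show ?thesis using rho_pair_rules[of \<alpha> \<beta>] assms(4,5) that unfolding q by (smt (verit) case_prodI2 subsetD)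
  qed
  then obtain N where N: "\<And>q. q \<in> I \<Longrightarrow> N q \<noteq> {}"
      "\<And>q e m. q \<in> I \<Longrightarrow> (e, m) \<in> N q \<Longrightarrow> 2 * int n + 1 \<le> m"
      "\<And>q \<theta>. q \<in> I \<Longrightarrow> fic x n \<theta> \<Longrightarrow> q \<in> \<theta> \<longleftrightarrow> (\<forall>(e, m) \<in> N q. ?rule \<theta> e m)"
    by (metis (no_types, lifting) case_prodD)
  \<comment> \<open>\<open>I\<close> may be infinite, but its demands are ordered by size, and a
    least size exists.\<close>
  define M where "M = (\<Union>q\<in>I. N q)"
  have M_iff: "I \<subseteq> \<theta> \<longleftrightarrow> (\<forall>(e, m) \<in> M. ?rule \<theta> e m)" if "fic x n \<theta>" for \<theta>
    using N(3)[OF _ that] unfolding M_def by blast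
  have M_ge: "2 * int n + 1 \<le> m" if "(e, m) \<in> M" for e m using that N(2) unfolding M_def by blast
  have "M \<noteq> {}" using assms(3) N(1) unfolding M_def by blast
  then obtain e0 m0 where e0: "(e0, m0) \<in> M" and min: "\<And>e m. (e, m) \<in> M \<Longrightarrow> m0 \<le> m"
  proof -
    obtain q where "q \<in> M" using \<open>M \<noteq> {}\<close> by blast
    from ex_has_least_nat[of "\<lambda>q. q \<in> M", OF this, of "\<lambda>q. nat (snd q)"] obtain q0 where
      q0: "q0 \<in> M" "\<And>q. q \<in> M \<Longrightarrow> nat (snd q0) \<le> nat (snd q)" by blast
    show ?thesis
    proof (rule that[of "fst q0" "snd q0"])
      fix e m assume em: "(e, m) \<in> M"
      then show "snd q0 \<le> m" using q0(2)[OF em] M_ge[OF em] by simp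
    qed (use q0 in simp)
  qed
  define m where "m = nat m0"
  have m0: "m0 = int m" "2 * n + 1 \<le> m" using M_ge[OF e0] by (auto simp: m_def)
  \<comment> \<open>Dividing \<open>m - 1\<close> instead of \<open>m\<close> puts \<open>i\<close>
    in the range from 1 to \<open>2 * n\<close>.\<close>
  define k i where "k = (m - 1) div (2 * n)" and "i = (m - 1) mod (2 * n) + 1"
  have m: "m = 2 * n * k + i" using m0(2) mult_div_mod_eq[of "2 * n" "m - 1"] by (simp add: k_def i_def)
  have i: "1 \<le> i" "i \<le> 2 * n" using assms(2) by (simp_all add: i_def Suc_le_eq)
  have k: "k \<ge> 1" using m i(2) m0(2) by (cases k) auto
  have parity: "odd i \<longleftrightarrow> odd m" using m by simp
  have m2: "m \<ge> 2" using m0(2) assms(2) by linarith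
  let ?p = "(alpha x n k i, beta x n k i)" and ?p' = "(alpha_star x n k i, beta_star x n k i)"
  have p: "?p \<in> I_pairs x n" using i k unfolding I_pairs_def by blast
  have p': "?p' \<in> I_pairs x n" if "odd i" using i k that unfolding I_pairs_def by blast
  \<comment> \<open>The parities demanded at the least size.\<close>
  define od ev where "od \<longleftrightarrow> (\<exists>e. odd e \<and> (e, m0) \<in> M)" and "ev \<longleftrightarrow> (\<exists>e. even e \<and> (e, m0) \<in> M)"
  have "od \<or> ev" using e0 unfolding od_def ev_def by blast
  have I_iff: "I \<subseteq> \<theta> \<longleftrightarrow> (od \<longrightarrow> ?p \<in> \<theta>) \<and> (ev \<longrightarrow> ?p' \<in> \<theta>)"
    if "congruence \<theta>" "fully_invariant \<theta>" for \<theta>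
  proof -
    interpret fic x n \<theta> using fic that .
    have r: "rule e m0 \<longleftrightarrow> (if odd e then ?p \<in> \<theta> else ?p' \<in> \<theta>)" for e
      using alpha_beta_iff[OF m m2] alpha_beta_star_iff[OF m m2] rule_iff[of m0 e 1] rule_iff[of m0 e 2] m0
      by simp
    \<comment> \<open>Any one rule at size \<open>m0\<close> yields all rules at larger sizes, by
      \<open>rule_mono\<close>.\<close>
    have "(\<forall>(e, m) \<in> M. rule e m) \<longleftrightarrow> (\<forall>e. (e, m0) \<in> M \<longrightarrow> rule e m0)"
    proof
      assume a: "\<forall>e. (e, m0) \<in> M \<longrightarrow> rule e m0"
      then have r0: "rule e0 m0" using e0 by blast
      have "rule e m'" if "(e, m') \<in> M" for e m'
      proof (cases "m' = m0")
        case False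
        then have "m0 < m'" using min[OF that] by simp
        then show ?thesis using rule_mono[OF r0] M_ge[OF e0] by simp
      qed (use a that in blast)
      then show "\<forall>(e, m) \<in> M. rule e m" by blast
    qed blast
    then show ?thesis using M_iff[OF fic[OF that]] unfolding r od_def ev_def by auto
  qed
  have even_iff: "?p \<in> \<theta> \<longleftrightarrow> ?p' \<in> \<theta>" if "even i" "congruence \<theta>" "fully_invariant \<theta>" for \<theta>
  proof -
    interpret fic x n \<theta> using fic that(2,3) .
    show ?thesis using alpha_beta_iff[OF m m2] alpha_beta_star_iff[OF m m2]
        rule_even[of 1 "int m" 2] rule_even[of 2 "int m" 1] that(1) parity m2 by auto
  qed
  \<comment> \<open>For even \<open>i\<close>, hence even \<open>m\<close>, the two pairs are
    interchangeable by \<open>rule_even\<close>; for odd \<open>i\<close> the demanded parities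
    decide.\<close>
  consider (single) "even i \<or> \<not> ev" | (star) "odd i" "\<not> od" | (both) "odd i" "od" "ev" by blast
  then show ?thesis
  proof cases
    case single
    then have "equivalent_pairs I {?p}"
      using I_iff even_iff \<open>od \<or> ev\<close> by (intro equivalent_pairsI) (auto; blast)
    then show ?thesis using p by blast
  next
    case star
    then have "equivalent_pairs I {?p'}"
      using I_iff \<open>od \<or> ev\<close> by (intro equivalent_pairsI) auto
    then show ?thesis using p' star(1) by blast
  next
    case both
    then have "equivalent_pairs I {?p, ?p'}"
      using I_iff by (intro equivalent_pairsI) auto
    then show ?thesis using both(1) i k by blast
  qed
qed

end
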